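(* Let $M\subset \mathbb C^{n+1}$ be a connected real-analytic hypersurface and $U$ an open neighborhood of $M$ in $\mathbb C^{n+1}$. Let $M'\subset\mathbb C^{n'+1}$ be a nondegenerate hyperquadric. Suppose that $n'\le 3(n-e_0(M,p))$ for some point $p\in M$. If $H\colon U\to\mathbb C^{n'+1}$ is a holomorphic mapping with $H(M)\subset M'$, then one of the following two mutually exclusive conditions must hold: (i) There is an open subset $V\subset U$ with $M\subset V$ and $H(V)\subset M'$. (ii) $H$ is transversal to $M'$ at $H(p)$ for all $p\in M$ outside a proper real-analytic subset of $M$.
   Context: Hypersurface means real hypersurface. For a real-analytic hypersurface $M\subset\mathbb C^{n+1}$ with local defining function $\rho$ near $p\in M$ (real-valued, real-analytic, $d\rho\neq0$), the Levi form of $M$ at $p$ is represented by the hermitian form $\mathcal L(u,v)=\sum_{j,k}\rho_{Z_j\bar Z_k}(p)u_j\bar v_k$ restricted to the $n$-dimensional space $\{u\in\mathbb C^{n+1}:\sum_j\rho_{Z_j}(p)u_j=0\}$; $e_0(M,p)$ denotes the number of zero eigenvalues of $\mathcal L$ (independent of the choice of $\rho$). A hyperquadric in $\mathbb C^{n'+1}$ is a real-algebraic hypersurface defined by $\operatorname{Im} w'=\langle z',\bar z'\rangle$, $(z',w')\in\mathbb C^{n'}\times\mathbb C$, where $\langle\cdot,\bar\cdot\rangle$ is a hermitian form in $\mathbb C^{n'}$; it is nondegenerate if this form is nondegenerate. If $H$ is a holomorphic mapping from an open set $U\subset\mathbb C^{n+1}$ to $\mathbb C^{n'+1}$ and $M'$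 is a real hypersurface through $H(p)$, $p\in U$, then $H$ is transversal to $M'$ at $H(p)$ if $T_{H(p)}M'+dH(T_p\mathbb C^{n+1})=T_{H(p)}\mathbb C^{n'+1}$ (real tangent spaces; $dH$ taken at $p$). *)

theory Defs
  imports "HOL-Analysis.Analysis"
begin

(* Throughout, C^{n+1} is the type complex ^ 'm with CARD('m) = n + 1; this keeps n = 0 available. *)

section \<open>Real-analytic functions and hypersurfaces\<close>

text \<open>Local expansion into an unconditionally convergent power series in the real coordinates
  centred at \<open>p\<close>; the multi-indices are the extensional functions from \<open>Basis\<close> to \<open>nat\<close>.\<close>

definition real_analytic_on :: "('a::euclidean_space \<Rightarrow> real) \<Rightarrow> 'a set \<Rightarrow> bool" where
  "real_analytic_on f W \<longleftrightarrow>
     (\<forall>p\<in>W. \<exists>r>0. \<exists>c :: ('a \<Rightarrow> nat) \<Rightarrow> real. \<forall>x\<in>ball p r.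
        ((\<lambda>\<alpha>. c \<alpha> * (\<Prod>b\<in>Basis. ((x - p) \<bullet> b) ^ \<alpha> b)) has_sum f x) (Basis \<rightarrow>\<^sub>E UNIV))"

definition local_defining_function ::
    "'a::euclidean_space set \<Rightarrow> 'a \<Rightarrow> 'a set \<Rightarrow> ('a \<Rightarrow> real) \<Rightarrow> bool" where
  "local_defining_function M p W \<rho> \<longleftrightarrow>
     open W \<and> p \<in> W \<and> real_analytic_on \<rho> W \<and>
     (\<forall>x\<in>W. frechet_derivative \<rho> (at x) \<noteq> (\<lambda>_. 0)) \<and>
     M \<inter> W = {x \<in> W. \<rho> x = 0}"

text \<open>Hypersurfaces are embedded, but need not be closed in the ambient space.\<close>

definition real_analytic_hypersurface :: "'a::euclidean_space set \<Rightarrow> bool" where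
  "real_analytic_hypersurface M \<longleftrightarrow> (\<forall>p\<in>M. \<exists>W \<rho>. local_defining_function M p W \<rho>)"

text \<open>The local description is required near every point of \<open>M\<close>, not only near the points
  of \<open>A\<close>; in particular \<open>A\<close> is closed in \<open>M\<close>.\<close>

definition real_analytic_subset :: "'a::euclidean_space set \<Rightarrow> 'a set \<Rightarrow> bool" where
  "real_analytic_subset A M \<longleftrightarrow>
     A \<subseteq> M \<and>
     (\<forall>q\<in>M. \<exists>W F. open W \<and> q \<in> W \<and> finite F \<and> (\<forall>f\<in>F. real_analytic_on f W) \<and>
        A \<inter> W = {x \<in> M \<inter> W. \<forall>f\<in>F. f x = 0})"

section \<open>Levi form\<close>

definition d_Z :: "'m \<Rightarrow> (complex ^ 'm \<Rightarrow> complex) \<Rightarrow> complex ^ 'm::finite \<Rightarrow> complex" where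
  "d_Z j f p = (frechet_derivative f (at p) (axis j 1)
      - \<i> * frechet_derivative f (at p) (axis j \<i>)) / 2"

definition d_Zbar :: "'m \<Rightarrow> (complex ^ 'm \<Rightarrow> complex) \<Rightarrow> complex ^ 'm::finite \<Rightarrow> complex" where
  "d_Zbar j f p = (frechet_derivative f (at p) (axis j 1)
      + \<i> * frechet_derivative f (at p) (axis j \<i>)) / 2"

definition levi_form ::
    "(complex ^ 'm \<Rightarrow> real) \<Rightarrow> complex ^ 'm::finite \<Rightarrow> complex ^ 'm \<Rightarrow> complex ^ 'm \<Rightarrow> complex" where
  "levi_form \<rho> p u v =
     (\<Sum>j\<in>UNIV. \<Sum>k\<in>UNIV. d_Z j (d_Zbar k (\<lambda>z. complex_of_real (\<rho> z))) p * u $ j * cnj (v $ k))"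

definition levi_space ::
    "(complex ^ 'm \<Rightarrow> real) \<Rightarrow> complex ^ 'm::finite \<Rightarrow> (complex ^ 'm) set" where
  "levi_space \<rho> p = {u. (\<Sum>j\<in>UNIV. d_Z j (\<lambda>z. complex_of_real (\<rho> z)) p * u $ j) = 0}"

text \<open>Eigenvalues of the restricted form are taken with respect to the standard hermitian
  inner product, that is, they are those of its matrix in a unitary basis of \<open>levi_space \<rho> p\<close>.
  The matrix being hermitian, the multiplicity of an eigenvalue is the complex dimension of
  its eigenspace.\<close>

definition levi_eigenspace ::
    "(complex ^ 'm \<Rightarrow> real) \<Rightarrow> complex ^ 'm::finite \<Rightarrow> real \<Rightarrow> (complex ^ 'm) set" where
  "levi_eigenspace \<rho> p \<mu> =
     {u \<in> levi_space \<rho> p. \<forall>v\<in>levi_space \<rho> p.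
        levi_form \<rho> p u v = complex_of_real \<mu> * (\<Sum>j\<in>UNIV. u $ j * cnj (v $ j))}"

text \<open>The value does not depend on the chosen local defining function;
  \<open>vec.dim\<close> is the dimension over the field of scalars, here over the complex numbers.\<close>

definition e0 :: "(complex ^ 'm::finite) set \<Rightarrow> complex ^ 'm \<Rightarrow> nat" where
  "e0 M p = vec.dim (levi_eigenspace (SOME \<rho>. \<exists>W. local_defining_function M p W \<rho>) p 0)"

section \<open>Hyperquadrics\<close>

text \<open>The distinguished index \<open>k\<close> is the coordinate \<open>w'\<close>, the remaining indices
  are the coordinates of \<open>z'\<close>, and the hermitian form is given by its matrix \<open>A\<close>, of which
  only the entries with both indices different from \<open>k\<close> matter.\<close>

definition sesq_form ::
    "'k::finite \<Rightarrow> ('k \<Rightarrow> 'k \<Rightarrow> complex) \<Rightarrow> complex ^ 'k \<Rightarrow> complex ^ 'k \<Rightarrow> complex" where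
  "sesq_form k A x y = (\<Sum>i\<in>UNIV - {k}. \<Sum>j\<in>UNIV - {k}. A i j * x $ i * cnj (y $ j))"

definition hermitian_matrix :: "'k::finite \<Rightarrow> ('k \<Rightarrow> 'k \<Rightarrow> complex) \<Rightarrow> bool" where
  "hermitian_matrix k A \<longleftrightarrow> (\<forall>i j. i \<noteq> k \<longrightarrow> j \<noteq> k \<longrightarrow> A j i = cnj (A i j))"

definition nondegenerate_form :: "'k::finite \<Rightarrow> ('k \<Rightarrow> 'k \<Rightarrow> complex) \<Rightarrow> bool" where
  "nondegenerate_form k A \<longleftrightarrow>
     (\<forall>x. (\<forall>y. sesq_form k A x y = 0) \<longrightarrow> (\<forall>i. i \<noteq> k \<longrightarrow> x $ i = 0))"

definition nondegenerate_hyperquadric :: "(complex ^ 'k::finite) set \<Rightarrow> bool" where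
  "nondegenerate_hyperquadric M' \<longleftrightarrow>
     (\<exists>k A. hermitian_matrix k A \<and> nondegenerate_form k A \<and>
        M' = {x. complex_of_real (Im (x $ k)) = sesq_form k A x x})"

section \<open>Holomorphic mappings and transversality\<close>

definition holomorphic_map_on ::
    "(complex ^ 'm::finite \<Rightarrow> complex ^ 'k::finite) \<Rightarrow> (complex ^ 'm) set \<Rightarrow> bool" where
  "holomorphic_map_on H U \<longleftrightarrow>
     (\<forall>z\<in>U. \<exists>D. (H has_derivative D) (at z) \<and> (\<forall>c v. D (c *s v) = c *s D v))"

text \<open>Velocities at \<open>q\<close> of \<open>C\<^sup>1\<close> curves in \<open>S\<close>. Used only for hypersurfaces \<open>S\<close>
  (for arbitrary sets this need not be a linear space).\<close>

definition real_tangent_space :: "'a::real_normed_vector set \<Rightarrow> 'a \<Rightarrow> 'a set" where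
  "real_tangent_space S q =
     {v. \<exists>\<gamma> \<epsilon>. \<epsilon> > (0::real) \<and> \<gamma> C1_differentiable_on {-\<epsilon><..<\<epsilon>} \<and> \<gamma> ` {-\<epsilon><..<\<epsilon>} \<subseteq> S \<and>
        \<gamma> 0 = q \<and> (\<gamma> has_vector_derivative v) (at 0)}"

definition transversal_at ::
    "('a::real_normed_vector \<Rightarrow> 'b::real_normed_vector) \<Rightarrow> 'b set \<Rightarrow> 'a \<Rightarrow> bool" where
  "transversal_at H M' p \<longleftrightarrow>
     {a + b | a b. a \<in> real_tangent_space M' (H p) \<and> b \<in> range (frechet_derivative H (at p))} = UNIV"

end

theory Submission
  imports Defs "HOL-Complex_Analysis.Complex_Analysis"
begin

no_notation fps_nth (infixl "$" 75)

text \<open>Let \<open>\<phi>\<close> be the defining function of the hyperquadric composed with \<open>H\<close>. At points of \<open>M\<close>,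
  transversality means \<open>d\<phi> \<noteq> 0\<close>, so the points where it fails form a real-analytic subset of \<open>M\<close>, and the
  task is to show that \<open>\<phi>\<close> vanishes near \<open>M\<close> once \<open>d\<phi>\<close> vanishes along \<open>M\<close>. Otherwise \<open>\<phi>\<close> vanishes along
  \<open>M\<close> near some \<open>p \<in> M\<close> exactly to an order \<open>m \<ge> 2\<close>, and after rescaling, with weight 1 for the Levi space and
  weight 2 for the transverse coordinate \<open>w\<close>, its leading part is \<open>C (Re w + L(u,u))\<^sup>m\<close> with \<open>L\<close> the Levi form.
  Since \<open>\<phi> = Im H\<^sub>k - \<langle>H,H\<rangle>\<close>, the mixed Taylor coefficients of this power are, up to sign, Gram products
  of Taylor coefficients of \<open>H\<close>. For a Levi form of rank \<open>r\<close> the monomials \<open>w\<close>, \<open>u\<^sub>j\<close>, \<open>u\<^sub>j\<^sup>2\<close>, \<open>u\<^sub>jw\<^sup>m\<^sup>-\<^sup>1\<close>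
  give a triangular Gram matrix with nonzero diagonal blocks, hence \<open>3r + 1\<close> independent vectors in
  \<open>\<complex>\<^sup>n\<^sup>'\<close>, contradicting \<open>n' \<le> 3r\<close>.\<close>

section \<open>Separately holomorphic functions\<close>

text \<open>The order m is minimised over all points of M near the given one, so that every
  transverse derivative of lower order vanishes along M and not just at one point; this makes the
  leading part a pure m-th power. The price is that the minimum may be attained away from the point
  where the Levi rank is known, so the rank bound has to persist nearby. Im H_k is the sum of a
  holomorphic and an antiholomorphic term, so a mixed coefficient of \<phi> is built from pairings
  of Taylor coefficients of H alone. No monomials are extracted: the part of H of weight a is
  evaluated at (u,w), and the points (0,1), (u,0), (u,1) play the roles of w, of u and u^2, and of u
  w^(m-1). Pairings of weights a and b vanish for a + b < 2m and are coefficients of the m-th power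
  for a + b = 2m; testing against complementary weights gives the triangular shape. The block of u^2
  carries the factor m choose 2, which is where m >= 2 enters. The k-th coordinate direction pairs
  to zero with everything, so the vectors are counted in n' and not in n' + 1 dimensions.\<close>

lemma Cauchy_coeff_bound:
  assumes hol: "f holomorphic_on ball 0 R" and R: "0 < R"
    and bd: "\<And>z. cmod z < R \<Longrightarrow> cmod (f z) \<le> M"
  shows "cmod ((deriv ^^ n) f 0 / fact n) \<le> M / R ^ n"
proof -
  let ?c = "cmod ((deriv ^^ n) f 0 / fact n)"
  \<comment> \<open>Nothing is assumed on the boundary circle, so the estimate is made for radii r <
    R and passed to the limit.\<close>
  have *: "?c * r ^ n \<le> M" if r: "0 < r" "r < R" for r
  proof -
    have "cmod ((deriv ^^ n) f 0) \<le> fact n * M / r ^ n"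
    proof (rule Cauchy_inequality)
      show "f holomorphic_on ball 0 r"
        by (rule holomorphic_on_subset[OF hol]) (use r in auto)
      show "continuous_on (cball 0 r) f"
        by (rule holomorphic_on_imp_continuous_on[OF holomorphic_on_subset[OF hol]]) (use r in auto)
    qed (use r bd in auto)
    then show ?thesis
      using r by (simp add: norm_divide field_simps)
  qed
  have "((\<lambda>r. ?c * r ^ n) \<longlongrightarrow> ?c * R ^ n) (at_left R)"
    by (intro tendsto_intros)
  moreover have "eventually (\<lambda>r. ?c * r ^ n \<le> M) (at_left R)"
    using eventually_at_left_real[OF R] by eventually_elim (use * in auto)
  ultimately have "?c * R ^ n \<le> M"
    by (rule tendsto_upperbound) simp
  then show ?thesis
    using R by (simp add: field_simps)
qed

text \<open>The quotient on the left is computed from values of f and lower coefficients only, and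
  the error depends on f only through M, which gives uniformity in families. The factor 2 sums the
  geometric series of ratio 1/2 available for |z| <= R/2.\<close>

lemma coeff_remainder_bound:
  assumes hol: "f holomorphic_on ball 0 R" and R: "0 < R" and M: "0 \<le> M"
    and bd: "\<And>z. cmod z < R \<Longrightarrow> cmod (f z) \<le> M"
    and z: "z \<noteq> 0" "cmod z \<le> R / 2"
  shows "cmod ((f z - (\<Sum>k<n. (deriv ^^ k) f 0 / fact k * z ^ k)) / z ^ n - (deriv ^^ n) f 0 / fact n)
         \<le> cmod z * (2 * M / R ^ Suc n)"
proof -
  define c where "c k = (deriv ^^ k) f 0 / fact k" for k
  have "(\<lambda>k. c k * (z - 0) ^ k) sums f z"
    unfolding c_def by (rule holomorphic_power_series[OF hol]) (use z R in auto)
  then have s: "(\<lambda>k. c k * z ^ k) sums f z" by simp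
  have "(\<lambda>k. c (k + Suc n) * z ^ (k + Suc n)) sums (f z - (\<Sum>k<Suc n. c k * z ^ k))"
    using sums_split_initial_segment[OF s, of "Suc n"] by simp
  then have "(\<lambda>k. c (k + Suc n) * z ^ (k + Suc n) / z ^ n) sums ((f z - (\<Sum>k<Suc n. c k * z ^ k)) / z ^ n)"
    by (rule sums_divide)
  moreover have "(f z - (\<Sum>k<Suc n. c k * z ^ k)) / z ^ n = (f z - (\<Sum>k<n. c k * z ^ k)) / z ^ n - c n"
    using z by (simp add: field_simps)
  ultimately have s2: "(\<lambda>k. c (k + Suc n) * z ^ (k + Suc n) / z ^ n) sums
      ((f z - (\<Sum>k<n. c k * z ^ k)) / z ^ n - c n)"
    by simp
  have b: "cmod (c (k + Suc n) * z ^ (k + Suc n) / z ^ n) \<le> (cmod z * (M / R ^ Suc n)) * (1/2) ^ k" for k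
  proof -
    have e: "c (k + Suc n) * z ^ (k + Suc n) / z ^ n = c (k + Suc n) * z * z ^ k"
      using z by (simp add: power_add)
    have "cmod (c (k + Suc n)) \<le> M / R ^ (k + Suc n)"
      unfolding c_def by (rule Cauchy_coeff_bound[OF hol R bd])
    moreover have "cmod z ^ k \<le> (R / 2) ^ k"
      using z by (intro power_mono) auto
    ultimately have "cmod (c (k + Suc n)) * cmod z ^ k \<le> (M / R ^ (k + Suc n)) * (R / 2) ^ k"
      using M R by (intro mult_mono) auto
    also have "\<dots> = (M / R ^ Suc n) * (1/2) ^ k"
      using R by (simp add: power_add power_divide field_simps)
    finally have "cmod z * (cmod (c (k + Suc n)) * cmod z ^ k) \<le> cmod z * ((M / R ^ Suc n) * (1/2) ^ k)"
      by (intro mult_left_mono) auto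
    then show ?thesis
      unfolding e norm_mult norm_power by (simp add: mult_ac)
  qed
  have g: "(\<lambda>k. (cmod z * (M / R ^ Suc n)) * (1/2) ^ k) sums ((cmod z * (M / R ^ Suc n)) * 2)"
    using sums_mult[OF geometric_sums[of "1/2::real"], of "cmod z * (M / R ^ Suc n)"] by simp
  have "cmod ((f z - (\<Sum>k<n. c k * z ^ k)) / z ^ n - c n) \<le> (cmod z * (M / R ^ Suc n)) * 2"
    using norm_suminf_le[OF b sums_summable[OF g]]
    unfolding sums_unique[OF s2, symmetric] sums_unique[OF g, symmetric] .
  then show ?thesis
    unfolding c_def by (simp add: mult_ac)
qed

text \<open>By induction the n-th coefficient is a locally uniform limit of expressions in
  \<open>G s (z j)\<close> and lower coefficients, all holomorphic in s. Separate holomorphy and a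
  bound are enough; joint continuity of G never enters.\<close>

lemma coeff_holomorphic_in_parameter:
  fixes G :: "complex \<Rightarrow> complex \<Rightarrow> complex"
  assumes S: "open S" and R: "0 < R"
    and hol1: "\<And>z. cmod z < R \<Longrightarrow> (\<lambda>s. G s z) holomorphic_on S"
    and hol2: "\<And>s. s \<in> S \<Longrightarrow> G s holomorphic_on ball 0 R"
    and bd: "\<And>s z. s \<in> S \<Longrightarrow> cmod z < R \<Longrightarrow> cmod (G s z) \<le> M"
  shows "(\<lambda>s. (deriv ^^ n) (G s) 0 / fact n) holomorphic_on S"
proof (cases "S = {}")
  case False
  then obtain s0 where "s0 \<in> S" by auto
  then have M: "0 \<le> M" using bd[of s0 0] R by (metis norm_ge_zero norm_zero order_trans)
  show ?thesis
  proof (induction n rule: less_induct)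
    case (less n)
    \<comment> \<open>Nonzero points tending to 0 inside the half disc where the remainder estimate
      holds.\<close>
    define z where "z j = complex_of_real (R / 2 / real (Suc j))" for j
    have cz: "cmod (z j) = R / 2 / real (Suc j)" for j
      using R unfolding z_def norm_of_real by (intro abs_of_nonneg) simp
    have z0: "z j \<noteq> 0" for j
      using R cz[of j] by (metis divide_pos_pos norm_zero of_nat_0_less_iff order_less_irrefl zero_less_Suc zero_less_numeral)
    have zR: "cmod (z j) \<le> R / 2" for j unfolding cz using R by (simp add: field_simps)
    have zlim: "(\<lambda>j. cmod (z j) * (2 * M / R ^ Suc n)) \<longlonglongrightarrow> 0"
    proof -
      have "(\<lambda>j. R / 2 / real (Suc j)) \<longlonglongrightarrow> 0"
        by (rule lim_const_over_n [THEN LIMSEQ_Suc])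
      then show ?thesis unfolding cz by (rule tendsto_mult_left_zero)
    qed
    define f where "f j s = (G s (z j) - (\<Sum>k<n. (deriv ^^ k) (G s) 0 / fact k * z j ^ k)) / z j ^ n" for j s
    show ?case
    proof (rule holomorphic_uniform_sequence[OF S])
      show "f j holomorphic_on S" for j
      proof -
        have "cmod (z j) < R" using zR[of j] R by linarith
        then show ?thesis
          unfolding f_def using z0
          by (intro holomorphic_intros hol1 less.IH) auto
      qed
      fix x assume "x \<in> S"
      then obtain d where d: "d > 0" "cball x d \<subseteq> S"
        using S open_contains_cball by blast
      have "uniform_limit (cball x d) f (\<lambda>s. (deriv ^^ n) (G s) 0 / fact n) sequentially"
      proof (rule uniform_limitI)
        fix e :: real assume "e > 0"
        with zlim have "eventually (\<lambda>j. cmod (z j) * (2 * M / R ^ Suc n) < e) sequentially"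
          by (rule order_tendstoD)
        then show "\<forall>\<^sub>F j in sequentially. \<forall>s\<in>cball x d. dist (f j s) ((deriv ^^ n) (G s) 0 / fact n) < e"
        proof eventually_elim
          case (elim j)
          show ?case
          proof
            fix s assume "s \<in> cball x d"
            then have "s \<in> S" using d by auto
            have "dist (f j s) ((deriv ^^ n) (G s) 0 / fact n) \<le> cmod (z j) * (2 * M / R ^ Suc n)"
              unfolding f_def dist_norm
              by (rule coeff_remainder_bound[OF hol2[OF \<open>s \<in> S\<close>] R M bd[OF \<open>s \<in> S\<close>] z0 zR])
            then show "dist (f j s) ((deriv ^^ n) (G s) 0 / fact n) < e" using elim by simp
          qed
        qed
      qed
      then show "\<exists>d>0. cball x d \<subseteq> S \<and>
           uniform_limit (cball x d) f (\<lambda>s. (deriv ^^ n) (G s) 0 / fact n) sequentially"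
        using d by blast
    qed
  qed
qed (auto simp: holomorphic_on_def)

lemma bij_betw_multiindex_insert:
  assumes "b \<notin> B"
  shows "bij_betw (\<lambda>(a, \<beta>). \<beta>(b := a)) (UNIV \<times> (B \<rightarrow>\<^sub>E UNIV)) (insert b B \<rightarrow>\<^sub>E (UNIV :: nat set))"
proof -
  have "inj_on (\<lambda>(a, \<beta>). \<beta>(b := a)) (UNIV \<times> (B \<rightarrow>\<^sub>E (UNIV :: nat set)))"
  proof (rule inj_onI, clarify)
    fix a1 a2 :: nat and \<beta>1 \<beta>2
    assume h: "\<beta>1 \<in> B \<rightarrow>\<^sub>E (UNIV :: nat set)" "\<beta>2 \<in> B \<rightarrow>\<^sub>E (UNIV :: nat set)" "\<beta>1(b := a1) = \<beta>2(b := a2)"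
    have "\<beta>1 x = \<beta>2 x" for x
      using fun_cong[OF h(3), of x] PiE_arb[OF h(1) assms] PiE_arb[OF h(2) assms]
      by (cases "x = b") simp_all
    then show "a1 = a2 \<and> \<beta>1 = \<beta>2"
      using fun_cong[OF h(3), of b] by auto
  qed
  then show ?thesis
    unfolding bij_betw_def PiE_insert_eq by simp
qed

lemma multi_geometric_summable:
  fixes x :: "'b \<Rightarrow> real"
  assumes "finite B" "\<And>b. b \<in> B \<Longrightarrow> 0 \<le> x b \<and> x b < 1"
  shows "(\<lambda>\<alpha>. \<Prod>b\<in>B. x b ^ \<alpha> b) summable_on (B \<rightarrow>\<^sub>E (UNIV :: nat set))"
  using assms
proof (induction B rule: finite_induct)
  case (insert b B)
  let ?F = "\<lambda>\<alpha>. \<Prod>b\<in>insert b B. x b ^ \<alpha> b"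
  have e: "?F (\<beta>(b := a)) = x b ^ a * (\<Prod>b\<in>B. x b ^ \<beta> b)" for a \<beta>
  proof -
    have "(\<Prod>b'\<in>B. x b' ^ (\<beta>(b := a)) b') = (\<Prod>b'\<in>B. x b' ^ \<beta> b')"
      using insert.hyps by (intro prod.cong) auto
    then show ?thesis using insert.hyps by simp
  qed
  have IH: "(\<lambda>\<alpha>. \<Prod>b\<in>B. x b ^ \<alpha> b) summable_on (B \<rightarrow>\<^sub>E UNIV)"
    by (rule insert.IH) (use insert.prems in auto)
  have "(\<lambda>a. x b ^ a * infsum (\<lambda>\<alpha>. \<Prod>b\<in>B. x b ^ \<alpha> b) (B \<rightarrow>\<^sub>E UNIV)) summable_on UNIV"
  proof (rule summable_on_cmult_left)
    have "summable (\<lambda>n. norm (x b ^ n))"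
      unfolding norm_power using insert.prems by (intro summable_geometric) auto
    then show "(\<lambda>n. x b ^ n) summable_on UNIV"
      by (rule norm_summable_imp_summable_on)
  qed
  then have "(\<lambda>(a, \<beta>). ?F (\<beta>(b := a))) summable_on Sigma UNIV (\<lambda>_. B \<rightarrow>\<^sub>E UNIV)"
    unfolding e
    by (intro summable_on_SigmaI[where g = "\<lambda>a. x b ^ a * infsum (\<lambda>\<alpha>. \<Prod>b\<in>B. x b ^ \<alpha> b) (B \<rightarrow>\<^sub>E UNIV)"])
       (use insert.prems in \<open>auto intro!: has_sum_cmult_right has_sum_infsum[OF IH] mult_nonneg_nonneg prod_nonneg zero_le_power\<close>)
  then have "(\<lambda>p. ?F ((\<lambda>(a, \<beta>). \<beta>(b := a)) p)) summable_on UNIV \<times> (B \<rightarrow>\<^sub>E UNIV)"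
    by (simp add: case_prod_unfold)
  then show ?case
    by (rule iffD1[OF summable_on_reindex_bij_betw[OF bij_betw_multiindex_insert[OF insert.hyps(2)]]])
qed simp

text \<open>Points are functions on the whole index type, constrained only on B, so that an
  induction on B stays within one type.\<close>

definition polydisc :: "'b set \<Rightarrow> real \<Rightarrow> ('b \<Rightarrow> complex) set" where
  "polydisc B R = {s. \<forall>b\<in>B. cmod (s b) < R}"

text \<open>Induction on the set of variables: expansion in the new variable gives coefficients that
  are again separately holomorphic in the old ones, the a-th bounded by M / R^a. That h ignores
  coordinates outside B replaces working in a smaller space.\<close>

lemma separately_holomorphic_power_series:
  fixes h :: "('b \<Rightarrow> complex) \<Rightarrow> complex"
  assumes "finite B" "0 < R"
    and "\<And>s s'. (\<And>b. b \<in> B \<Longrightarrow> s b = s' b) \<Longrightarrow> h s = h s'"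
    and "\<And>s b. s \<in> polydisc B R \<Longrightarrow> b \<in> B \<Longrightarrow> (\<lambda>\<sigma>. h (s(b := \<sigma>))) holomorphic_on ball 0 R"
    and "\<And>s. s \<in> polydisc B R \<Longrightarrow> cmod (h s) \<le> M"
  shows "\<exists>c. (\<forall>\<alpha>. cmod (c \<alpha>) \<le> M / R ^ (\<Sum>b\<in>B. \<alpha> b)) \<and>
    (\<forall>s\<in>polydisc B R. ((\<lambda>\<alpha>. c \<alpha> * (\<Prod>b\<in>B. s b ^ \<alpha> b)) has_sum h s) (B \<rightarrow>\<^sub>E UNIV))"
  using assms
proof (induction B arbitrary: h M rule: finite_induct)
  case empty
  have "h s = h (\<lambda>_. 0)" for s by (rule empty.prems(2)) auto
  moreover have "cmod (h (\<lambda>_. 0)) \<le> M" by (rule empty.prems) (auto simp: polydisc_def)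
  ultimately show ?case
    by (intro exI[of _ "\<lambda>_. h (\<lambda>_. 0)"]) (auto intro!: has_sum_finiteI)
next
  case (insert b B)
  note R = \<open>0 < R\<close>
  define d where "d a s = (deriv ^^ a) (\<lambda>\<sigma>. h (s(b := \<sigma>))) 0 / fact a" for a s
  have upd: "s(b := \<sigma>) \<in> polydisc (insert b B) R" if "s \<in> polydisc B R" "cmod \<sigma> < R" for s \<sigma>
    using that insert.hyps by (auto simp: polydisc_def)
  have holb: "(\<lambda>\<sigma>. h (s(b := \<sigma>))) holomorphic_on ball 0 R" if "s \<in> polydisc B R" for s
    using insert.prems(3)[OF upd[OF that, of 0], of b] R by (simp only: fun_upd_upd norm_zero insertI1)
  have dB: "cmod (d a s) \<le> M / R ^ a" if "s \<in> polydisc B R" for a s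
    unfolding d_def
    by (rule Cauchy_coeff_bound[OF holb[OF that] R]) (rule insert.prems(4)[OF upd[OF that]])
  have "\<exists>c. (\<forall>\<beta>. cmod (c \<beta>) \<le> M / R ^ a / R ^ (\<Sum>b\<in>B. \<beta> b)) \<and>
    (\<forall>s\<in>polydisc B R. ((\<lambda>\<beta>. c \<beta> * (\<Prod>b\<in>B. s b ^ \<beta> b)) has_sum d a s) (B \<rightarrow>\<^sub>E UNIV))" for a
  proof (rule insert.IH[OF R])
    show "d a s = d a s'" if "\<And>b. b \<in> B \<Longrightarrow> s b = s' b" for s s'
    proof -
      have "(\<lambda>\<sigma>. h (s(b := \<sigma>))) = (\<lambda>\<sigma>. h (s'(b := \<sigma>)))"
        by (rule ext, rule insert.prems(2)) (use that in auto)
      then show ?thesis by (simp add: d_def)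
    qed
    show "cmod (d a s) \<le> M / R ^ a" if "s \<in> polydisc B R" for s
      by (rule dB[OF that])
    fix s b' assume s: "s \<in> polydisc B R" and b': "b' \<in> B"
    have ne: "b' \<noteq> b" using b' insert.hyps by auto
    have s': "s(b' := \<sigma>) \<in> polydisc B R" if "cmod \<sigma> < R" for \<sigma>
      using s that by (auto simp: polydisc_def)
    show "(\<lambda>\<sigma>. d a (s(b' := \<sigma>))) holomorphic_on ball 0 R"
      unfolding d_def
    proof (rule coeff_holomorphic_in_parameter[OF _ R])
      fix z assume "cmod z < R"
      then show "(\<lambda>\<sigma>. h ((s(b' := \<sigma>))(b := z))) holomorphic_on ball 0 R"
        unfolding fun_upd_twist[OF ne] using insert.prems(3)[OF upd[OF s, of z], of b'] b' by blast
    next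
      fix \<sigma> :: complex assume "\<sigma> \<in> ball 0 R"
      then have \<sigma>: "cmod \<sigma> < R" by simp
      show "(\<lambda>z. h ((s(b' := \<sigma>))(b := z))) holomorphic_on ball 0 R"
        by (rule holb[OF s'[OF \<sigma>]])
      show "cmod (h ((s(b' := \<sigma>))(b := z))) \<le> M" if "cmod z < R" for z
        by (rule insert.prems(4)[OF upd[OF s'[OF \<sigma>] that]])
    qed auto
  qed
  then have "\<exists>c. \<forall>a. (\<forall>\<beta>. cmod (c a \<beta>) \<le> M / R ^ a / R ^ (\<Sum>b\<in>B. \<beta> b)) \<and>
    (\<forall>s\<in>polydisc B R. ((\<lambda>\<beta>. c a \<beta> * (\<Prod>b\<in>B. s b ^ \<beta> b)) has_sum d a s) (B \<rightarrow>\<^sub>E UNIV))"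
    by (intro choice allI)
  then obtain c where c1: "\<And>a \<beta>. cmod (c a \<beta>) \<le> M / R ^ a / R ^ (\<Sum>b\<in>B. \<beta> b)"
    and c2: "\<And>a s. s \<in> polydisc B R \<Longrightarrow> ((\<lambda>\<beta>. c a \<beta> * (\<Prod>b\<in>B. s b ^ \<beta> b)) has_sum d a s) (B \<rightarrow>\<^sub>E UNIV)"
    by blast
  \<comment> \<open>The exponent of b selects the outer coefficient; resetting it to
    \<open>undefined\<close> restores an extensional multi-index on B.\<close>
  define C where "C \<alpha> = c (\<alpha> b) (\<alpha>(b := undefined))" for \<alpha>
  have "cmod (h (\<lambda>_. 0)) \<le> M" by (rule insert.prems) (use R in \<open>auto simp: polydisc_def\<close>)
  then have M: "0 \<le> M" by (metis norm_ge_zero order_trans)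
  have sumupd: "(\<Sum>b'\<in>B. (\<alpha>(b := x)) b') = (\<Sum>b'\<in>B. \<alpha> b')" for \<alpha> :: "'b \<Rightarrow> nat" and x
    using insert.hyps by (intro sum.cong) auto
  have C1: "cmod (C \<alpha>) \<le> M / R ^ (\<Sum>b\<in>insert b B. \<alpha> b)" for \<alpha>
    using c1[of "\<alpha> b" "\<alpha>(b := undefined)"] insert.hyps
    unfolding C_def sumupd by (simp add: power_add)
  have C2: "((\<lambda>\<alpha>. C \<alpha> * (\<Prod>b\<in>insert b B. s b ^ \<alpha> b)) has_sum h s) (insert b B \<rightarrow>\<^sub>E UNIV)"
    if s: "s \<in> polydisc (insert b B) R" for s
  proof -
    let ?F = "\<lambda>\<alpha>. C \<alpha> * (\<Prod>b\<in>insert b B. s b ^ \<alpha> b)"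
    let ?j = "\<lambda>(a, \<beta>). \<beta>(b := a)"
    have sB: "s \<in> polydisc B R" and sb: "cmod (s b) < R" using s by (auto simp: polydisc_def)
    \<comment> \<open>Absolute summability by a geometric majorant is what permits merging the
      iterated sum into one sum over multi-indices.\<close>
    have sumF: "?F summable_on (insert b B \<rightarrow>\<^sub>E UNIV)"
    proof (rule abs_summable_summable, rule Infinite_Sum.abs_summable_on_comparison_test')
      show "(\<lambda>\<alpha>. M * (\<Prod>b\<in>insert b B. (cmod (s b) / R) ^ \<alpha> b)) summable_on (insert b B \<rightarrow>\<^sub>E UNIV)"
        by (rule summable_on_cmult_right, rule multi_geometric_summable)
           (use insert.hyps R s in \<open>auto simp: polydisc_def\<close>)
      fix \<alpha>
      have "norm (?F \<alpha>) \<le> M / R ^ (\<Sum>b\<in>insert b B. \<alpha> b) * (\<Prod>b\<in>insert b B. cmod (s b) ^ \<alpha> b)"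
        unfolding norm_mult prod_norm[symmetric] norm_power
        by (rule mult_right_mono[OF C1]) (auto intro!: prod_nonneg)
      also have "\<dots> = M * (\<Prod>b\<in>insert b B. (cmod (s b) / R) ^ \<alpha> b)"
        by (simp add: power_divide prod_dividef power_sum)
      finally show "norm (?F \<alpha>) \<le> M * (\<Prod>b\<in>insert b B. (cmod (s b) / R) ^ \<alpha> b)" .
    qed
    have Fj: "?F (?j (a, \<beta>)) = c a \<beta> * (\<Prod>b\<in>B. s b ^ \<beta> b) * s b ^ a" if "\<beta> \<in> B \<rightarrow>\<^sub>E UNIV" for a \<beta>
    proof -
      have "\<beta>(b := undefined) = \<beta>"
        using PiE_arb[OF that insert.hyps(2)] by (simp add: fun_upd_idem)
      moreover have "(\<Prod>b'\<in>B. s b' ^ (\<beta>(b := a)) b') = (\<Prod>b'\<in>B. s b' ^ \<beta> b')"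
        using insert.hyps by (intro prod.cong) auto
      ultimately show ?thesis using insert.hyps by (simp add: C_def mult.commute mult.left_commute)
    qed
    have "((\<lambda>p. ?F (?j p)) has_sum h s) (Sigma UNIV (\<lambda>_. B \<rightarrow>\<^sub>E UNIV))"
    proof (rule has_sum_SigmaI)
      show "((\<lambda>\<beta>. ?F (?j (a, \<beta>))) has_sum d a s * s b ^ a) (B \<rightarrow>\<^sub>E UNIV)" for a

        by (rule iffD2[OF has_sum_cong[where g = "\<lambda>\<beta>. c a \<beta> * (\<Prod>b\<in>B. s b ^ \<beta> b) * s b ^ a"]])
           (rule Fj, assumption, rule has_sum_cmult_left[OF c2[OF sB]])
      show "(\<lambda>p. ?F (?j p)) summable_on Sigma UNIV (\<lambda>_. B \<rightarrow>\<^sub>E UNIV)"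
        by (rule iffD2[OF summable_on_reindex_bij_betw[OF bij_betw_multiindex_insert[OF insert.hyps(2)]] sumF])
      show "((\<lambda>a. d a s * s b ^ a) has_sum h s) UNIV"
      proof (rule norm_summable_imp_has_sum)
        have "(\<lambda>n. (deriv ^^ n) (\<lambda>\<sigma>. h (s(b := \<sigma>))) 0 / fact n * (s b - 0) ^ n) sums h (s(b := s b))"
          by (rule holomorphic_power_series[OF holb[OF sB]]) (use sb in auto)
        then show "(\<lambda>n. d n s * s b ^ n) sums h s"
          by (simp add: d_def)
        show "summable (\<lambda>n. norm (d n s * s b ^ n))"
        proof (rule summable_comparison_test')
          show "summable (\<lambda>n. M * (cmod (s b) / R) ^ n)"
            using sb R by (intro summable_mult summable_geometric) auto
          show "norm (norm (d n s * s b ^ n)) \<le> M * (cmod (s b) / R) ^ n" for n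
            using mult_right_mono[OF dB[OF sB], of "cmod (s b) ^ n" n]
            by (simp add: norm_mult norm_power power_divide)
        qed
      qed
    qed
    then show ?thesis
      by (rule iffD1[OF has_sum_reindex_bij_betw[OF bij_betw_multiindex_insert[OF insert.hyps(2)]]])
  qed
  show ?case using C1 C2 by blast
qed

section \<open>Real-analytic functions\<close>

abbreviation multiindices :: "('a::euclidean_space \<Rightarrow> nat) set" where
  "multiindices \<equiv> Basis \<rightarrow>\<^sub>E UNIV"

abbreviation monomial :: "'a::euclidean_space \<Rightarrow> ('a \<Rightarrow> nat) \<Rightarrow> real" where
  "monomial y \<alpha> \<equiv> \<Prod>b\<in>Basis. (y \<bullet> b) ^ \<alpha> b"

abbreviation taylor_sums :: "(('a::euclidean_space \<Rightarrow> nat) \<Rightarrow> real) \<Rightarrow> 'a \<Rightarrow> 'a \<Rightarrow> real \<Rightarrow> bool" where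
  "taylor_sums c p x S \<equiv> ((\<lambda>\<alpha>. c \<alpha> * monomial (x - p) \<alpha>) has_sum S) multiindices"

abbreviation fderiv :: "('a::real_normed_vector \<Rightarrow> 'b::real_normed_vector) \<Rightarrow> 'a \<Rightarrow> 'a \<Rightarrow> 'b" where
  "fderiv f x \<equiv> frechet_derivative f (at x)"

text \<open>Multi-index sums become ordinary series here because uniform limits and termwise
  differentiation are applied to sequences of partial sums.\<close>

lemma has_sum_imp_sums_enum:
  assumes "bij_betw e (UNIV :: nat set) I" "(f has_sum S) I"
  shows "(\<lambda>n. f (e n)) sums S"
proof -
  have "((\<lambda>n. f (e n)) has_sum S) UNIV"
    using assms by (simp add: has_sum_reindex_bij_betw)
  then show ?thesis by (rule has_sum_imp_sums)
qed

lemma infinite_multiindices: "infinite (multiindices :: ('a::euclidean_space \<Rightarrow> nat) set)"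
proof -
  obtain b where b: "b \<in> (Basis :: 'a set)" using nonempty_Basis by blast
  have "inj (\<lambda>n::nat. \<lambda>x\<in>Basis::'a set. n)"
    using b by (auto intro!: injI dest: fun_cong[of _ _ b])
  moreover have "range (\<lambda>n::nat. \<lambda>x\<in>Basis::'a set. n) \<subseteq> multiindices" by auto
  ultimately show ?thesis
    using infinite_iff_countable_subset by blast
qed

text \<open>Taylor coefficients of the partial derivative in direction b: lowering the exponent
  \<open>Suc (\<beta> b)\<close> by one leaves it as a factor.\<close>

definition shift_coeff :: "'a \<Rightarrow> (('a \<Rightarrow> nat) \<Rightarrow> real) \<Rightarrow> ('a \<Rightarrow> nat) \<Rightarrow> real" where
  "shift_coeff b c \<beta> = c (\<beta>(b := Suc (\<beta> b))) * real (Suc (\<beta> b))"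

text \<open>Terms with exponent 0 in direction b carry a factor 0; lowering that exponent by one
  maps the remaining multi-indices bijectively onto all of them.\<close>

lemma has_sum_shift_coeff:
  fixes y :: "'a::euclidean_space"
  assumes b: "b \<in> Basis"
    and E: "((\<lambda>\<alpha>. c \<alpha> * (real (\<alpha> b) * (y \<bullet> b) ^ (\<alpha> b - 1) * (\<Prod>a\<in>Basis - {b}. (y \<bullet> a) ^ \<alpha> a))) has_sum S) multiindices"
      (is "(?E has_sum S) _")
  shows "((\<lambda>\<beta>. shift_coeff b c \<beta> * monomial y \<beta>) has_sum S) multiindices"
proof -
  let ?s = "\<lambda>\<beta>::'a \<Rightarrow> nat. \<beta>(b := Suc (\<beta> b))"
  have "(?E has_sum S) {\<alpha>\<in>multiindices. \<alpha> b \<noteq> 0}"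
    using E by (rule iffD1[OF has_sum_cong_neutral, rotated -1]) auto
  then have "((\<lambda>\<beta>. ?E (?s \<beta>)) has_sum S) multiindices"
  proof (rule iffD2[OF has_sum_reindex_bij_witness[where i = "\<lambda>\<alpha>. \<alpha>(b := \<alpha> b - 1)" and j = ?s], rotated -1])
  qed (use b in \<open>auto simp: fun_eq_iff PiE_iff extensional_def\<close>)
  moreover have "?E (?s \<beta>) = shift_coeff b c \<beta> * monomial y \<beta>" for \<beta>
  proof -
    have "(\<Prod>a\<in>Basis - {b}. (y \<bullet> a) ^ ?s \<beta> a) = (\<Prod>a\<in>Basis - {b}. (y \<bullet> a) ^ \<beta> a)"
      by (intro prod.cong) auto
    moreover have "monomial y \<beta> = (y \<bullet> b) ^ \<beta> b * (\<Prod>a\<in>Basis - {b}. (y \<bullet> a) ^ \<beta> a)"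
      using b by (simp add: prod.remove)
    ultimately show ?thesis by (simp add: shift_coeff_def mult_ac del: of_nat_Suc)
  qed
  ultimately show ?thesis by simp
qed

lemma has_derivative_monomial:
  fixes p :: "'a::euclidean_space" and \<alpha> :: "'a \<Rightarrow> nat"
  shows "((\<lambda>x. monomial (x - p) \<alpha>) has_derivative
    (\<lambda>h. \<Sum>b\<in>Basis. (h \<bullet> b) * (real (\<alpha> b) * ((x - p) \<bullet> b) ^ (\<alpha> b - 1) *
        (\<Prod>a\<in>Basis - {b}. ((x - p) \<bullet> a) ^ \<alpha> a)))) (at x within S)"
proof -
  have "((\<lambda>x. ((x - p) \<bullet> b) ^ \<alpha> b) has_derivative (\<lambda>h. real (\<alpha> b) * (h \<bullet> b) * ((x - p) \<bullet> b) ^ (\<alpha> b - 1))) (at x within S)" for b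
    by (rule has_derivative_power[THEN has_derivative_eq_rhs])
       (auto intro!: derivative_eq_intros simp: fun_eq_iff)
  then show ?thesis
    by (rule has_derivative_prod[THEN has_derivative_eq_rhs]) (simp add: mult_ac)
qed

text \<open>Halving the polyradius absorbs the exponent that differentiation of a monomial brings
  down.\<close>

lemma real_nat_le_two_power: "real n * (1/2) ^ (n - 1) \<le> 1"
proof (cases n)
  case (Suc k)
  have "real (Suc k) \<le> 2 ^ k" by (induction k) auto
  then show ?thesis by (simp add: Suc power_divide field_simps)
qed simp

text \<open>Convergence at a single point with all coordinates equal to \<rho> gives a summable
  majorant m; for coordinates up to \<rho>/2 the differentiated terms are bounded by
  \<open>m \<alpha> / \<rho>\<close>, so differentiation may be carried out termwise.\<close>

lemma power_series_has_derivative: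
  fixes f :: "'a::euclidean_space \<Rightarrow> real"
  assumes r: "0 < r"
    and sum: "\<And>x. x \<in> ball p r \<Longrightarrow> taylor_sums c p x (f x)"
  shows "\<exists>r'>0. \<exists>g. \<forall>x\<in>ball p r'. (f has_derivative (\<lambda>h. \<Sum>b\<in>Basis. (h \<bullet> b) * g b x)) (at x) \<and>
    (\<forall>b\<in>Basis. taylor_sums (shift_coeff b c) p x (g b x))"
proof -
  \<comment> \<open>The point \<open>x0\<close> has distance at most DIM * \<rho> = r/2 from p,
    which keeps it inside the ball of convergence.\<close>
  define \<rho> where "\<rho> = r / (2 * DIM('a))"
  have \<rho>: "\<rho> > 0" using r by (simp add: \<rho>_def)
  have \<rho>r: "DIM('a) * \<rho> = r / 2" by (simp add: \<rho>_def)
  define x0 where "x0 = p + (\<Sum>b\<in>Basis. \<rho> *\<^sub>R b)"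
  have x0b: "(x0 - p) \<bullet> b = \<rho>" if "b \<in> Basis" for b
    using that by (simp add: x0_def)
  have "norm (\<Sum>b\<in>Basis. \<rho> *\<^sub>R b :: 'a) \<le> (\<Sum>b\<in>(Basis::'a set). \<rho>)"
    by (rule sum_norm_le) (use \<rho> in simp)
  then have "x0 \<in> ball p r" using \<rho>r r by (simp add: x0_def dist_norm)
  from sum[OF this] have s0: "(\<lambda>\<alpha>. c \<alpha> * monomial (x0 - p) \<alpha>) summable_on multiindices"
    by (rule has_sum_imp_summable)
  define m where "m \<alpha> = \<bar>c \<alpha>\<bar> * \<rho> ^ (\<Sum>b\<in>Basis. \<alpha> b)" for \<alpha> :: "'a \<Rightarrow> nat"
  have mm: "m \<alpha> = \<bar>c \<alpha> * monomial (x0 - p) \<alpha>\<bar>" for \<alpha>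
    using \<rho> by (simp add: m_def abs_mult power_sum x0b prod_nonneg flip: abs_prod)
  have msum: "m summable_on multiindices"
    using s0 unfolding mm by (subst (asm) summable_on_iff_abs_summable_on_real) simp
  define r' where "r' = min r (\<rho> / 2)"
  have r': "r' > 0" using r \<rho> by (simp add: r'_def)
  define E where "E b \<alpha> x = c \<alpha> * (real (\<alpha> b) * ((x - p) \<bullet> b) ^ (\<alpha> b - 1) *
        (\<Prod>a\<in>Basis - {b}. ((x - p) \<bullet> a) ^ \<alpha> a))" for b \<alpha> x
  have Ebd: "norm (E b \<alpha> x) \<le> m \<alpha> / \<rho>" if x: "x \<in> ball p r'" and b: "b \<in> Basis" for b \<alpha> x
  proof (cases "\<alpha> b = 0")
    case True
    then show ?thesis using \<rho> by (simp add: E_def m_def)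
  next
    case False
    have y: "\<bar>(x - p) \<bullet> a\<bar> \<le> \<rho> / 2" if "a \<in> Basis" for a
      using x Basis_le_norm[OF that, of "x - p"] by (simp add: r'_def dist_norm norm_minus_commute)
    have "\<bar>\<Prod>a\<in>Basis - {b}. ((x - p) \<bullet> a) ^ \<alpha> a\<bar> \<le> (\<Prod>a\<in>Basis - {b}. (\<rho> / 2) ^ \<alpha> a)"
      unfolding abs_prod power_abs by (intro prod_mono conjI power_mono) (use y in auto)
    also have "\<dots> = (\<rho>/2) ^ (\<Sum>a\<in>Basis - {b}. \<alpha> a)" by (simp add: power_sum)
    finally have P: "\<bar>\<Prod>a\<in>Basis - {b}. ((x - p) \<bullet> a) ^ \<alpha> a\<bar> \<le> (\<rho>/2) ^ (\<Sum>a\<in>Basis - {b}. \<alpha> a)" .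
    let ?n = "\<Sum>a\<in>Basis - {b}. \<alpha> a"
    have "norm (E b \<alpha> x) \<le> \<bar>c \<alpha>\<bar> * (real (\<alpha> b) * (\<rho>/2) ^ (\<alpha> b - 1) * (\<rho>/2) ^ ?n)"
      unfolding E_def real_norm_def abs_mult power_abs
      by (intro mult_mono power_mono P) (use y b \<rho> in auto)
    also have "\<dots> = \<bar>c \<alpha>\<bar> * \<rho> ^ (\<alpha> b - 1 + ?n) * ((real (\<alpha> b) * (1/2) ^ (\<alpha> b - 1)) * (1/2) ^ ?n)"
      by (simp add: power_add power_divide)
    also have "\<dots> \<le> \<bar>c \<alpha>\<bar> * \<rho> ^ (\<alpha> b - 1 + ?n) * (1 * 1)"
      using \<rho> by (intro mult_left_mono mult_mono real_nat_le_two_power power_le_one) auto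
    also have "\<dots> = m \<alpha> / \<rho>"
    proof -
      have "(\<Sum>a\<in>Basis. \<alpha> a) = Suc (\<alpha> b - 1 + ?n)"
        using False b by (subst sum.remove[OF _ b]) auto
      then show ?thesis using \<rho> by (simp add: m_def)
    qed
    finally show ?thesis .
  qed
  have mr: "(\<lambda>\<alpha>. m \<alpha> / \<rho>) summable_on multiindices"
    using summable_on_cmult_left[OF msum, of "1/\<rho>"] by simp
  define g where "g b x = infsum (\<lambda>\<alpha>. E b \<alpha> x) multiindices" for b x
  have gsum: "((\<lambda>\<alpha>. E b \<alpha> x) has_sum g b x) multiindices" if "x \<in> ball p r'" "b \<in> Basis" for b x
    unfolding g_def
    by (rule has_sum_infsum, rule abs_summable_summable, rule Infinite_Sum.abs_summable_on_comparison_test'[OF mr])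
       (rule Ebd[OF that])
  obtain e where e: "bij_betw e (UNIV :: nat set) (multiindices :: ('a \<Rightarrow> nat) set)"
    using bij_betw_from_nat_into[OF countable_PiE infinite_multiindices] by auto
  have unif: "uniform_limit (ball p r') (\<lambda>n x. \<Sum>i<n. E b (e i) x) (g b) sequentially" if b: "b \<in> Basis" for b
  proof -
    have "uniform_limit (ball p r') (\<lambda>n x. \<Sum>i<n. E b (e i) x) (\<lambda>x. \<Sum>i. E b (e i) x) sequentially"
    proof (rule Weierstrass_m_test)
      show "summable (\<lambda>i. m (e i) / \<rho>)"
        using has_sum_imp_sums_enum[OF e has_sum_infsum[OF mr]] by (rule sums_summable)
    qed (rule Ebd[OF _ b])
    then show ?thesis
      by (rule uniform_limit_cong'[THEN iffD1, rotated -1])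
         (use sums_unique[OF has_sum_imp_sums_enum[OF e gsum[OF _ b]]] in auto)
  qed
  have "\<exists>F. \<forall>x\<in>ball p r'. (\<lambda>n. c (e n) * monomial (x - p) (e n)) sums F x \<and>
      (F has_derivative (\<lambda>h. \<Sum>b\<in>Basis. (h \<bullet> b) * g b x)) (at x within ball p r')"
  proof (rule has_derivative_series[where x = p])
    show "((\<lambda>x. c (e n) * monomial (x - p) (e n)) has_derivative
        (\<lambda>h. \<Sum>b\<in>Basis. (h \<bullet> b) * E b (e n) x)) (at x within ball p r')" for n x
      by (rule has_derivative_mult_right[OF has_derivative_monomial, THEN has_derivative_eq_rhs])
         (simp add: E_def sum_distrib_left mult_ac)
    fix \<epsilon> :: real assume \<epsilon>: "\<epsilon> > 0"
    have "\<forall>\<^sub>F n in sequentially. \<forall>b\<in>Basis. \<forall>x\<in>ball p r'. dist (\<Sum>i<n. E b (e i) x) (g b x) < \<epsilon> / DIM('a)"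
      by (intro eventually_ball_finite ballI uniform_limitD[OF unif]) (use \<epsilon> in auto)
    then show "\<forall>\<^sub>F n in sequentially. \<forall>x\<in>ball p r'. \<forall>h.
        norm ((\<Sum>i<n. \<Sum>b\<in>Basis. (h \<bullet> b) * E b (e i) x) - (\<Sum>b\<in>Basis. (h \<bullet> b) * g b x)) \<le> \<epsilon> * norm h"
    proof eventually_elim
      case (elim n)
      show ?case
      proof (intro ballI allI)
        fix x h assume x: "x \<in> ball p r'"
        have "(\<Sum>i<n. \<Sum>b\<in>Basis. (h \<bullet> b) * E b (e i) x) - (\<Sum>b\<in>Basis. (h \<bullet> b) * g b x)
            = (\<Sum>b\<in>Basis. (h \<bullet> b) * ((\<Sum>i<n. E b (e i) x) - g b x))"
          by (subst sum.swap) (simp add: sum_distrib_left right_diff_distrib sum_subtractf)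
        also have "norm \<dots> \<le> (\<Sum>b\<in>(Basis::'a set). norm h * (\<epsilon> / DIM('a)))"
        proof (rule sum_norm_le)
          fix b :: 'a assume b: "b \<in> Basis"
          show "norm ((h \<bullet> b) * ((\<Sum>i<n. E b (e i) x) - g b x)) \<le> norm h * (\<epsilon> / DIM('a))"
            unfolding norm_mult using elim b x Basis_le_norm[OF b, of h]
            by (intro mult_mono) (auto simp: dist_norm intro: less_imp_le)
        qed
        also have "\<dots> = \<epsilon> * norm h" by simp
        finally show "norm ((\<Sum>i<n. \<Sum>b\<in>Basis. (h \<bullet> b) * E b (e i) x) - (\<Sum>b\<in>Basis. (h \<bullet> b) * g b x)) \<le> \<epsilon> * norm h" .
      qed
    qed
  next
    show "(\<lambda>n. c (e n) * monomial (p - p) (e n)) sums f p"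
      by (rule has_sum_imp_sums_enum[OF e sum]) (use r in auto)
  qed (use r' in auto)
  then obtain F where F: "\<And>x. x \<in> ball p r' \<Longrightarrow> (\<lambda>n. c (e n) * monomial (x - p) (e n)) sums F x"
    "\<And>x. x \<in> ball p r' \<Longrightarrow> (F has_derivative (\<lambda>h. \<Sum>b\<in>Basis. (h \<bullet> b) * g b x)) (at x within ball p r')"
    by blast
  have Ff: "F x = f x" if "x \<in> ball p r'" for x
    by (rule sums_unique2[OF F(1)[OF that] has_sum_imp_sums_enum[OF e sum]])
       (use that in \<open>auto simp: r'_def\<close>)
  show ?thesis
  proof (intro exI[of _ r'] conjI r' exI[of _ g] ballI)
    fix x assume x: "x \<in> ball p r'"
    have "(F has_derivative (\<lambda>h. \<Sum>b\<in>Basis. (h \<bullet> b) * g b x)) (at x)"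
      using F(2)[OF x] unfolding at_within_open[OF x open_ball] .
    then show "(f has_derivative (\<lambda>h. \<Sum>b\<in>Basis. (h \<bullet> b) * g b x)) (at x)"
      by (rule has_derivative_transform_within_open[OF _ open_ball x Ff])
  next
    fix x b assume x: "x \<in> ball p r'" and b: "b \<in> (Basis :: 'a set)"
    show "taylor_sums (shift_coeff b c) p x (g b x)"
      by (rule has_sum_shift_coeff[OF b]) (use gsum[OF x b] in \<open>simp add: E_def\<close>)
  qed
qed

lemma frechet_derivative_Basis:
  assumes "(f has_derivative (\<lambda>h. \<Sum>b\<in>Basis. (h \<bullet> b) * g b)) (at (x::'a::euclidean_space))" "b \<in> Basis"
  shows "fderiv f x b = (g b :: real)"
proof -
  have "fderiv f x b = (\<Sum>a\<in>Basis. (b \<bullet> a) * g a)"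
    using frechet_derivative_at[OF assms(1)] by metis
  also have "\<dots> = (\<Sum>a\<in>Basis. if a = b then g a else 0)"
    by (intro sum.cong) (use assms(2) in \<open>auto simp: inner_Basis\<close>)
  finally show ?thesis using assms(2) by simp
qed

lemma real_analytic_onE:
  assumes "real_analytic_on f W" "p \<in> W"
  obtains r c where "r > 0" "\<And>x. x \<in> ball p r \<Longrightarrow>
      taylor_sums c p x (f x)"
  using assms unfolding real_analytic_on_def by blast

lemma real_analytic_local_expansion:
  assumes "real_analytic_on f W" "p \<in> W"
  obtains r g c where "0 < (r::real)"
    "\<And>x. x \<in> ball p r \<Longrightarrow> (f has_derivative (\<lambda>h. \<Sum>b\<in>Basis. (h \<bullet> b) * g b x)) (at x)"
    "\<And>x b. x \<in> ball p r \<Longrightarrow> b \<in> Basis \<Longrightarrow>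
       taylor_sums (shift_coeff b c) p x (g b x)"
proof -
  obtain r c where r: "r > 0" "\<And>x. x \<in> ball p r \<Longrightarrow>
      taylor_sums c p x (f x)"
    by (rule real_analytic_onE[OF assms]) (rule that)
  have "\<exists>r'>0. \<exists>g. \<forall>x\<in>ball p r'. (f has_derivative (\<lambda>h. \<Sum>b\<in>Basis. (h \<bullet> b) * g b x)) (at x) \<and>
    (\<forall>b\<in>Basis. taylor_sums (shift_coeff b c) p x (g b x))"
    by (rule power_series_has_derivative[OF r(1)]) (rule r(2))
  then obtain r' g where "r' > 0" and g: "\<forall>x\<in>ball p r'. (f has_derivative (\<lambda>h. \<Sum>b\<in>Basis. (h \<bullet> b) * g b x)) (at x) \<and>
    (\<forall>b\<in>Basis. taylor_sums (shift_coeff b c) p x (g b x))"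
    by (elim exE conjE)
  show ?thesis
    by (rule that[OF \<open>r' > 0\<close> g[rule_format, THEN conjunct1] g[rule_format, THEN conjunct2, rule_format]])
qed

lemma real_analytic_differentiable:
  assumes "real_analytic_on f W" "x \<in> W"
  shows "f differentiable at x"
proof -
  obtain r' c g where g: "0 < (r'::real)"
     "\<And>y. y \<in> ball x r' \<Longrightarrow> (f has_derivative (\<lambda>h. \<Sum>b\<in>Basis. (h \<bullet> b) * g b y)) (at y)"
     "\<And>y b. y \<in> ball x r' \<Longrightarrow> b \<in> Basis \<Longrightarrow>
       taylor_sums (shift_coeff b c) x y (g b y)"
    by (rule real_analytic_local_expansion[OF assms]) (rule that)
  have "x \<in> ball x r'" using g(1) by simp
  then show ?thesis unfolding differentiable_def by (intro exI) (rule g(2))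
qed

lemma real_analytic_has_derivative:
  assumes "real_analytic_on f W" "x \<in> W"
  shows "(f has_derivative fderiv f x) (at x)"
  using real_analytic_differentiable[OF assms] frechet_derivative_works by blast

section \<open>Closure properties of real-analytic functions\<close>

lemma real_analytic_add:
  assumes "real_analytic_on f W" "real_analytic_on g W"
  shows "real_analytic_on (\<lambda>x. f x + g x) W"
  unfolding real_analytic_on_def
proof
  fix p assume p: "p \<in> W"
  obtain r c where r:
    "r > 0" "\<And>x. x \<in> ball p r \<Longrightarrow> taylor_sums c p x (f x)"
    by (rule real_analytic_onE[OF assms(1) p]) (rule that)
  obtain r' c' where r':
    "r' > 0" "\<And>x. x \<in> ball p r' \<Longrightarrow> taylor_sums c' p x (g x)"
    by (rule real_analytic_onE[OF assms(2) p]) (rule that)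
  show "\<exists>r>0. \<exists>c. \<forall>x\<in>ball p r. taylor_sums c p x (f x + g x)"
  proof (intro exI[of _ "min r r'"] conjI exI[of _ "\<lambda>\<alpha>. c \<alpha> + c' \<alpha>"] ballI)
    fix x assume "x \<in> ball p (min r r')"
    then have "x \<in> ball p r" "x \<in> ball p r'" by simp_all
    then show "((\<lambda>\<alpha>. (c \<alpha> + c' \<alpha>) * monomial (x - p) \<alpha>) has_sum f x + g x) multiindices"
      unfolding distrib_right by (rule has_sum_add[OF r(2) r'(2)])
  qed (use r(1) r'(1) in auto)
qed

lemma real_analytic_cmult:
  assumes "real_analytic_on f W"
  shows "real_analytic_on (\<lambda>x. k * f x) W"
  unfolding real_analytic_on_def
proof
  fix p assume p: "p \<in> W"
  obtain r c where r:
    "r > 0" "\<And>x. x \<in> ball p r \<Longrightarrow> taylor_sums c p x (f x)"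
    by (rule real_analytic_onE[OF assms p]) (rule that)
  show "\<exists>r>0. \<exists>c. \<forall>x\<in>ball p r. taylor_sums c p x (k * f x)"
  proof (intro exI[of _ r] conjI exI[of _ "\<lambda>\<alpha>. k * c \<alpha>"] ballI)
    fix x assume "x \<in> ball p r"
    then show "((\<lambda>\<alpha>. (k * c \<alpha>) * monomial (x - p) \<alpha>) has_sum k * f x) multiindices"
      unfolding mult.assoc by (intro has_sum_cmult_right r)
  qed (use r(1) in auto)
qed

lemma real_analytic_zero: "real_analytic_on (\<lambda>_. 0) W"
  unfolding real_analytic_on_def by (intro ballI exI[of _ 1] conjI exI[of _ "\<lambda>_. 0"]) (auto simp: has_sum_0)

lemma real_analytic_sum:
  assumes "finite I" "\<And>i. i \<in> I \<Longrightarrow> real_analytic_on (f i) W"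
  shows "real_analytic_on (\<lambda>x. \<Sum>i\<in>I. f i x) W"
  using assms by (induction I rule: finite_induct) (auto intro: real_analytic_add real_analytic_zero)

lemma real_analytic_partial:
  assumes "real_analytic_on f W" "b \<in> Basis"
  shows "real_analytic_on (\<lambda>x. fderiv f x b) W"
  unfolding real_analytic_on_def
proof
  fix p assume "p \<in> W"
  obtain r' c g where r': "0 < (r'::real)" and
     g: "\<And>x. x \<in> ball p r' \<Longrightarrow> (f has_derivative (\<lambda>h. \<Sum>b\<in>Basis. (h \<bullet> b) * g b x)) (at x)"
     "\<And>x b. x \<in> ball p r' \<Longrightarrow> b \<in> Basis \<Longrightarrow>
       taylor_sums (shift_coeff b c) p x (g b x)"
    by (rule real_analytic_local_expansion[OF assms(1) \<open>p \<in> W\<close>]) (rule that)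
  then show "\<exists>r>0. \<exists>c. \<forall>x\<in>ball p r.
      taylor_sums c p x (fderiv f x b)"
    using frechet_derivative_Basis[OF g(1) assms(2)] assms(2)
    by (intro exI[of _ r'] conjI exI[of _ "shift_coeff b c"] ballI) auto
qed

lemma frechet_derivative_expand:
  fixes f :: "'a::euclidean_space \<Rightarrow> real"
  assumes "f differentiable at x"
  shows "fderiv f x v = (\<Sum>b\<in>Basis. (v \<bullet> b) * fderiv f x b)"
proof -
  interpret bounded_linear "fderiv f x"
    using assms frechet_derivative_works has_derivative_bounded_linear by blast
  have "fderiv f x v = fderiv f x (\<Sum>b\<in>Basis. (v \<bullet> b) *\<^sub>R b)"
    by (simp add: euclidean_representation)
  then show ?thesis by (simp add: sum scaleR)
qed

lemma real_analytic_cong: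
  assumes "open W" "\<And>x. x \<in> W \<Longrightarrow> f x = g x" "real_analytic_on f W"
  shows "real_analytic_on g W"
  unfolding real_analytic_on_def
proof
  fix p assume p: "p \<in> W"
  obtain r c where
    r: "r > 0" "\<And>x. x \<in> ball p r \<Longrightarrow> taylor_sums c p x (f x)"
    by (rule real_analytic_onE[OF assms(3) p]) (rule that)
  obtain d where d: "d > 0" "ball p d \<subseteq> W" using assms(1) p open_contains_ball by blast
  show "\<exists>r>0. \<exists>c. \<forall>x\<in>ball p r. taylor_sums c p x (g x)"
  proof (intro exI[of _ "min r d"] conjI exI[of _ c] ballI)
    fix x assume "x \<in> ball p (min r d)"
    then have "x \<in> ball p r" "f x = g x" using d assms(2) by auto
    then show "taylor_sums c p x (g x)"
      using r(2)[of x] by simp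
  qed (use r d in auto)
qed

lemma real_analytic_directional:
  assumes "open W" "real_analytic_on f W"
  shows "real_analytic_on (\<lambda>x. fderiv f x v) W"
proof (rule real_analytic_cong[OF assms(1)])
  show "real_analytic_on (\<lambda>x. \<Sum>b\<in>Basis. (v \<bullet> b) * fderiv f x b) W"
    by (intro real_analytic_sum real_analytic_cmult real_analytic_partial[OF assms(2)]) auto
  show "(\<Sum>b\<in>Basis. (v \<bullet> b) * fderiv f x b) = fderiv f x v" if "x \<in> W" for x
    by (rule frechet_derivative_expand[OF real_analytic_differentiable[OF assms(2) that], symmetric])
qed

lemma power_series_at_centre:
  fixes p :: "'a::euclidean_space"
  assumes "taylor_sums c p p S"
  shows "S = c (\<lambda>x\<in>Basis. 0)"
proof -
  let ?z = "\<lambda>x\<in>Basis::'a set. 0::nat"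
  have "((\<lambda>\<alpha>. c \<alpha> * monomial (p - p) \<alpha>) has_sum S) {?z}"
  proof (rule iffD1[OF has_sum_cong_neutral assms])
    fix \<alpha> assume \<alpha>: "\<alpha> \<in> multiindices - {?z}"
    obtain b where b: "b \<in> Basis" "\<alpha> b \<noteq> 0"
    proof (rule ccontr)
      assume "\<not> ?thesis"
      with that have "\<alpha> b = 0" if "b \<in> Basis" for b using \<open>b \<in> Basis\<close> by blast
      then have "\<alpha> = ?z" using \<alpha> by (auto simp: fun_eq_iff PiE_iff extensional_def)
      then show False using \<alpha> by simp
    qed
    then have "monomial (p - p) \<alpha> = 0"
      by (intro prod_zero bexI[of _ b]) simp_all
    then show "c \<alpha> * monomial (p - p) \<alpha> = 0"
      by simp
  qed auto
  then have "S = c ?z * monomial (p - p) ?z"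
    by (rule has_sum_unique[OF _ has_sum_finite, THEN trans]) auto
  then show ?thesis by simp
qed

section \<open>The second derivative and its symmetry\<close>

definition hess :: "('a::euclidean_space \<Rightarrow> real) \<Rightarrow> 'a \<Rightarrow> 'a \<Rightarrow> 'a \<Rightarrow> real" where
  "hess f p u v = frechet_derivative (\<lambda>x. fderiv f x v) (at p) u"

text \<open>Both mixed partials are values at the centre of a twice shifted series, and shifts in
  two different directions commute, so they are the same Taylor coefficient.\<close>

lemma hess_Basis_symmetric:
  assumes "real_analytic_on f W" "p \<in> W" "a \<in> Basis" "b \<in> Basis"
  shows "hess f p a b = hess f p b a"
proof (cases "a = b")
  case False
  obtain r' c g where r': "0 < (r'::real)" and
     g: "\<And>x. x \<in> ball p r' \<Longrightarrow> (f has_derivative (\<lambda>h. \<Sum>b\<in>Basis. (h \<bullet> b) * g b x)) (at x)"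
     "\<And>x b. x \<in> ball p r' \<Longrightarrow> b \<in> Basis \<Longrightarrow>
       taylor_sums (shift_coeff b c) p x (g b x)"
    by (rule real_analytic_local_expansion[OF assms(1,2)]) (rule that)
  have *: "hess f p d e = shift_coeff d (shift_coeff e c) (\<lambda>x\<in>Basis. 0)"
    if "d \<in> Basis" "e \<in> Basis" for d e
  proof -
    have ser: "taylor_sums (shift_coeff e c) p x (fderiv f x e)" if "x \<in> ball p r'" for x
      using g(2)[OF that \<open>e \<in> Basis\<close>] frechet_derivative_Basis[OF g(1)[OF that] \<open>e \<in> Basis\<close>] by simp
    have "\<exists>r''>0. \<exists>h. \<forall>x\<in>ball p r''. ((\<lambda>x. fderiv f x e) has_derivative (\<lambda>v. \<Sum>b\<in>Basis. (v \<bullet> b) * h b x)) (at x) \<and>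
       (\<forall>b\<in>Basis. taylor_sums (shift_coeff b (shift_coeff e c)) p x (h b x))"
      by (rule power_series_has_derivative[OF r']) (rule ser)
    then obtain r'' h where r'': "0 < (r''::real)" and
      h: "\<forall>x\<in>ball p r''. ((\<lambda>x. fderiv f x e) has_derivative (\<lambda>v. \<Sum>b\<in>Basis. (v \<bullet> b) * h b x)) (at x) \<and>
       (\<forall>b\<in>Basis. taylor_sums (shift_coeff b (shift_coeff e c)) p x (h b x))"
      by (elim exE conjE)
    have "hess f p d e = h d p"
      unfolding hess_def
      by (rule frechet_derivative_Basis[OF h[rule_format, THEN conjunct1] that(1)]) (use r'' in auto)
    also have "\<dots> = shift_coeff d (shift_coeff e c) (\<lambda>x\<in>Basis. 0)"
      by (rule power_series_at_centre[OF h[rule_format, THEN conjunct2, rule_format]]) (use r'' that in auto)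
    finally show ?thesis .
  qed
  show ?thesis
    unfolding *[OF assms(3,4)] *[OF assms(4,3)]
    using False by (simp add: shift_coeff_def fun_upd_twist[OF False])
qed simp

lemma hess_expand:
  assumes W: "open W" and f: "real_analytic_on f W" and p: "p \<in> W"
  shows "hess f p u v = (\<Sum>a\<in>Basis. \<Sum>b\<in>Basis. (u \<bullet> a) * (v \<bullet> b) * hess f p a b)"
proof -
  have d: "(\<lambda>x. fderiv f x w) differentiable at p" for w
    by (rule real_analytic_differentiable[OF real_analytic_directional[OF W f] p])
  have 1: "hess f p u w = (\<Sum>a\<in>Basis. (u \<bullet> a) * hess f p a w)" for w
    unfolding hess_def by (rule frechet_derivative_expand[OF d])
  have 2: "hess f p a v = (\<Sum>b\<in>Basis. (v \<bullet> b) * hess f p a b)" for a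
  proof -
    have "((\<lambda>x. \<Sum>b\<in>Basis. (v \<bullet> b) * fderiv f x b) has_derivative
        (\<lambda>h. \<Sum>b\<in>Basis. (v \<bullet> b) * hess f p h b)) (at p)"
      unfolding hess_def using d frechet_derivative_works
      by (intro has_derivative_sum has_derivative_mult_right) blast
    then have "((\<lambda>x. fderiv f x v) has_derivative
        (\<lambda>h. \<Sum>b\<in>Basis. (v \<bullet> b) * hess f p h b)) (at p)"
      by (rule has_derivative_transform_within_open[OF _ W p])
         (rule frechet_derivative_expand[OF real_analytic_differentiable[OF f], symmetric])
    from frechet_derivative_at[OF this] show ?thesis unfolding hess_def[of f p a v] by metis
  qed
  have "hess f p u v = (\<Sum>a\<in>Basis. (u \<bullet> a) * (\<Sum>b\<in>Basis. (v \<bullet> b) * hess f p a b))"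
    unfolding 1[of v] by (rule sum.cong[OF refl], subst 2, rule refl)
  then show ?thesis
    by (simp add: sum_distrib_left mult.assoc)
qed

lemma hess_symmetric:
  assumes W: "open W" and f: "real_analytic_on f W" and p: "p \<in> W"
  shows "hess f p u v = hess f p v u"
proof -
  have "hess f p u v = (\<Sum>a\<in>Basis. \<Sum>b\<in>Basis. (u \<bullet> a) * (v \<bullet> b) * hess f p a b)"
    by (rule hess_expand[OF assms])
  also have "\<dots> = (\<Sum>b\<in>Basis. \<Sum>a\<in>Basis. (u \<bullet> a) * (v \<bullet> b) * hess f p a b)"
    by (rule sum.swap)
  also have "\<dots> = (\<Sum>b\<in>Basis. \<Sum>a\<in>Basis. (v \<bullet> b) * (u \<bullet> a) * hess f p b a)"
    using hess_Basis_symmetric[OF f p] by (intro sum.cong refl) (simp add: mult_ac)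
  also have "\<dots> = hess f p v u" by (rule hess_expand[OF assms, symmetric])
  finally show ?thesis .
qed

section \<open>Pulling back a hyperquadric\<close>

lemma norm_vector_smult: "norm (c *s x) = cmod c * norm (x :: complex ^ 'm)"
  unfolding norm_vec_def by (simp add: norm_mult L2_set_right_distrib)

lemma of_real_smult: "complex_of_real t *s (b :: complex ^ 'm) = t *\<^sub>R b"
  unfolding vec_eq_iff vector_scaleR_component vector_smult_component by (simp add: scaleR_conv_of_real)

section \<open>Holomorphic maps along complex curves\<close>

lemma has_derivative_curve:
  fixes c :: "complex \<Rightarrow> complex ^ 'm"
  assumes "\<And>i. ((\<lambda>\<sigma>. c \<sigma> $ i) has_field_derivative d $ i) (at \<sigma>)"
  shows "(c has_derivative (\<lambda>s. s *s d)) (at \<sigma>)"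
  unfolding has_derivative_componentwise_within[of c]
proof
  fix b :: "complex ^ 'm" assume "b \<in> Basis"
  then obtain j u where b: "b = axis j u" by (auto simp: Basis_vec_def)
  have "((\<lambda>\<sigma>. c \<sigma> $ j) has_derivative (\<lambda>s. s * d $ j)) (at \<sigma>)"
    using assms[of j] unfolding has_field_derivative_def by (simp add: mult_commute_abs)
  from has_derivative_inner_left[OF this, of u]
  show "((\<lambda>x. c x \<bullet> b) has_derivative (\<lambda>x. (x *s d) \<bullet> b)) (at \<sigma>)"
    by (simp add: b inner_axis)
qed

text \<open>The derivative of H is complex linear, so its composition with \<open>s *s d\<close> is
  multiplication by a complex number. This reduces the use of H to functions of one complex
  variable.\<close>

lemma holomorphic_map_has_field_derivative:
  fixes c :: "complex \<Rightarrow> complex ^ 'm"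
  assumes H: "holomorphic_map_on H U" and "c \<sigma> \<in> U"
    and c: "\<And>i. (\<lambda>\<sigma>. c \<sigma> $ i) field_differentiable (at \<sigma>)"
  shows "(\<lambda>\<sigma>. H (c \<sigma>) $ j) field_differentiable (at \<sigma>)"
proof -
  obtain D where D: "(H has_derivative D) (at (c \<sigma>))" and lin: "\<And>k v. D (k *s v) = k *s D v"
    using H \<open>c \<sigma> \<in> U\<close> unfolding holomorphic_map_on_def by blast
  define d where "d = (\<chi> i. deriv (\<lambda>\<sigma>. c \<sigma> $ i) \<sigma>)"
  have "(c has_derivative (\<lambda>s. s *s d)) (at \<sigma>)"
    by (rule has_derivative_curve) (use c in \<open>simp add: d_def DERIV_deriv_iff_field_differentiable\<close>)
  from has_derivative_compose[OF this D]
  have "((\<lambda>\<sigma>. H (c \<sigma>)) has_derivative (\<lambda>s. s *s D d)) (at \<sigma>)" by (simp add: lin)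
  from bounded_linear.has_derivative[OF bounded_linear_vec_nth this, of j]
  have "((\<lambda>\<sigma>. H (c \<sigma>) $ j) has_field_derivative (D d $ j)) (at \<sigma>)"
    unfolding has_field_derivative_def by (simp add: mult_commute_abs)
  then show ?thesis unfolding field_differentiable_def by blast
qed

lemma holomorphic_map_curve:
  fixes c :: "complex \<Rightarrow> complex ^ 'm"
  assumes H: "holomorphic_map_on H U" and S: "open S" and cS: "\<And>\<sigma>. \<sigma> \<in> S \<Longrightarrow> c \<sigma> \<in> U"
    and c: "\<And>i. (\<lambda>\<sigma>. c \<sigma> $ i) holomorphic_on S"
  shows "(\<lambda>\<sigma>. H (c \<sigma>) $ j) holomorphic_on S"
proof -
  have "(\<lambda>\<sigma>. H (c \<sigma>) $ j) field_differentiable (at \<sigma>)" if \<sigma>: "\<sigma> \<in> S" for \<sigma>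
    by (rule holomorphic_map_has_field_derivative[where c = c and \<sigma> = \<sigma>, OF H cS[OF \<sigma>]])
       (use c S \<sigma> holomorphic_on_imp_differentiable_at in blast)
  then show ?thesis
    unfolding holomorphic_on_def by (blast intro: field_differentiable_at_within)
qed

lemma holomorphic_map_continuous_on:
  assumes "holomorphic_map_on H U"
  shows "continuous_on U H"
  by (meson assms continuous_at_imp_continuous_on has_derivative_continuous holomorphic_map_on_def)

definition quadric_fn :: "'k::finite \<Rightarrow> ('k \<Rightarrow> 'k \<Rightarrow> complex) \<Rightarrow> complex ^ 'k \<Rightarrow> real" where
  "quadric_fn k A x = Im (x $ k) - Re (sesq_form k A x x)"

text \<open>Polarisation of \<open>quadric_fn\<close>: holomorphic in x, antiholomorphic in y, and
  equal to the defining function on the diagonal when A is hermitian. The first term polarises the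
  imaginary part.\<close>

definition quadric_polar :: "'k::finite \<Rightarrow> ('k \<Rightarrow> 'k \<Rightarrow> complex) \<Rightarrow> complex ^ 'k \<Rightarrow> complex ^ 'k \<Rightarrow> complex" where
  "quadric_polar k A x y = (x $ k - cnj (y $ k)) / (2 * \<i>) - sesq_form k A x y"

lemma sesq_form_add_left: "sesq_form k A (x + y) z = sesq_form k A x z + sesq_form k A y z"
  unfolding sesq_form_def by (simp add: algebra_simps sum.distrib)

lemma sesq_form_add_right: "sesq_form k A x (y + z) = sesq_form k A x y + sesq_form k A x z"
  unfolding sesq_form_def by (simp add: algebra_simps sum.distrib)

lemma sesq_form_scale_left: "sesq_form k A (c *s x) y = c * sesq_form k A x y"
  unfolding sesq_form_def by (simp add: sum_distrib_left mult_ac)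

lemma sesq_form_scale_right: "sesq_form k A x (c *s y) = cnj c * sesq_form k A x y"
  unfolding sesq_form_def by (simp add: sum_distrib_left mult_ac)

lemma sesq_form_sum_left: "sesq_form k A (\<Sum>i\<in>I. f i) y = (\<Sum>i\<in>I. sesq_form k A (f i) y)"
proof (induction I rule: infinite_finite_induct)
  case (insert i I)
  then show ?case by (simp add: sesq_form_add_left)
qed (simp_all add: sesq_form_def)

lemma sesq_form_cnj:
  assumes "hermitian_matrix k A"
  shows "cnj (sesq_form k A x y) = sesq_form k A y x"
proof -
  have "cnj (sesq_form k A x y) = (\<Sum>i\<in>UNIV - {k}. \<Sum>j\<in>UNIV - {k}. A j i * cnj (x $ i) * y $ j)"
    unfolding sesq_form_def cnj_sum
  proof (intro sum.cong refl)
    fix i j assume "i \<in> UNIV - {k}" "j \<in> UNIV - {k}"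
    then have "A j i = cnj (A i j)" using assms unfolding hermitian_matrix_def by blast
    then show "cnj (A i j * x $ i * cnj (y $ j)) = A j i * cnj (x $ i) * y $ j" by simp
  qed
  also have "\<dots> = (\<Sum>j\<in>UNIV - {k}. \<Sum>i\<in>UNIV - {k}. A j i * cnj (x $ i) * y $ j)"
    by (rule sum.swap)
  finally show ?thesis unfolding sesq_form_def by (simp only: mult.assoc mult.commute[of "cnj _"])
qed

lemma sesq_form_self_real:
  assumes "hermitian_matrix k A"
  shows "sesq_form k A x x = of_real (Re (sesq_form k A x x))"
  by (metis assms sesq_form_cnj Reals_cnj_iff of_real_Re)

lemma quadric_polar_diag:
  assumes "hermitian_matrix k A"
  shows "quadric_polar k A x x = of_real (quadric_fn k A x)"
proof -
  have "(x $ k - cnj (x $ k)) / (2 * \<i>) = of_real (Im (x $ k))"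
    by (simp add: complex_eq_iff)
  then show ?thesis
    unfolding quadric_polar_def quadric_fn_def by (subst sesq_form_self_real[OF assms]) simp
qed

lemma quadric_eq:
  assumes "hermitian_matrix k A"
  shows "{x. complex_of_real (Im (x $ k)) = sesq_form k A x x} = {x. quadric_fn k A x = 0}"
proof -
  have "complex_of_real (Im (x $ k)) = sesq_form k A x x \<longleftrightarrow> quadric_fn k A x = 0" for x
    unfolding quadric_fn_def by (subst sesq_form_self_real[OF assms]) (simp only: of_real_eq_iff, auto)
  then show ?thesis by blast
qed

lemma holomorphic_quadric_polar:
  assumes "\<And>i. (\<lambda>\<sigma>. X \<sigma> $ i) holomorphic_on S" "\<And>i. (\<lambda>\<sigma>. cnj (Y \<sigma> $ i)) holomorphic_on S"
  shows "(\<lambda>\<sigma>. quadric_polar k A (X \<sigma>) (Y \<sigma>)) holomorphic_on S"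
  unfolding quadric_polar_def sesq_form_def
  by (intro holomorphic_intros assms) auto

lemma continuous_on_quadric_polar:
  assumes "continuous_on S X" "continuous_on S Y"
  shows "continuous_on S (\<lambda>\<sigma>. quadric_polar k A (X \<sigma>) (Y \<sigma>))"
  unfolding quadric_polar_def sesq_form_def
  by (intro continuous_intros assms continuous_on_cnj) auto

text \<open>The second argument is antiholomorphic in \<sigma>, and \<open>quadric_polar\<close>
  conjugates it once more.\<close>

lemma holomorphic_map_polar_curve:
  fixes c d :: "complex \<Rightarrow> complex ^ 'm"
  assumes H: "holomorphic_map_on H U" and S: "open S"
    and cS: "\<And>\<sigma>. \<sigma> \<in> S \<Longrightarrow> c \<sigma> \<in> U" and dS: "\<And>\<sigma>. \<sigma> \<in> S \<Longrightarrow> d (cnj \<sigma>) \<in> U"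
    and c: "\<And>i. (\<lambda>\<sigma>. c \<sigma> $ i) holomorphic_on S" and d: "\<And>i. (\<lambda>\<sigma>. d \<sigma> $ i) holomorphic_on (cnj ` S)"
  shows "(\<lambda>\<sigma>. quadric_polar k A (H (c \<sigma>)) (H (d (cnj \<sigma>)))) holomorphic_on S"
proof (rule holomorphic_quadric_polar)
  show "(\<lambda>\<sigma>. H (c \<sigma>) $ i) holomorphic_on S" for i
    by (rule holomorphic_map_curve[OF H S cS c])
  have oS: "open (cnj ` S)"
    unfolding image_cnj_conv_vimage_cnj using S by (intro open_vimage) auto
  have "(\<lambda>\<sigma>. H (d \<sigma>) $ i) holomorphic_on (cnj ` S)" for i
    by (rule holomorphic_map_curve[OF H oS _ d]) (use dS in auto)
  then have "cnj \<circ> (\<lambda>\<sigma>. H (d \<sigma>) $ i) \<circ> cnj holomorphic_on S" for i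
    by (intro holomorphic_on_compose_cnj_cnj S)
  then show "(\<lambda>\<sigma>. cnj (H (d (cnj \<sigma>)) $ i)) holomorphic_on S" for i
    by (simp add: o_def)
qed

text \<open>The real coordinates are complexified one by one: h is separately holomorphic and
  bounded on a polydisc and restricts to the pullback at real points, so its power series yields the
  real one.\<close>

lemma real_analytic_quadric_pullback:
  fixes H :: "complex ^ 'm::finite \<Rightarrow> complex ^ 'k::finite"
  assumes H: "holomorphic_map_on H U" and U: "open U" and A: "hermitian_matrix k A"
  shows "real_analytic_on (\<lambda>z. quadric_fn k A (H z)) U"
  unfolding real_analytic_on_def
proof
  fix p assume "p \<in> U"
  then obtain r where r: "r > 0" "cball p r \<subseteq> U" using U open_contains_cball by blast
  let ?N = "real DIM(complex ^ 'm)"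
  define R where "R = r / ?N"
  have R: "R > 0" using r by (simp add: R_def)
  \<comment> \<open>The second slot receives the conjugated coordinates, because it is
    antiholomorphic; at real s both slots hold the same point.\<close>
  define Z where "Z s = p + (\<Sum>b\<in>Basis. s b *s b)" for s :: "complex ^ 'm \<Rightarrow> complex"
  define h where "h s = quadric_polar k A (H (Z s)) (H (Z (\<lambda>b. cnj (s b))))" for s
  have Zin: "Z s \<in> cball p r" if "s \<in> polydisc Basis R" for s
  proof -
    have "norm (\<Sum>b\<in>Basis. s b *s b) \<le> (\<Sum>b\<in>(Basis :: (complex ^ 'm) set). R)"
      by (rule sum_norm_le) (use that in \<open>auto simp: norm_vector_smult polydisc_def less_imp_le\<close>)
    also have "\<dots> = r" by (simp add: R_def)
    finally show ?thesis by (simp add: Z_def dist_norm)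
  qed
  have cin: "(\<lambda>b. cnj (s b)) \<in> polydisc Basis R" if "s \<in> polydisc Basis R" for s
    using that by (simp add: polydisc_def)
  have updin: "s(b := \<sigma>) \<in> polydisc Basis R" if "s \<in> polydisc Basis R" "\<sigma> \<in> ball 0 R" for s b \<sigma>
    using that by (simp add: polydisc_def)
  have "\<exists>M. \<forall>x\<in>cball p r. \<forall>y\<in>cball p r. cmod (quadric_polar k A (H x) (H y)) \<le> M"
  proof -
    have "continuous_on (cball p r \<times> cball p r) (\<lambda>q. quadric_polar k A (H (fst q)) (H (snd q)))"
      by (intro continuous_on_quadric_polar continuous_on_compose2[OF holomorphic_map_continuous_on[OF H]]
          continuous_on_fst continuous_on_snd continuous_on_id) (use r in auto)
    then have "bounded ((\<lambda>q. quadric_polar k A (H (fst q)) (H (snd q))) ` (cball p r \<times> cball p r))"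
      by (intro compact_imp_bounded compact_continuous_image compact_Times compact_cball)
    then show ?thesis unfolding bounded_iff by fastforce
  qed
  then obtain M where M: "\<And>x y. x \<in> cball p r \<Longrightarrow> y \<in> cball p r \<Longrightarrow> cmod (quadric_polar k A (H x) (H y)) \<le> M"
    by blast
  have "\<exists>c. (\<forall>\<alpha>. cmod (c \<alpha>) \<le> M / R ^ (\<Sum>b\<in>Basis. \<alpha> b)) \<and>
    (\<forall>s\<in>polydisc Basis R. ((\<lambda>\<alpha>. c \<alpha> * (\<Prod>b\<in>Basis. s b ^ \<alpha> b)) has_sum h s) (Basis \<rightarrow>\<^sub>E UNIV))"
  proof (rule separately_holomorphic_power_series[OF finite_Basis R])
    show "h s = h s'" if "\<And>b. b \<in> Basis \<Longrightarrow> s b = s' b" for s s'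
    proof -
      have "Z s = Z s'" "Z (\<lambda>b. cnj (s b)) = Z (\<lambda>b. cnj (s' b))"
        unfolding Z_def using that by (auto intro!: sum.cong)
      then show ?thesis unfolding h_def by simp
    qed
    show "cmod (h s) \<le> M" if "s \<in> polydisc Basis R" for s
      unfolding h_def by (rule M[OF Zin[OF that] Zin[OF cin[OF that]]])
    fix s :: "complex ^ 'm \<Rightarrow> complex" and b assume s: "s \<in> polydisc Basis R" and b: "b \<in> (Basis :: (complex ^ 'm) set)"
    have e: "(\<lambda>a. cnj ((s(b := \<sigma>)) a)) = (\<lambda>a. cnj (s a))(b := cnj \<sigma>)" for \<sigma> by auto
    have hol: "(\<lambda>\<sigma>. Z (s(b := \<sigma>)) $ i) holomorphic_on S" for s :: "complex ^ 'm \<Rightarrow> complex" and i S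
    proof -
      have "Z (s(b := \<sigma>)) $ i = p $ i + (\<Sum>a\<in>Basis - {b}. s a * a $ i) + \<sigma> * b $ i" for \<sigma>
        unfolding Z_def using b by (simp add: sum.remove[of _ b])
      then show ?thesis by (auto intro!: holomorphic_intros)
    qed
    show "(\<lambda>\<sigma>. h (s(b := \<sigma>))) holomorphic_on ball 0 R"
      unfolding h_def e
    proof (rule holomorphic_map_polar_curve[OF H])
      show "Z (s(b := \<sigma>)) \<in> U" if "\<sigma> \<in> ball 0 R" for \<sigma>
        using Zin[OF updin[OF s that]] r by blast
      show "Z ((\<lambda>a. cnj (s a))(b := cnj \<sigma>)) \<in> U" if "\<sigma> \<in> ball 0 R" for \<sigma>
        using Zin[OF updin[OF cin[OF s], of "cnj \<sigma>"]] r that by auto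
    qed (rule open_ball hol)+
  qed
  then obtain c where c: "\<And>s. s \<in> polydisc Basis R \<Longrightarrow>
      ((\<lambda>\<alpha>. c \<alpha> * (\<Prod>b\<in>Basis. s b ^ \<alpha> b)) has_sum h s) (Basis \<rightarrow>\<^sub>E UNIV)"
    by blast
  show "\<exists>r>0. \<exists>c. \<forall>x\<in>ball p r. taylor_sums c p x (quadric_fn k A (H x))"
  proof (intro exI[of _ R] conjI R exI[of _ "\<lambda>\<alpha>. Re (c \<alpha>)"] ballI)
    fix x assume x: "x \<in> ball p R"
    define s where "s b = complex_of_real ((x - p) \<bullet> b)" for b
    have s: "s \<in> polydisc Basis R"
      unfolding polydisc_def s_def
      using x Basis_le_norm[of _ "x - p"] by (auto simp: dist_norm norm_minus_commute intro: le_less_trans)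
    have "Z s = x" "Z (\<lambda>b. cnj (s b)) = x"
      unfolding Z_def s_def complex_cnj_complex_of_real of_real_smult by (simp_all only: euclidean_representation) simp_all
    then have h: "h s = of_real (quadric_fn k A (H x))"
      unfolding h_def by (simp add: quadric_polar_diag[OF A])
    \<comment> \<open>The monomials and h are real at real points, so the real parts of the
      coefficients already represent the function.\<close>
    have "Re (c \<alpha> * (\<Prod>b\<in>Basis. s b ^ \<alpha> b)) = Re (c \<alpha>) * monomial (x - p) \<alpha>" for \<alpha>
    proof -
      have "(\<Prod>b\<in>Basis. s b ^ \<alpha> b) = complex_of_real (monomial (x - p) \<alpha>)"
        unfolding s_def by simp
      then show ?thesis by (simp only: times_complex.sel Re_complex_of_real Im_complex_of_real mult_zero_right diff_zero)
    qed
    then show "((\<lambda>\<alpha>. Re (c \<alpha>) * monomial (x - p) \<alpha>) has_sum quadric_fn k A (H x)) multiindices"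
      using has_sum_Re[OF c[OF s]] h by simp
  qed
qed

section \<open>Transversality and unique continuation\<close>

definition quadric_deriv :: "'k::finite \<Rightarrow> ('k \<Rightarrow> 'k \<Rightarrow> complex) \<Rightarrow> complex ^ 'k \<Rightarrow> complex ^ 'k \<Rightarrow> real" where
  "quadric_deriv k A x v = Im (v $ k) - Re (sesq_form k A x v + sesq_form k A v x)"

lemma quadric_fn_add:
  "quadric_fn k A (x + v) = quadric_fn k A x + quadric_deriv k A x v - Re (sesq_form k A v v)"
  unfolding quadric_fn_def quadric_deriv_def by (simp add: sesq_form_add_left sesq_form_add_right)

lemma quadric_deriv_linear:
  "quadric_deriv k A x (v + w) = quadric_deriv k A x v + quadric_deriv k A x w"
  "quadric_deriv k A x (r *\<^sub>R v) = r * quadric_deriv k A x v"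
proof -
  show "quadric_deriv k A x (v + w) = quadric_deriv k A x v + quadric_deriv k A x w"
    unfolding quadric_deriv_def by (simp add: sesq_form_add_left sesq_form_add_right)
  show "quadric_deriv k A x (r *\<^sub>R v) = r * quadric_deriv k A x v"
    unfolding quadric_deriv_def of_real_smult[symmetric]
    by (simp add: sesq_form_scale_left sesq_form_scale_right algebra_simps)
qed

lemma quadric_fn_has_derivative:
  "(quadric_fn k A has_derivative quadric_deriv k A x) (at x)"
proof -
  have d: "((\<lambda>x. A i j * x $ i * cnj (x $ j)) has_derivative
      (\<lambda>v. A i j * x $ i * cnj (v $ j) + A i j * v $ i * cnj (x $ j))) (at x)" for i j
  proof -
    have 1: "((\<lambda>x. A i j * x $ i) has_derivative (\<lambda>v. A i j * v $ i)) (at x)"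
      by (intro has_derivative_mult_right bounded_linear_imp_has_derivative bounded_linear_vec_nth)
    have 2: "((\<lambda>x. cnj (x $ j)) has_derivative (\<lambda>v. cnj (v $ j))) (at x)"
      by (intro bounded_linear.has_derivative[OF bounded_linear_cnj] bounded_linear_imp_has_derivative bounded_linear_vec_nth)
    show ?thesis by (rule has_derivative_mult[OF 1 2])
  qed
  have "((\<lambda>x. Im (x $ k) - Re (\<Sum>i\<in>UNIV - {k}. \<Sum>j\<in>UNIV - {k}. A i j * x $ i * cnj (x $ j))) has_derivative
     (\<lambda>v. Im (v $ k) - Re (\<Sum>i\<in>UNIV - {k}. \<Sum>j\<in>UNIV - {k}. A i j * x $ i * cnj (v $ j) + A i j * v $ i * cnj (x $ j)))) (at x)"
    by (intro has_derivative_diff has_derivative_sum d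
        bounded_linear.has_derivative[OF bounded_linear_Re] bounded_linear.has_derivative[OF bounded_linear_Im]
        bounded_linear_imp_has_derivative bounded_linear_vec_nth)
  then show ?thesis
    unfolding quadric_fn_def[abs_def] quadric_deriv_def[abs_def] sesq_form_def by (simp add: sum.distrib)
qed

lemma quadric_tangent_space_subset:
  assumes "v \<in> real_tangent_space {x. quadric_fn k A x = 0} q"
  shows "quadric_deriv k A q v = 0"
proof -
  obtain \<gamma> \<epsilon> where g: "\<epsilon> > (0::real)" "\<gamma> ` {-\<epsilon><..<\<epsilon>} \<subseteq> {x. quadric_fn k A x = 0}" "\<gamma> 0 = q"
    "(\<gamma> has_vector_derivative v) (at 0)"
    using assms unfolding real_tangent_space_def by blast
  have "((\<lambda>t. quadric_fn k A (\<gamma> t)) has_derivative (\<lambda>t. quadric_deriv k A q (t *\<^sub>R v))) (at 0)"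
    using has_derivative_compose[OF g(4)[unfolded has_vector_derivative_def], OF quadric_fn_has_derivative, of k A]
    by (simp add: g(3))
  moreover have "((\<lambda>t. quadric_fn k A (\<gamma> t)) has_derivative (\<lambda>_. 0)) (at 0)"
  proof (rule has_derivative_transform_within_open[OF has_derivative_const[of 0]])
    show "open {-\<epsilon><..<\<epsilon>}" "(0::real) \<in> {-\<epsilon><..<\<epsilon>}" using g(1) by auto
    show "0 = quadric_fn k A (\<gamma> t)" if "t \<in> {-\<epsilon><..<\<epsilon>}" for t
      using g(2) that by (simp add: image_subset_iff)
  qed
  ultimately have "(\<lambda>t. quadric_deriv k A q (t *\<^sub>R v)) = (\<lambda>_. 0)"
    by (rule has_derivative_unique)
  from fun_cong[OF this, of 1] show ?thesis by simp
qed

text \<open>The line q + t v leaves the quadric only by the quadratic term of v; a motion of order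
  t^2 in the imaginary direction of the k-th coordinate compensates it exactly, so a parabola stays
  in the quadric.\<close>

lemma quadric_tangent_space_supset:
  assumes q: "quadric_fn k A q = 0" and v: "quadric_deriv k A q v = 0"
  shows "v \<in> real_tangent_space {x. quadric_fn k A x = 0} q"
proof -
  define w where "w = axis k (\<i> * of_real (Re (sesq_form k A v v)))"
  define \<gamma> where "\<gamma> t = q + (t *\<^sub>R v + t\<^sup>2 *\<^sub>R w)" for t :: real
  have w0: "sesq_form k A w y = 0" "sesq_form k A y w = 0" for y
    unfolding sesq_form_def w_def axis_def by (auto intro!: sum.neutral)
  have wk: "quadric_deriv k A q w = Re (sesq_form k A v v)"
    unfolding quadric_deriv_def w0 by (simp add: w_def)
  have "quadric_fn k A (\<gamma> t) = 0" for t
  proof -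
    have "sesq_form k A (t *\<^sub>R v + t\<^sup>2 *\<^sub>R w) (t *\<^sub>R v + t\<^sup>2 *\<^sub>R w) = of_real (t\<^sup>2) * sesq_form k A v v"
      unfolding of_real_smult[symmetric] sesq_form_add_left sesq_form_add_right sesq_form_scale_left sesq_form_scale_right w0
      by (simp add: power2_eq_square)
    then show ?thesis
      unfolding \<gamma>_def quadric_fn_add quadric_deriv_linear q v wk by simp
  qed
  moreover have der: "(\<gamma> has_vector_derivative (v + (2 * t) *\<^sub>R w)) (at t)" for t
    unfolding \<gamma>_def by (auto intro!: derivative_eq_intros)
  moreover have "\<gamma> C1_differentiable_on {-1<..<1}"
    unfolding C1_differentiable_on_def
    by (intro exI[of _ "\<lambda>t. v + (2 * t) *\<^sub>R w"] conjI ballI der continuous_intros)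
  moreover have "(\<gamma> has_vector_derivative v) (at 0)" using der[of 0] by simp
  moreover have "\<gamma> 0 = q" by (simp add: \<gamma>_def)
  ultimately show ?thesis
    unfolding real_tangent_space_def by (intro CollectI exI[of _ \<gamma>] exI[of _ "1::real"]) auto
qed

text \<open>The tangent space is the kernel of a nonzero real functional, so a subspace added to it
  fills everything exactly when the functional does not vanish on that subspace; on the image of dH
  the functional is d\<phi>.\<close>

lemma transversal_at_quadric_iff:
  assumes D: "(H has_derivative D) (at p)" and q: "quadric_fn k A (H p) = 0"
  shows "transversal_at H {x. quadric_fn k A x = 0} p \<longleftrightarrow>
    frechet_derivative (\<lambda>z. quadric_fn k A (H z)) (at p) \<noteq> (\<lambda>_. 0)"
proof -
  let ?T = "real_tangent_space {x. quadric_fn k A x = 0} (H p)"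
  have fH: "fderiv H p = D" using frechet_derivative_at[OF D] by simp
  have "((\<lambda>z. quadric_fn k A (H z)) has_derivative (\<lambda>v. quadric_deriv k A (H p) (D v))) (at p)"
    by (rule has_derivative_compose[OF D quadric_fn_has_derivative])
  from frechet_derivative_at[OF this]
  have f\<phi>: "frechet_derivative (\<lambda>z. quadric_fn k A (H z)) (at p) = (\<lambda>v. quadric_deriv k A (H p) (D v))"
    by simp
  have T: "v \<in> ?T \<longleftrightarrow> quadric_deriv k A (H p) v = 0" for v
    using quadric_tangent_space_subset quadric_tangent_space_supset[OF q] by blast
  show ?thesis
  proof
    assume tr: "transversal_at H {x. quadric_fn k A x = 0} p"
    show "frechet_derivative (\<lambda>z. quadric_fn k A (H z)) (at p) \<noteq> (\<lambda>_. 0)"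
    proof
      assume "frechet_derivative (\<lambda>z. quadric_fn k A (H z)) (at p) = (\<lambda>_. 0)"
      then have 0: "quadric_deriv k A (H p) (D v) = 0" for v
        unfolding f\<phi> by (rule fun_cong)
      \<comment> \<open>The functional takes the value 1 on this vector.\<close>
      have "axis k \<i> \<in> {a + b | a b. a \<in> ?T \<and> b \<in> range (fderiv H p)}"
        using tr unfolding transversal_at_def by simp
      then obtain a b where "axis k \<i> = a + D b" "a \<in> ?T" unfolding fH by blast
      then have "quadric_deriv k A (H p) (axis k \<i>) = 0" using 0 T by (simp add: quadric_deriv_linear)
      moreover have "sesq_form k A (axis k \<i>) y = 0" "sesq_form k A y (axis k \<i>) = 0" for y
        unfolding sesq_form_def axis_def by (auto intro!: sum.neutral)
      ultimately show False by (simp add: quadric_deriv_def)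
    qed
  next
    assume "frechet_derivative (\<lambda>z. quadric_fn k A (H z)) (at p) \<noteq> (\<lambda>_. 0)"
    then obtain v where v: "quadric_deriv k A (H p) (D v) \<noteq> 0"
      unfolding f\<phi> by auto
    have "y \<in> {a + b | a b. a \<in> ?T \<and> b \<in> range (fderiv H p)}" for y
    proof -
      define c where "c = quadric_deriv k A (H p) y / quadric_deriv k A (H p) (D v)"
      have "quadric_deriv k A (H p) (y + (- c) *\<^sub>R D v) = 0"
        unfolding quadric_deriv_linear using v by (simp add: c_def)
      then have "y + (- c) *\<^sub>R D v \<in> ?T" by (simp only: T)
      moreover have "D (c *\<^sub>R v) = c *\<^sub>R D v"
        using has_derivative_bounded_linear[OF D] by (simp add: bounded_linear.linear linear_scale)
      moreover have "y = (y + (- c) *\<^sub>R D v) + c *\<^sub>R D v" by simp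
      ultimately show ?thesis unfolding fH by (metis (mono_tags, lifting) mem_Collect_eq rangeI)
    qed
    then show "transversal_at H {x. quadric_fn k A x = 0} p"
      unfolding transversal_at_def by blast
  qed
qed

section \<open>The identity theorem along real lines\<close>

lemma islimpt_of_real_interval:
  assumes "e > 0"
  shows "(0::complex) islimpt (complex_of_real ` {-e<..<e})"
  unfolding islimpt_approachable
proof (intro allI impI)
  fix d :: real assume "d > 0"
  then show "\<exists>x'\<in>complex_of_real ` {- e<..<e}. x' \<noteq> 0 \<and> dist x' 0 < d"
    using assms by (intro bexI[of _ "complex_of_real (min d e / 2)"] imageI) (auto simp: min_def)
qed

text \<open>Equals the pulled-back defining function for real \<open>\<sigma>\<close>, so one-variable complex analysis applies to its
  restriction to real lines.\<close>

definition line_extension ::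
    "(complex ^ 'm \<Rightarrow> complex ^ 'k::finite) \<Rightarrow> 'k \<Rightarrow> ('k \<Rightarrow> 'k \<Rightarrow> complex) \<Rightarrow> complex ^ 'm \<Rightarrow> complex ^ 'm \<Rightarrow> complex \<Rightarrow> complex" where
  "line_extension H k A y v \<sigma> = quadric_polar k A (H (y + \<sigma> *s v)) (H (y + cnj \<sigma> *s v))"

definition line_domain :: "(complex ^ 'm) set \<Rightarrow> complex ^ 'm \<Rightarrow> complex ^ 'm \<Rightarrow> complex set" where
  "line_domain B y v = {\<sigma>. y + \<sigma> *s v \<in> B \<and> y + cnj \<sigma> *s v \<in> B}"

lemma line_domain_of_real: "complex_of_real s \<in> line_domain B y v \<longleftrightarrow> y + s *\<^sub>R v \<in> B"
  by (simp add: line_domain_def of_real_smult)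

lemma continuous_on_smult: "continuous_on S f \<Longrightarrow> continuous_on S (\<lambda>\<sigma>. f \<sigma> *s (v :: complex ^ 'm))"
  unfolding vector_scalar_mult_def by (intro continuous_on_vec_lambda continuous_intros)

lemma open_line_domain:
  assumes "open B" shows "open (line_domain B y v)"
proof -
  have "line_domain B y v = (\<lambda>\<sigma>. y + \<sigma> *s v) -` B \<inter> (\<lambda>\<sigma>. y + cnj \<sigma> *s v) -` B"
    by (auto simp: line_domain_def)
  moreover have "open ((\<lambda>\<sigma>. y + \<sigma> *s v) -` B)"
    by (intro open_vimage[OF assms] continuous_intros continuous_on_smult)
  moreover have "open ((\<lambda>\<sigma>. y + cnj \<sigma> *s v) -` B)"
    by (intro open_vimage[OF assms] continuous_intros continuous_on_smult continuous_on_cnj)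
  ultimately show ?thesis by (simp only: open_Int)
qed

lemma convex_line_domain:
  assumes "convex B" shows "convex (line_domain B y v)"
proof (rule convexI)
  fix a b :: complex and s t :: real
  assume h: "a \<in> line_domain B y v" "b \<in> line_domain B y v" "0 \<le> s" "0 \<le> t" "s + t = 1"
  have e: "y + (s *\<^sub>R a + t *\<^sub>R b) *s v = s *\<^sub>R (y + a *s v) + t *\<^sub>R (y + b *s v)" for a b
  proof -
    have "y = (s + t) *\<^sub>R y" using h by simp
    then have "y = s *\<^sub>R y + t *\<^sub>R y" by (simp only: scaleR_left_distrib)
    moreover have "(s *\<^sub>R a + t *\<^sub>R b) *s v = s *\<^sub>R (a *s v) + t *\<^sub>R (b *s v)"
      by (simp add: of_real_smult[symmetric] scaleR_conv_of_real vector_add_ldistrib vector_sadd_rdistrib vector_smult_assoc)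
    ultimately show ?thesis by (simp add: scaleR_right_distrib)
  qed
  have c: "cnj (s *\<^sub>R a + t *\<^sub>R b) = s *\<^sub>R cnj a + t *\<^sub>R cnj b" by (simp add: scaleR_conv_of_real)
  show "s *\<^sub>R a + t *\<^sub>R b \<in> line_domain B y v"
    using h unfolding line_domain_def mem_Collect_eq c e
    by (intro conjI convexD[OF assms]) auto
qed

lemma holomorphic_line_extension:
  assumes H: "holomorphic_map_on H U" and B: "open B" "B \<subseteq> U"
  shows "line_extension H k A y v holomorphic_on line_domain B y v"
  unfolding line_extension_def[abs_def]
  by (rule holomorphic_map_polar_curve[OF H open_line_domain[OF B(1)]])
     (use B(2) in \<open>auto simp: line_domain_def intro!: holomorphic_intros\<close>)

lemma line_extension_of_real:
  assumes "hermitian_matrix k A"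
  shows "line_extension H k A y v (of_real s) = of_real (quadric_fn k A (H (y + s *\<^sub>R v)))"
  unfolding line_extension_def by (simp add: of_real_smult quadric_polar_diag[OF assms])

text \<open>On the line from q to x the extension vanishes at small real parameters; convexity makes
  its domain connected, so the zeros reach the parameter 1.\<close>

lemma pullback_zero_on_ball:
  assumes H: "holomorphic_map_on H U" and A: "hermitian_matrix k A"
    and B: "open B" "convex B" "B \<subseteq> U" and q: "q \<in> B" and N: "open N" "q \<in> N"
    and zero: "\<And>z. z \<in> N \<Longrightarrow> quadric_fn k A (H z) = 0" and x: "x \<in> B"
  shows "quadric_fn k A (H x) = 0"
proof -
  define v where "v = x - q"
  obtain e where e: "e > 0" "\<And>s. \<bar>s\<bar> < e \<Longrightarrow> q + s *\<^sub>R v \<in> N \<inter> B"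
  proof -
    have "open ((\<lambda>s::real. q + s *\<^sub>R v) -` (N \<inter> B))"
      by (intro open_vimage continuous_intros open_Int N B)
    moreover have "0 \<in> (\<lambda>s::real. q + s *\<^sub>R v) -` (N \<inter> B)" using q N by simp
    ultimately obtain e where "e > 0" "ball 0 e \<subseteq> (\<lambda>s::real. q + s *\<^sub>R v) -` (N \<inter> B)"
      using open_contains_ball by blast
    then show ?thesis by (intro that[of e]) (auto simp: subset_iff)
  qed
  have "line_extension H k A q v 1 = 0"
  proof (rule analytic_continuation[OF holomorphic_line_extension[OF H B(1,3)]])
    show "open (line_domain B q v)" "connected (line_domain B q v)"
      using B by (auto intro: open_line_domain convex_connected convex_line_domain)
    show "complex_of_real ` {-e<..<e} \<subseteq> line_domain B q v"
      using e(2) by (auto simp: line_domain_of_real)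
    show "0 \<in> line_domain B q v" "1 \<in> line_domain B q v"
      using q x by (auto simp: line_domain_def v_def)
    show "0 islimpt complex_of_real ` {-e<..<e}" by (rule islimpt_of_real_interval[OF e(1)])
    show "line_extension H k A q v z = 0" if "z \<in> complex_of_real ` {-e<..<e}" for z
      using that e(2) zero by (force simp: line_extension_of_real[OF A])
  qed
  moreover have "line_extension H k A q v (of_real 1) = of_real (quadric_fn k A (H x))"
    unfolding line_extension_of_real[OF A] by (simp add: v_def)
  ultimately show ?thesis by simp
qed

fun iter_deriv :: "('a::real_normed_vector \<Rightarrow> real) \<Rightarrow> 'a \<Rightarrow> nat \<Rightarrow> 'a \<Rightarrow> real" where
  "iter_deriv f v 0 = f"
| "iter_deriv f v (Suc n) = (\<lambda>x. frechet_derivative (iter_deriv f v n) (at x) v)"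

lemma real_analytic_iter_deriv:
  assumes "open U" "real_analytic_on f U"
  shows "real_analytic_on (iter_deriv f v n) U"
  by (induction n) (use assms in \<open>auto intro: real_analytic_directional\<close>)

lemma iter_deriv_along_line:
  assumes U: "open U" and f: "real_analytic_on f U" and x: "y + s *\<^sub>R v \<in> U"
  shows "((\<lambda>s. iter_deriv f v n (y + s *\<^sub>R v)) has_real_derivative
           iter_deriv f v (Suc n) (y + s *\<^sub>R v)) (at s)"
proof -
  let ?f = "iter_deriv f v n"
  have "((\<lambda>s. y + s *\<^sub>R v) has_derivative (\<lambda>h. h *\<^sub>R v)) (at s)"
    by (auto intro!: derivative_eq_intros)
  moreover have D: "(?f has_derivative fderiv ?f (y + s *\<^sub>R v)) (at (y + s *\<^sub>R v))"
    by (rule real_analytic_has_derivative[OF real_analytic_iter_deriv[OF U f] x])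
  ultimately have "((\<lambda>s. ?f (y + s *\<^sub>R v)) has_derivative (\<lambda>h. fderiv ?f (y + s *\<^sub>R v) (h *\<^sub>R v))) (at s)"
    by (rule has_derivative_compose)
  then show ?thesis
    unfolding has_field_derivative_def
    using has_derivative_bounded_linear[OF D]
    by (simp add: bounded_linear.linear linear_scale mult_commute_abs)
qed

text \<open>At real parameters the complex derivatives of the line extension are the iterated real
  derivatives in direction v, so all its Taylor coefficients at 0 vanish.\<close>

lemma pullback_zero_of_iter_derivs:
  assumes H: "holomorphic_map_on H U" and U: "open U" and A: "hermitian_matrix k A"
    and B: "open B" "convex B" "B \<subseteq> U" and y: "y \<in> B" and x: "y + s *\<^sub>R v \<in> B"
    and zero: "\<And>n. iter_deriv (\<lambda>z. quadric_fn k A (H z)) v n y = 0"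
  shows "quadric_fn k A (H (y + s *\<^sub>R v)) = 0"
proof -
  let ?\<phi> = "\<lambda>z. quadric_fn k A (H z)"
  let ?L = "line_extension H k A y v" and ?S = "line_domain B y v"
  note hol = holomorphic_line_extension[OF H B(1,3), of k A y v]
  note oS = open_line_domain[OF B(1), of y v]
  have an: "real_analytic_on ?\<phi> U" by (rule real_analytic_quadric_pullback[OF H U A])
  \<comment> \<open>Stated for every real t in the domain and not only for 0, so that the identity
    can be differentiated in the induction.\<close>
  have *: "(deriv ^^ n) ?L (of_real t) = of_real (iter_deriv ?\<phi> v n (y + t *\<^sub>R v))"
    if "complex_of_real t \<in> ?S" for n t
    using that
  proof (induction n arbitrary: t)
    case (Suc n)
    have tB: "y + t *\<^sub>R v \<in> U" using Suc.prems B(3) by (auto simp: line_domain_of_real)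
    have "((deriv ^^ n) ?L has_field_derivative deriv ((deriv ^^ n) ?L) (of_real t)) (at (of_real t))"
      by (rule holomorphic_derivI[OF holomorphic_higher_deriv[OF hol oS] oS Suc.prems])
    then have 1: "((\<lambda>t. (deriv ^^ n) ?L (of_real t)) has_vector_derivative deriv ((deriv ^^ n) ?L) (of_real t)) (at t)"
      by (rule has_vector_derivative_real_field)
    have "((\<lambda>t. complex_of_real (iter_deriv ?\<phi> v n (y + t *\<^sub>R v))) has_vector_derivative
        of_real (iter_deriv ?\<phi> v (Suc n) (y + t *\<^sub>R v))) (at t)"
      by (rule has_vector_derivative_of_real[OF iter_deriv_along_line[OF U an tB]])
    then have 2: "((\<lambda>t. (deriv ^^ n) ?L (of_real t)) has_vector_derivative
        of_real (iter_deriv ?\<phi> v (Suc n) (y + t *\<^sub>R v))) (at t)"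
    proof (rule has_vector_derivative_transform_within_open)
      show "open (complex_of_real -` ?S)" by (intro open_vimage oS continuous_intros)
      show "t \<in> complex_of_real -` ?S" using Suc.prems by simp
    qed (use Suc.IH in auto)
    show ?case using vector_derivative_unique_at[OF 1 2] by simp
  qed (simp add: line_extension_of_real[OF A])
  have "?L (of_real s) = 0"
  proof (rule holomorphic_fun_eq_0_on_connected[OF hol oS])
    show "connected ?S" using B(2) by (intro convex_connected convex_line_domain)
    show "(deriv ^^ n) ?L 0 = 0" for n using *[of 0 n] zero y line_domain_of_real[of 0 B y v] by simp
    show "0 \<in> ?S" "of_real s \<in> ?S" using y x line_domain_of_real[of 0 B y v] line_domain_of_real[of s B y v] by auto
  qed
  then show ?thesis unfolding line_extension_of_real[OF A] by simp
qed

section \<open>Order of vanishing along a hypersurface\<close>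

lemma isCont_directional:
  assumes "open W" "real_analytic_on \<rho> W" "p \<in> W"
  shows "isCont (\<lambda>x. fderiv \<rho> x v) p"
  by (rule differentiable_imp_continuous_within[OF
        real_analytic_differentiable[OF real_analytic_directional[OF assms(1,2)] assms(3)]])

lemma has_real_derivative_along_line:
  fixes y v :: "'a::euclidean_space"
  assumes W: "open W" and \<rho>: "real_analytic_on \<rho> W" and x: "y + s *\<^sub>R v \<in> W"
  shows "((\<lambda>s. \<rho> (y + s *\<^sub>R v)) has_real_derivative fderiv \<rho> (y + s *\<^sub>R v) v) (at s)"
  using iter_deriv_along_line[OF assms, of 0] by simp

lemma taylor_along_line:
  fixes y v :: "'a::euclidean_space"
  assumes W: "open W" and f: "real_analytic_on f W" and seg: "\<And>t. \<bar>t\<bar> \<le> \<bar>s\<bar> \<Longrightarrow> y + t *\<^sub>R v \<in> W"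
  shows "\<exists>t. \<bar>t\<bar> \<le> \<bar>s\<bar> \<and> f (y + s *\<^sub>R v) = (\<Sum>j<n. iter_deriv f v j y / fact j * s ^ j) +
    iter_deriv f v n (y + t *\<^sub>R v) / fact n * s ^ n"
  using Maclaurin_bi_le[where diff = "\<lambda>j t. iter_deriv f v j (y + t *\<^sub>R v)" and n = n and x = s,
      OF refl] iter_deriv_along_line[OF W f seg] by simp

text \<open>Along \<nu> the function \<rho> grows with slope at least c, so a zero lies within
  parameter distance |\<rho> x| / c by the intermediate value theorem. The factor 2 in the last
  clause guarantees that the segment of half-length |s| around the projected point also stays in the
  neighbourhood.\<close>

lemma hypersurface_projection:
  fixes p \<nu> :: "'a::euclidean_space"
  assumes W: "open W" and \<rho>: "real_analytic_on \<rho> W" and p: "p \<in> W" "\<rho> p = 0"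
    and pos: "fderiv \<rho> p \<nu> > 0" and R: "R > 0"
  obtains \<delta> K where "\<delta> > 0"
    "\<And>x. x \<in> ball p \<delta> \<Longrightarrow> \<exists>s. \<bar>s\<bar> \<le> K * \<bar>\<rho> x\<bar> \<and> \<rho> (x - s *\<^sub>R \<nu>) = 0 \<and>
       (\<forall>\<sigma>. \<bar>\<sigma>\<bar> \<le> 2 * \<bar>s\<bar> \<longrightarrow> x + \<sigma> *\<^sub>R \<nu> \<in> ball p R \<inter> W)"
proof -
  define c where "c = fderiv \<rho> p \<nu> / 2"
  have c: "c > 0" using pos by (simp add: c_def)
  have "c < fderiv \<rho> p \<nu>" using pos by (simp add: c_def)
  from order_tendstoD(1)[OF isCont_directional[OF W \<rho> p(1), of \<nu>, unfolded isCont_def] this]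
  have "\<forall>\<^sub>F x in at p. c < fderiv \<rho> x \<nu>" .
  then have "\<forall>\<^sub>F x in nhds p. c < fderiv \<rho> x \<nu>"
    using \<open>c < fderiv \<rho> p \<nu>\<close> by (simp add: eventually_nhds_conv_at)
  moreover have "\<forall>\<^sub>F x in nhds p. x \<in> W" using W p(1) by (rule eventually_nhds_in_open)
  ultimately have "\<forall>\<^sub>F x in nhds p. x \<in> W \<and> c < fderiv \<rho> x \<nu>" by eventually_elim simp
  then obtain r where r: "r > 0" "\<And>x. dist x p < r \<Longrightarrow> x \<in> W \<and> c < fderiv \<rho> x \<nu>"
    unfolding eventually_nhds_metric by blast
  define e where "e = min r R"
  have e: "e > 0" using r R by (simp add: e_def)
  have in_e: "x + \<sigma> *\<^sub>R \<nu> \<in> ball p R \<inter> W \<and> c < fderiv \<rho> (x + \<sigma> *\<^sub>R \<nu>) \<nu>"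
    if "dist p x < e / 2" "\<bar>\<sigma>\<bar> * norm \<nu> < e / 2" for x \<sigma>
  proof -
    have "dist p (x + \<sigma> *\<^sub>R \<nu>) \<le> dist p x + \<bar>\<sigma>\<bar> * norm \<nu>"
      using dist_triangle[of p "x + \<sigma> *\<^sub>R \<nu>" x] by (simp add: dist_norm)
    then have "dist p (x + \<sigma> *\<^sub>R \<nu>) < e" using that by simp
    then show ?thesis using r(2)[of "x + \<sigma> *\<^sub>R \<nu>"] by (simp add: e_def dist_commute)
  qed
  have "isCont (\<lambda>x. 2 * (\<bar>\<rho> x\<bar> / c) * norm \<nu>) p"
    by (intro continuous_intros differentiable_imp_continuous_within real_analytic_differentiable[OF \<rho> p(1)])
       (use c in auto)
  then have "((\<lambda>x. 2 * (\<bar>\<rho> x\<bar> / c) * norm \<nu>) \<longlongrightarrow> 0) (at p)" by (simp add: isCont_def p(2))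
  then have "\<forall>\<^sub>F x in at p. 2 * (\<bar>\<rho> x\<bar> / c) * norm \<nu> < e / 2"
    by (rule order_tendstoD) (use e in simp)
  then have "\<forall>\<^sub>F x in nhds p. 2 * (\<bar>\<rho> x\<bar> / c) * norm \<nu> < e / 2"
    using p(2) e by (simp add: eventually_nhds_conv_at)
  then obtain d where d: "d > 0" "\<And>x. dist x p < d \<Longrightarrow> 2 * (\<bar>\<rho> x\<bar> / c) * norm \<nu> < e / 2"
    unfolding eventually_nhds_metric by blast
  show ?thesis
  proof (rule that[of "min d (e / 2)" "1 / c"])
    show "min d (e / 2) > 0" using d e by simp
    fix x assume x: "x \<in> ball p (min d (e / 2))"
    \<comment> \<open>With slope at least c, a step of length S changes \<rho> by at least |\<rho>
      x|, which forces a zero within [-S, S].\<close>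
    define S where "S = \<bar>\<rho> x\<bar> / c"
    have S0: "S \<ge> 0" using c by (simp add: S_def)
    have S2: "2 * S * norm \<nu> < e / 2" using d(2)[of x] x by (simp add: S_def dist_commute)
    have seg: "x + \<sigma> *\<^sub>R \<nu> \<in> ball p R \<inter> W \<and> c < fderiv \<rho> (x + \<sigma> *\<^sub>R \<nu>) \<nu>"
      if "\<bar>\<sigma>\<bar> \<le> 2 * S" for \<sigma>
    proof (rule in_e)
      show "\<bar>\<sigma>\<bar> * norm \<nu> < e / 2"
        using mult_right_mono[OF that, of "norm \<nu>"] S2 by simp
    qed (use x in simp)
    define g where "g \<sigma> = \<rho> (x + \<sigma> *\<^sub>R \<nu>)" for \<sigma>
    have der: "(g has_real_derivative fderiv \<rho> (x + \<sigma> *\<^sub>R \<nu>) \<nu>) (at \<sigma>)"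
      if "\<bar>\<sigma>\<bar> \<le> 2 * S" for \<sigma>
      unfolding g_def by (rule has_real_derivative_along_line[OF W \<rho>]) (use seg[OF that] in blast)
    have cont: "continuous_on {-S..S} g"
      by (rule DERIV_continuous_on, rule DERIV_subset[OF der]) (use S0 in auto)
    have grow: "g b - g a \<ge> c * (b - a)" if "a \<le> b" "\<bar>a\<bar> \<le> S" "\<bar>b\<bar> \<le> S" for a b
    proof (cases "a = b")
      case False
      have "\<exists>z>a. z < b \<and> g b - g a = (b - a) * fderiv \<rho> (x + z *\<^sub>R \<nu>) \<nu>"
        by (rule MVT2, use False that in simp, rule der) (use that S0 in linarith)
      then obtain z where "a < z" "z < b" "g b - g a = (b - a) * fderiv \<rho> (x + z *\<^sub>R \<nu>) \<nu>"
        by blast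
      moreover have "c \<le> fderiv \<rho> (x + z *\<^sub>R \<nu>) \<nu>"
      proof -
        have "\<bar>z\<bar> \<le> 2 * S" using calculation(1,2) that S0 by linarith
        then show ?thesis using seg[of z] by simp
      qed
      ultimately show ?thesis using that by (simp add: mult.commute mult_right_mono)
    qed simp
    have cS: "c * S = \<bar>g 0\<bar>" using c by (simp add: S_def g_def)
    have "g (-S) \<le> 0" "0 \<le> g S" using grow[of 0 S] grow[of "-S" 0] S0 cS by auto
    then obtain \<sigma> where \<sigma>: "-S \<le> \<sigma>" "\<sigma> \<le> S" "g \<sigma> = 0"
      using IVT'[of g "-S" 0 S] cont S0 by auto
    show "\<exists>s. \<bar>s\<bar> \<le> 1 / c * \<bar>\<rho> x\<bar> \<and> \<rho> (x - s *\<^sub>R \<nu>) = 0 \<and>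
       (\<forall>\<sigma>. \<bar>\<sigma>\<bar> \<le> 2 * \<bar>s\<bar> \<longrightarrow> x + \<sigma> *\<^sub>R \<nu> \<in> ball p R \<inter> W)"
    proof (intro exI[of _ "- \<sigma>"] conjI allI impI)
      show "\<bar>- \<sigma>\<bar> \<le> 1 / c * \<bar>\<rho> x\<bar>" using \<sigma> by (simp add: S_def)
      show "\<rho> (x - (- \<sigma>) *\<^sub>R \<nu>) = 0" using \<sigma>(3) by (simp add: g_def)
      fix \<sigma>' assume "\<bar>\<sigma>'\<bar> \<le> 2 * \<bar>- \<sigma>\<bar>"
      then have "\<bar>\<sigma>'\<bar> \<le> 2 * S" using \<sigma> by simp
      then show "x + \<sigma>' *\<^sub>R \<nu> \<in> ball p R \<inter> W" using seg by blast
    qed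
  qed
qed

text \<open>Expanding \<open>f\<close> in the direction \<open>\<nu>\<close> from the projection to the hypersurface stands in for the
  factorisation \<open>f = a \<rho>\<^sup>m\<close>.\<close>

lemma transverse_vanishing_asymptotics:
  fixes f \<rho> :: "'a::euclidean_space \<Rightarrow> real"
  assumes U: "open U" "real_analytic_on f U" "p \<in> U"
    and W: "open W" and \<rho>: "real_analytic_on \<rho> W" and p: "p \<in> W" "\<rho> p = 0"
    and pos: "fderiv \<rho> p \<nu> > 0"
    and N: "open N" "p \<in> N"
    and zero: "\<And>y j. y \<in> N \<inter> W \<Longrightarrow> \<rho> y = 0 \<Longrightarrow> j < m \<Longrightarrow> iter_deriv f \<nu> j y = 0"
    and x: "(x \<longlongrightarrow> p) (at (0::real))" and \<kappa>: "((\<lambda>t. \<rho> (x t) / t\<^sup>2) \<longlongrightarrow> \<kappa>) (at 0)"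
  shows "((\<lambda>t. f (x t) / t ^ (2 * m)) \<longlongrightarrow>
    iter_deriv f \<nu> m p / fact m * (\<kappa> / fderiv \<rho> p \<nu>) ^ m) (at 0)"
proof -
  let ?D = "\<lambda>y. fderiv \<rho> y \<nu>" and ?\<psi> = "iter_deriv f \<nu>"
  have "open (U \<inter> N)" "p \<in> U \<inter> N" using U N by auto
  then obtain R0 where R0: "R0 > 0" "ball p R0 \<subseteq> U \<inter> N" using open_contains_ball by blast
  have "\<forall>\<^sub>F y in at p. 0 < ?D y"
    using order_tendstoD(1)[OF isCont_directional[OF W \<rho> p(1), of \<nu>, unfolded isCont_def] pos] .
  then have "\<forall>\<^sub>F y in nhds p. 0 < ?D y"
    using pos by (simp add: eventually_nhds_conv_at)
  then obtain R1 where R1: "R1 > 0" "\<And>y. dist y p < R1 \<Longrightarrow> 0 < ?D y"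
    unfolding eventually_nhds_metric by blast
  define R where "R = min R0 R1"
  have R: "R > 0" using R0 R1 by (simp add: R_def)
  obtain \<delta> K where \<delta>: "\<delta> > 0" and pr:
    "\<And>x. x \<in> ball p \<delta> \<Longrightarrow> \<exists>s. \<bar>s\<bar> \<le> K * \<bar>\<rho> x\<bar> \<and> \<rho> (x - s *\<^sub>R \<nu>) = 0 \<and>
       (\<forall>\<sigma>. \<bar>\<sigma>\<bar> \<le> 2 * \<bar>s\<bar> \<longrightarrow> x + \<sigma> *\<^sub>R \<nu> \<in> ball p R \<inter> W)"
    by (rule hypersurface_projection[OF W \<rho> p pos R]) (rule that)
  \<comment> \<open>Projection moves z by at most K |\<rho> z| along \<nu>, and an intermediate
    point lies at most as far again from the projection; \<open>e z\<close> therefore bounds the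
    distance from p of all points used below.\<close>
  define e where "e z = dist p z + 2 * (K * \<bar>\<rho> z\<bar>) * norm \<nu>" for z
  have key: "\<exists>\<xi> \<xi>'. dist p \<xi> \<le> e z \<and>
      dist p \<xi>' \<le> e z \<and>
      f z = ?\<psi> m \<xi>' / fact m * (\<rho> z / ?D \<xi>) ^ m" if z: "z \<in> ball p \<delta>" for z
  proof -
    obtain s where s: "\<bar>s\<bar> \<le> K * \<bar>\<rho> z\<bar>" "\<rho> (z - s *\<^sub>R \<nu>) = 0"
      "\<And>\<sigma>. \<bar>\<sigma>\<bar> \<le> 2 * \<bar>s\<bar> \<Longrightarrow> z + \<sigma> *\<^sub>R \<nu> \<in> ball p R \<inter> W"
      using pr[OF z] by blast
    define y where "y = z - s *\<^sub>R \<nu>"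
    have yz: "y + \<sigma> *\<^sub>R \<nu> = z + (\<sigma> - s) *\<^sub>R \<nu>" for \<sigma> by (simp add: y_def scaleR_left_diff_distrib)
    have yin: "y + \<sigma> *\<^sub>R \<nu> \<in> ball p R \<inter> W" if "\<bar>\<sigma>\<bar> \<le> \<bar>s\<bar>" for \<sigma>
      unfolding yz using s(3)[of "\<sigma> - s"] that by simp
    have yd: "dist p (y + \<sigma> *\<^sub>R \<nu>) \<le> e z" if "\<bar>\<sigma>\<bar> \<le> \<bar>s\<bar>" for \<sigma>
    proof -
      have "dist p (y + \<sigma> *\<^sub>R \<nu>) \<le> dist p z + \<bar>\<sigma> - s\<bar> * norm \<nu>"
        unfolding yz using dist_triangle[of p "z + (\<sigma> - s) *\<^sub>R \<nu>" z] by (simp add: dist_norm)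
      also have "\<bar>\<sigma> - s\<bar> * norm \<nu> \<le> 2 * (K * \<bar>\<rho> z\<bar>) * norm \<nu>"
        by (rule mult_right_mono) (use that s(1) in auto)
      finally show ?thesis by (simp add: e_def)
    qed
    have ys: "y + s *\<^sub>R \<nu> = z" by (simp add: y_def)
    have UN: "ball p R \<subseteq> U \<inter> N" using R0 by (auto simp: R_def)
    obtain t1 where t1: "\<bar>t1\<bar> \<le> \<bar>s\<bar>" "\<rho> z = \<rho> y + ?D (y + t1 *\<^sub>R \<nu>) * s"
      using taylor_along_line[OF W \<rho>, of s y \<nu> 1] yin by (auto simp: ys)
    obtain t2 where t2: "\<bar>t2\<bar> \<le> \<bar>s\<bar>"
      "f z = (\<Sum>j<m. ?\<psi> j y / fact j * s ^ j) + ?\<psi> m (y + t2 *\<^sub>R \<nu>) / fact m * s ^ m"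
      using taylor_along_line[OF U(1,2), of s y \<nu> m] yin UN unfolding ys by blast
    have y0: "\<rho> y = 0" "y \<in> N \<inter> W" using s(2) yin[of 0] UN by (auto simp: y_def)
    have "(\<Sum>j<m. ?\<psi> j y / fact j * s ^ j) = 0"
      by (rule sum.neutral) (use zero[OF y0(2,1)] in auto)
    moreover have "?D (y + t1 *\<^sub>R \<nu>) > 0"
      using yin[OF t1(1)] R1(2) by (auto simp: R_def dist_commute)
    then have "s = \<rho> z / ?D (y + t1 *\<^sub>R \<nu>)" using t1(2) y0(1) by (simp add: field_simps)
    ultimately have "f z = ?\<psi> m (y + t2 *\<^sub>R \<nu>) / fact m * (\<rho> z / ?D (y + t1 *\<^sub>R \<nu>)) ^ m"
      using t2(2) by simp
    then show ?thesis using yd[OF t1(1)] yd[OF t2(1)] by blast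
  qed
  \<comment> \<open>The intermediate points are chosen as functions of z without any continuity; the
    bound by \<open>e\<close> alone makes them converge to p.\<close>
  have "\<forall>z. \<exists>\<xi> \<xi>'. z \<in> ball p \<delta> \<longrightarrow> dist p \<xi> \<le> e z \<and>
      dist p \<xi>' \<le> e z \<and>
      f z = ?\<psi> m \<xi>' / fact m * (\<rho> z / ?D \<xi>) ^ m"
    using key by blast
  then obtain \<xi> \<xi>' where \<xi>: "\<And>z. z \<in> ball p \<delta> \<Longrightarrow> dist p (\<xi> z) \<le> e z \<and>
      dist p (\<xi>' z) \<le> e z \<and>
      f z = ?\<psi> m (\<xi>' z) / fact m * (\<rho> z / ?D (\<xi> z)) ^ m"
    by metis
  have evb: "\<forall>\<^sub>F t in at 0. x t \<in> ball p \<delta>"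
    using tendstoD[OF x \<delta>] by eventually_elim (simp add: dist_commute)
  have "isCont \<rho> p" by (rule differentiable_imp_continuous_within[OF real_analytic_differentiable[OF \<rho> p(1)]])
  from isCont_tendsto_compose[OF this x] have "((\<lambda>t. \<rho> (x t)) \<longlongrightarrow> 0) (at 0)" by (simp add: p(2))
  then have "((\<lambda>t. e (x t)) \<longlongrightarrow> dist p p + 2 * (K * \<bar>0\<bar>) * norm \<nu>) (at 0)"
    unfolding e_def by (intro tendsto_intros x)
  then have lim0: "((\<lambda>t. e (x t)) \<longlongrightarrow> 0) (at 0)" by simp
  have lim1: "((\<lambda>t. g (x t)) \<longlongrightarrow> p) (at 0)" if "\<And>z. z \<in> ball p \<delta> \<Longrightarrow> dist p (g z) \<le> e z" for g
  proof -
    have "\<forall>\<^sub>F t in at 0. norm (dist (g (x t)) p) \<le> e (x t)"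
      using evb by eventually_elim (simp add: that dist_commute del: mem_ball)
    from Lim_null_comparison[OF this lim0] show ?thesis using tendsto_dist_iff by blast
  qed
  have c1: "((\<lambda>t. ?D (\<xi> (x t))) \<longlongrightarrow> ?D p) (at 0)"
    by (rule isCont_tendsto_compose[OF isCont_directional[OF W \<rho> p(1)] lim1[of \<xi>]]) (use \<xi> in blast)
  have "isCont (?\<psi> m) p"
    by (rule differentiable_imp_continuous_within[OF real_analytic_differentiable[OF real_analytic_iter_deriv[OF U(1,2)] U(3)]])
  then have c2: "((\<lambda>t. ?\<psi> m (\<xi>' (x t))) \<longlongrightarrow> ?\<psi> m p) (at 0)"
    by (rule isCont_tendsto_compose[OF _ lim1[of \<xi>']]) (use \<xi> in blast)
  have "((\<lambda>t. ?\<psi> m (\<xi>' (x t)) / fact m * ((\<rho> (x t) / t\<^sup>2) / ?D (\<xi> (x t))) ^ m) \<longlongrightarrow>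
     ?\<psi> m p / fact m * (\<kappa> / ?D p) ^ m) (at 0)"
    by (intro tendsto_intros c1 c2 \<kappa>) (use pos in auto)
  moreover have "\<forall>\<^sub>F t in at 0. ?\<psi> m (\<xi>' (x t)) / fact m * ((\<rho> (x t) / t\<^sup>2) / ?D (\<xi> (x t))) ^ m = f (x t) / t ^ (2 * m)"
    using evb
  proof eventually_elim
    case (elim t)
    have "f (x t) = ?\<psi> m (\<xi>' (x t)) / fact m * (\<rho> (x t) / ?D (\<xi> (x t))) ^ m" using \<xi>[OF elim] by blast
    then show ?case by (simp add: power_divide power_mult power_mult_distrib flip: power_mult)
  qed
  ultimately show ?thesis by (rule Lim_transform_eventually)
qed

text \<open>Since u is annihilated by d\<rho>, there is no term of order t; both the second-order
  displacement and the Hessian of u contribute at order t^2.\<close>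

lemma defining_function_along_curve:
  fixes \<rho> :: "'a::euclidean_space \<Rightarrow> real"
  assumes W: "open W" and \<rho>: "real_analytic_on \<rho> W" and p: "p \<in> W" "\<rho> p = 0"
    and u: "fderiv \<rho> p u = 0"
  shows "((\<lambda>t. \<rho> (p + t *\<^sub>R u + t\<^sup>2 *\<^sub>R \<eta>) / t\<^sup>2) \<longlongrightarrow> fderiv \<rho> p \<eta> + hess \<rho> p u u / 2) (at 0)"
proof -
  define x where "x t = p + t *\<^sub>R u + t\<^sup>2 *\<^sub>R \<eta>" for t :: real
  have xder: "(x has_derivative (\<lambda>h. h *\<^sub>R (u + (2 * t) *\<^sub>R \<eta>))) (at t)" for t
    unfolding x_def by (rule derivative_eq_intros | simp add: algebra_simps scaleR_add_right)+
  have x0: "x 0 = p" by (simp add: x_def)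
  have xlim: "(x \<longlongrightarrow> p) (at 0)"
    using has_derivative_continuous[OF xder[of 0]] by (simp add: continuous_at x0)
  have evW: "\<forall>\<^sub>F t in at 0. x t \<in> W" using topological_tendstoD[OF xlim W p(1)] .
  let ?D = "\<lambda>t v. fderiv \<rho> (x t) v"
  have lin: "?D t (u + (2 * t) *\<^sub>R \<eta>) = ?D t u + 2 * t * ?D t \<eta>" if "x t \<in> W" for t
    using has_derivative_bounded_linear[OF real_analytic_has_derivative[OF \<rho> that]]
    by (simp add: bounded_linear.linear linear_add linear_scale)
  have der: "((\<lambda>t. \<rho> (x t)) has_real_derivative (?D t u + 2 * t * ?D t \<eta>)) (at t)" if "x t \<in> W" for t
  proof -
    have "((\<lambda>t. \<rho> (x t)) has_derivative (\<lambda>h. ?D t (h *\<^sub>R (u + (2 * t) *\<^sub>R \<eta>)))) (at t)"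
      by (rule has_derivative_compose[OF xder real_analytic_has_derivative[OF \<rho> that]])
    then show ?thesis
      unfolding has_field_derivative_def lin[OF that, symmetric]
      using has_derivative_bounded_linear[OF real_analytic_has_derivative[OF \<rho> that]]
      by (simp add: bounded_linear.linear linear_scale mult_commute_abs)
  qed
  have "((\<lambda>t. \<rho> (x t) / t\<^sup>2) \<longlongrightarrow> fderiv \<rho> p \<eta> + hess \<rho> p u u / 2) (at 0)"
  proof (rule lhopital)
    show "((\<lambda>t. \<rho> (x t)) \<longlongrightarrow> 0) (at 0)"
      using isCont_tendsto_compose[OF differentiable_imp_continuous_within[OF real_analytic_differentiable[OF \<rho> p(1)]] xlim]
      by (simp add: p(2))
    show "((\<lambda>t::real. t\<^sup>2) \<longlongrightarrow> 0) (at 0)" by (auto intro!: tendsto_eq_intros)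
    show "\<forall>\<^sub>F t in at 0. (t::real)\<^sup>2 \<noteq> 0" "\<forall>\<^sub>F t in at 0. 2 * t \<noteq> (0::real)"
      by (simp_all add: eventually_at_filter)
    show "\<forall>\<^sub>F t in at 0. ((\<lambda>t. \<rho> (x t)) has_real_derivative (?D t u + 2 * t * ?D t \<eta>)) (at t)"
      using evW by eventually_elim (rule der)
    show "\<forall>\<^sub>F t in at 0. ((\<lambda>t::real. t\<^sup>2) has_real_derivative 2 * t) (at t)"
      by (auto intro!: always_eventually derivative_eq_intros)
    have "((\<lambda>t. ?D t u) has_derivative (\<lambda>h. hess \<rho> p (h *\<^sub>R (u + (2 * 0) *\<^sub>R \<eta>)) u)) (at 0)"
      unfolding hess_def
      by (rule has_derivative_compose[OF xder])
         (use real_analytic_has_derivative[OF real_analytic_directional[OF W \<rho>] p(1)] in \<open>simp add: x0\<close>)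
    moreover have "hess \<rho> p (h *\<^sub>R u) u = h * hess \<rho> p u u" for h
      unfolding hess_def
      using has_derivative_bounded_linear[OF real_analytic_has_derivative[OF real_analytic_directional[OF W \<rho>] p(1)]]
      by (simp add: bounded_linear.linear linear_scale)
    ultimately have "((\<lambda>t. ?D t u) has_real_derivative hess \<rho> p u u) (at 0)"
      unfolding has_field_derivative_def by (simp add: mult_commute_abs)
    then have l1: "((\<lambda>t. ?D t u / t) \<longlongrightarrow> hess \<rho> p u u) (at 0)"
      unfolding DERIV_def by (simp add: x0 u)
    have l2: "((\<lambda>t. ?D t \<eta>) \<longlongrightarrow> fderiv \<rho> p \<eta>) (at 0)"
      by (rule isCont_tendsto_compose[OF isCont_directional[OF W \<rho> p(1)] xlim])
    \<comment> \<open>Division by 2t leaves the difference quotient of \<open>?D t u\<close>, which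
      vanishes at t = 0, so one use of l'Hospital's rule suffices.\<close>
    have "((\<lambda>t. ?D t \<eta> + (?D t u / t) / 2) \<longlongrightarrow> fderiv \<rho> p \<eta> + hess \<rho> p u u / 2) (at 0)"
      by (intro tendsto_intros l1 l2) simp
    moreover have "\<forall>\<^sub>F t in at 0. ?D t \<eta> + (?D t u / t) / 2 = (?D t u + 2 * t * ?D t \<eta>) / (2 * t)"
      unfolding eventually_at_filter by (rule always_eventually) (simp add: field_simps)
    ultimately show "((\<lambda>t. (?D t u + 2 * t * ?D t \<eta>) / (2 * t)) \<longlongrightarrow> fderiv \<rho> p \<eta> + hess \<rho> p u u / 2) (at 0)"
      by (rule Lim_transform_eventually)
  qed
  then show ?thesis by (simp add: x_def)
qed

section \<open>Hermitian forms and the Levi form\<close>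

definition hermitian_form :: "(complex ^ 'm \<Rightarrow> complex ^ 'm \<Rightarrow> complex) \<Rightarrow> bool" where
  "hermitian_form L \<longleftrightarrow> (\<forall>u v w. L (u + v) w = L u w + L v w) \<and> (\<forall>c u v. L (c *s u) v = c * L u v) \<and>
     (\<forall>u v. L v u = cnj (L u v))"

lemma hermitian_formD:
  assumes "hermitian_form L"
  shows herm_add_left: "L (u + v) w = L u w + L v w"
    and herm_scale_left: "L (c *s u) v = c * L u v"
    and herm_cnj: "L v u = cnj (L u v)"
  using assms unfolding hermitian_form_def by blast+

lemma herm_add_right:
  assumes L: "hermitian_form L"
  shows "L w (u + v) = L w u + L w v"
  by (subst (1 2 3) herm_cnj[OF L]) (simp add: herm_add_left[OF L])

lemma herm_scale_right:
  assumes L: "hermitian_form L"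
  shows "L u (c *s v) = cnj c * L u v"
  by (subst (1 2) herm_cnj[OF L]) (simp add: herm_scale_left[OF L])

lemma herm_zero_left: "hermitian_form L \<Longrightarrow> L 0 v = 0"
  using herm_scale_left[of L 0 0 v] by simp

lemma herm_zero_right: "hermitian_form L \<Longrightarrow> L v 0 = 0"
  using herm_scale_right[of L v 0 0] by simp

lemma herm_diff_left: "hermitian_form L \<Longrightarrow> L (u - v) w = L u w - L v w"
  using herm_add_left[of L "u - v" v w] by simp

lemma herm_diff_right: "hermitian_form L \<Longrightarrow> L w (u - v) = L w u - L w v"
  using herm_add_right[of L w "u - v" v] by simp

lemma herm_sum_left:
  "hermitian_form L \<Longrightarrow> L (\<Sum>i\<in>I. f i) v = (\<Sum>i\<in>I. L (f i) v)"
  by (induction I rule: infinite_finite_induct) (simp_all add: herm_zero_left herm_add_left)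

lemma herm_sum_right:
  "hermitian_form L \<Longrightarrow> L v (\<Sum>i\<in>I. f i) = (\<Sum>i\<in>I. L v (f i))"
  by (induction I rule: infinite_finite_induct) (simp_all add: herm_zero_right herm_add_right)

lemma herm_self_real: "hermitian_form L \<Longrightarrow> L u u = of_real (Re (L u u))"
  by (metis herm_cnj Reals_cnj_iff of_real_Re)

lemma herm_expand:
  assumes L: "hermitian_form L"
  shows "L u v = (\<Sum>j\<in>UNIV. \<Sum>k\<in>UNIV. L (axis j 1) (axis k 1) * u $ j * cnj (v $ k))"
proof -
  have "L u v = L (\<Sum>j\<in>UNIV. u $ j *s axis j 1) (\<Sum>k\<in>UNIV. v $ k *s axis k 1)"
    by (simp only: basis_expansion)
  also have "\<dots> = (\<Sum>k\<in>UNIV. \<Sum>j\<in>UNIV. L (axis j 1) (axis k 1) * u $ j * cnj (v $ k))"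
    unfolding herm_sum_right[OF L] herm_sum_left[OF L]
      herm_scale_left[OF L] herm_scale_right[OF L] by (simp add: mult_ac sum_distrib_left)
  also have "\<dots> = (\<Sum>j\<in>UNIV. \<Sum>k\<in>UNIV. L (axis j 1) (axis k 1) * u $ j * cnj (v $ k))"
    by (rule sum.swap)
  finally show ?thesis .
qed

text \<open>Polarisation with u + v and u + i v isolates \<open>L u v\<close>.\<close>

lemma herm_totally_isotropic:
  assumes L: "hermitian_form L" and S: "vec.subspace S" and iso: "\<And>u. u \<in> S \<Longrightarrow> L u u = 0"
    and u: "u \<in> S" and v: "v \<in> S"
  shows "L u v = 0"
proof -
  have "L (u + v) (u + v) = 0" "L (u + \<i> *s v) (u + \<i> *s v) = 0"
    using S u v by (auto intro!: iso vec.subspace_add vec.subspace_scale)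
  then have "L u v + L v u = 0" "- \<i> * L u v + \<i> * L v u = 0"
    using iso[OF u] iso[OF v] iso[OF vec.subspace_scale[OF S v, of \<i>]]
    by (simp_all add: herm_add_left[OF L] herm_add_right[OF L]
        herm_scale_left[OF L] herm_scale_right[OF L])
  then have "\<i> * (L u v + L v u) - (- \<i> * L u v + \<i> * L v u) = 0" by simp
  then show ?thesis by (simp add: algebra_simps)
qed

text \<open>A maximal orthogonal family of non-isotropic vectors works, because the form vanishes on its
  orthogonal complement.\<close>

lemma herm_orthogonal_family:
  fixes S :: "(complex ^ 'm::finite) set"
  assumes L: "hermitian_form L" and S: "vec.subspace S"
  obtains E where "finite E" "E \<subseteq> S" "\<And>e. e \<in> E \<Longrightarrow> L e e \<noteq> 0"
    "\<And>e e'. e \<in> E \<Longrightarrow> e' \<in> E \<Longrightarrow> e \<noteq> e' \<Longrightarrow> L e e' = 0"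
    "vec.dim S \<le> card E + vec.dim {u \<in> S. \<forall>v\<in>S. L u v = 0}"
proof -
  define P where "P E \<longleftrightarrow> finite E \<and> E \<subseteq> S \<and> (\<forall>e\<in>E. L e e \<noteq> 0) \<and> (\<forall>e\<in>E. \<forall>e'\<in>E. e \<noteq> e' \<longrightarrow> L e e' = 0)" for E
  have sum1: "(\<Sum>a\<in>E. c a * L a e) = c e * L e e" if "P E" "e \<in> E" for E e and c :: "complex ^ 'm \<Rightarrow> complex"
  proof -
    have "(\<Sum>a\<in>E. c a * L a e) = (\<Sum>a\<in>E. if a = e then c e * L e e else 0)"
      using that by (intro sum.cong) (auto simp: P_def)
    then show ?thesis using that by (simp add: P_def)
  qed
  have card: "card E \<le> CARD('m)" if "P E" for E
  proof -
    have "vec.independent E"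
    proof (rule vec.independent_if_scalars_zero)
      fix c x assume h: "(\<Sum>a\<in>E. c a *s a) = 0" "x \<in> E"
      have "L (\<Sum>a\<in>E. c a *s a) x = c x * L x x"
        unfolding herm_sum_left[OF L] herm_scale_left[OF L] by (rule sum1[OF that h(2)])
      then show "c x = 0" using h that by (simp add: herm_zero_left[OF L] P_def)
    qed (use that in \<open>simp add: P_def\<close>)
    then have "card E \<le> vec.dim (UNIV :: (complex ^ 'm) set)"
      by (intro vec.independent_card_le_dim) auto
    then show ?thesis by (simp only: vec_dim_card)
  qed
  have "P {}" by (simp add: P_def)
  \<comment> \<open>Such families are linearly independent, so their sizes are bounded and a largest
    one exists.\<close>
  have "\<exists>E. P E \<and> (\<forall>E'. P E' \<longrightarrow> card E' \<le> card E)"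
    by (rule ex_has_greatest_nat[where P = P and k = "{}" and b = "Suc CARD('m)"])
       (use \<open>P {}\<close> card in \<open>auto intro: le_imp_less_Suc\<close>)
  then obtain E where PE: "P E" and max: "\<And>E'. P E' \<Longrightarrow> card E' \<le> card E"
    by blast
  define S' where "S' = {u \<in> S. \<forall>e\<in>E. L u e = 0}"
  have S': "vec.subspace S'"
    unfolding S'_def vec.subspace_def
    using S by (auto simp: vec.subspace_0 vec.subspace_add vec.subspace_scale herm_zero_left[OF L]
        herm_add_left[OF L] herm_scale_left[OF L])
  have iso: "L u u = 0" if u: "u \<in> S'" for u
  proof (rule ccontr)
    assume ne: "L u u \<noteq> 0"
    then have "u \<notin> E" using u by (auto simp: S'_def)
    have "L e u = 0" if "e \<in> E" for e
      using herm_cnj[OF L, of e u] u that by (simp add: S'_def)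
    then have "P (insert u E)"
      using PE u ne unfolding P_def S'_def by auto
    from max[OF this] show False using \<open>u \<notin> E\<close> PE by (simp add: P_def)
  qed
  \<comment> \<open>The orthogonal projection onto the span of E; the division is possible because
    no member of E is isotropic.\<close>
  define pr where "pr v = (\<Sum>a\<in>E. (L v a / L a a) *s a)" for v
  have prS': "v - pr v \<in> S'" if "v \<in> S" for v
  proof -
    have "pr v \<in> S"
      unfolding pr_def using PE by (intro vec.subspace_sum[OF S] vec.subspace_scale[OF S]) (auto simp: P_def)
    moreover have "L (v - pr v) e = 0" if "e \<in> E" for e
      unfolding herm_diff_left[OF L] pr_def herm_sum_left[OF L] herm_scale_left[OF L] sum1[OF PE that]
      using PE that by (simp add: P_def)
    ultimately show ?thesis using that S by (simp add: S'_def vec.subspace_diff)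
  qed
  let ?R = "{u \<in> S. \<forall>v\<in>S. L u v = 0}"
  have S'R: "S' \<subseteq> ?R"
  proof
    fix u assume u: "u \<in> S'"
    \<comment> \<open>v splits into \<open>v - pr v\<close>, which pairs to zero because the form
      vanishes on \<open>S'\<close>, and \<open>pr v\<close>, which pairs to zero because u is
      orthogonal to E.\<close>
    have "L u v = 0" if v: "v \<in> S" for v
    proof -
      have "L u (v - pr v) = 0"
        by (rule herm_totally_isotropic[OF L S' iso u prS'[OF v]])
      moreover have "L u (pr v) = 0"
        unfolding pr_def herm_sum_right[OF L] herm_scale_right[OF L]
        using u by (simp add: S'_def)
      ultimately show ?thesis by (simp add: herm_diff_right[OF L])
    qed
    then show "u \<in> ?R" using u by (simp add: S'_def)
  qed
  obtain B where B: "B \<subseteq> ?R" "vec.independent B" "?R \<subseteq> vec.span B" "card B = vec.dim ?R"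
    by (rule vec.basis_exists)
  have "S \<subseteq> vec.span (E \<union> B)"
  proof
    fix v assume v: "v \<in> S"
    have "v - pr v \<in> vec.span (E \<union> B)"
      using prS'[OF v] S'R B(3) vec.span_mono[of B "E \<union> B"] by blast
    moreover have "pr v \<in> vec.span (E \<union> B)"
      unfolding pr_def by (intro vec.span_sum vec.span_scale vec.span_base) auto
    ultimately have "(v - pr v) + pr v \<in> vec.span (E \<union> B)" by (rule vec.span_add)
    then show "v \<in> vec.span (E \<union> B)" by simp
  qed
  then have "vec.dim S \<le> card (E \<union> B)"
    using PE vec.independent_bound_general[OF B(2)] by (intro vec.dim_le_card) (auto simp: P_def)
  also have "\<dots> \<le> card E + vec.dim ?R" using card_Un_le[of E B] B(4) by simp
  finally show ?thesis
    using that[of E] PE unfolding P_def by blast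
qed

lemma hyperplane_dim:
  fixes l :: "complex ^ 'm::finite \<Rightarrow> complex"
  assumes add: "\<And>u v. l (u + v) = l u + l v" and scale: "\<And>c u. l (c *s u) = c * l u" and \<nu>: "l \<nu> \<noteq> 0"
  shows "vec.subspace {u. l u = 0}" "CARD('m) \<le> Suc (vec.dim {u. l u = 0})"
proof -
  let ?S = "{u. l u = 0}"
  have l0: "l 0 = 0" using scale[of 0 0] by simp
  show "vec.subspace ?S" unfolding vec.subspace_def by (auto simp: add scale l0)
  obtain B where B: "B \<subseteq> ?S" "vec.independent B" "?S \<subseteq> vec.span B" "card B = vec.dim ?S"
    by (rule vec.basis_exists)
  have "(UNIV :: (complex ^ 'm) set) \<subseteq> vec.span (insert \<nu> B)"
  proof
    fix x
    let ?c = "l x / l \<nu>"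
    have "l ((x + (- ?c) *s \<nu>)) = 0" unfolding add scale using \<nu> by simp
    then have "x + (- ?c) *s \<nu> \<in> vec.span (insert \<nu> B)"
      using B(3) vec.span_mono[of B "insert \<nu> B"] by blast
    moreover have "?c *s \<nu> \<in> vec.span (insert \<nu> B)" by (intro vec.span_scale vec.span_base) simp
    ultimately have "(x + (- ?c) *s \<nu>) + ?c *s \<nu> \<in> vec.span (insert \<nu> B)" by (rule vec.span_add)
    moreover have "(x + (- ?c) *s \<nu>) + ?c *s \<nu> = x" by (simp add: vec_eq_iff)
    ultimately show "x \<in> vec.span (insert \<nu> B)" by simp
  qed
  then have "vec.dim (UNIV :: (complex ^ 'm) set) \<le> card (insert \<nu> B)"
    using vec.independent_bound_general[OF B(2)] by (intro vec.dim_le_card) auto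
  also have "\<dots> \<le> Suc (card B)" using vec.independent_bound_general[OF B(2)] by (simp add: card_insert_if)
  finally show "CARD('m) \<le> Suc (vec.dim ?S)" using B(4) by (simp only: vec_dim_card)
qed

section \<open>The Levi form through the real Hessian\<close>

lemma hess_add_left:
  assumes "open W" "real_analytic_on f W" "p \<in> W"
  shows "hess f p (u + v) w = hess f p u w + hess f p v w"
    and hess_scale_left: "hess f p (r *\<^sub>R u) w = r * hess f p u w"
  using has_derivative_bounded_linear[OF real_analytic_has_derivative[OF real_analytic_directional[OF assms(1,2), of w] assms(3)]]
  unfolding hess_def by (simp_all add: bounded_linear.linear linear_add linear_scale)

text \<open>The part of the real Hessian that is sesquilinear under multiplication by i. The factor
  1/4 is the product of the two factors 1/2 in the Wirtinger derivatives, so this is the Levi form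
  itself.\<close>

definition levi_sesq :: "(complex ^ 'm::finite \<Rightarrow> real) \<Rightarrow> complex ^ 'm \<Rightarrow> complex ^ 'm \<Rightarrow> complex ^ 'm \<Rightarrow> complex" where
  "levi_sesq \<rho> p u v = Complex ((hess \<rho> p u v + hess \<rho> p (\<i> *s u) (\<i> *s v)) / 4)
     ((hess \<rho> p u (\<i> *s v) - hess \<rho> p (\<i> *s u) v) / 4)"

text \<open>The complex bilinear part of the Hessian, normalised so that the Hessian on the diagonal
  is 2 Re of the Levi form plus Re of this form.\<close>

definition hess_bilin :: "(complex ^ 'm::finite \<Rightarrow> real) \<Rightarrow> complex ^ 'm \<Rightarrow> complex ^ 'm \<Rightarrow> complex ^ 'm \<Rightarrow> complex" where
  "hess_bilin \<rho> p u v = Complex ((hess \<rho> p u v - hess \<rho> p (\<i> *s u) (\<i> *s v)) / 2)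
     (- (hess \<rho> p u (\<i> *s v) + hess \<rho> p (\<i> *s u) v) / 2)"

lemma complex_smult_decompose: "c *s (u :: complex ^ 'm) = Re c *\<^sub>R u + Im c *\<^sub>R (\<i> *s u)"
proof -
  have "c *s u = (of_real (Re c) + of_real (Im c) * \<i>) *s u"
    by (metis complex_eq mult.commute)
  then show ?thesis
    by (simp only: vector_sadd_rdistrib of_real_smult[symmetric] vector_smult_assoc)
qed

lemma i_smult_i_smult: "\<i> *s (\<i> *s u) = - (u :: complex ^ 'm)"
  by (simp add: vec_eq_iff)

text \<open>The complex linear part of d\<rho>, the functional with coefficients the Z-derivatives
  of \<rho>; its real part is half of d\<rho>.\<close>

definition levi_cov :: "(complex ^ 'm::finite \<Rightarrow> real) \<Rightarrow> complex ^ 'm \<Rightarrow> complex ^ 'm \<Rightarrow> complex" where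
  "levi_cov \<rho> p u = Complex (fderiv \<rho> p u / 2) (- fderiv \<rho> p (\<i> *s u) / 2)"

lemma complex_linear_of_real_linear:
  fixes f :: "complex ^ 'm \<Rightarrow> complex"
  assumes add: "\<And>u v. f (u + v) = f u + f v" and i: "\<And>u. f (\<i> *s u) = \<i> * f u"
    and r: "\<And>r u. f (r *\<^sub>R u) = of_real r * f u"
  shows "f (c *s u) = c * f u"
proof -
  have "f (c *s u) = (of_real (Re c) + \<i> * of_real (Im c)) * f u"
    unfolding complex_smult_decompose[of c] add r i by (simp add: algebra_simps)
  then show ?thesis by (simp only: complex_eq[symmetric])
qed

lemma i_smult_scaleR: "\<i> *s (r *\<^sub>R u) = r *\<^sub>R (\<i> *s (u :: complex ^ 'm))"
  by (simp add: of_real_smult[symmetric] vector_smult_assoc mult.commute)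

context
  fixes \<rho> :: "complex ^ 'm::finite \<Rightarrow> real" and W p
  assumes W: "open W" and \<rho>: "real_analytic_on \<rho> W" and p: "p \<in> W"
begin

lemma hess_simps:
  "hess \<rho> p (u + v) w = hess \<rho> p u w + hess \<rho> p v w"
  "hess \<rho> p w (u + v) = hess \<rho> p w u + hess \<rho> p w v"
  "hess \<rho> p (r *\<^sub>R u) w = r * hess \<rho> p u w"
  "hess \<rho> p w (r *\<^sub>R u) = r * hess \<rho> p w u"
  "hess \<rho> p (- u) w = - hess \<rho> p u w"
  "hess \<rho> p w (- u) = - hess \<rho> p w u"
  using hess_add_left[OF W \<rho> p] hess_scale_left[OF W \<rho> p] hess_symmetric[OF W \<rho> p, of w]
    hess_scale_left[OF W \<rho> p, of "-1"]
  by simp_all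

lemma hermitian_levi_sesq: "hermitian_form (levi_sesq \<rho> p)"
  unfolding hermitian_form_def
proof (intro conjI allI)
  show *: "levi_sesq \<rho> p (u + v) w = levi_sesq \<rho> p u w + levi_sesq \<rho> p v w" for u v w
    unfolding levi_sesq_def by (simp add: complex_eq_iff hess_simps vector_add_ldistrib field_simps)
  show "levi_sesq \<rho> p (c *s u) v = c * levi_sesq \<rho> p u v" for c u v
    by (rule complex_linear_of_real_linear[OF *])
       (simp_all add: levi_sesq_def complex_eq_iff hess_simps i_smult_i_smult i_smult_scaleR field_simps)
  show "levi_sesq \<rho> p v u = cnj (levi_sesq \<rho> p u v)" for u v
    unfolding levi_sesq_def
    using hess_symmetric[OF W \<rho> p, of v u] hess_symmetric[OF W \<rho> p, of "\<i> *s v" u]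
      hess_symmetric[OF W \<rho> p, of v "\<i> *s u"] hess_symmetric[OF W \<rho> p, of "\<i> *s v" "\<i> *s u"]
    by (simp add: complex_eq_iff field_simps)
qed

lemma hess_bilin_add_left: "hess_bilin \<rho> p (u + v) w = hess_bilin \<rho> p u w + hess_bilin \<rho> p v w"
  unfolding hess_bilin_def by (simp add: complex_eq_iff hess_simps vector_add_ldistrib field_simps)

lemma hess_bilin_sym: "hess_bilin \<rho> p u v = hess_bilin \<rho> p v u"
    unfolding hess_bilin_def
    using hess_symmetric[OF W \<rho> p, of v u] hess_symmetric[OF W \<rho> p, of "\<i> *s v" u]
      hess_symmetric[OF W \<rho> p, of v "\<i> *s u"] hess_symmetric[OF W \<rho> p, of "\<i> *s v" "\<i> *s u"]
    by (simp add: complex_eq_iff field_simps)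

lemma hess_bilin_scale_left: "hess_bilin \<rho> p (c *s u) v = c * hess_bilin \<rho> p u v"
  by (rule complex_linear_of_real_linear[OF hess_bilin_add_left])
     (simp_all add: hess_bilin_def complex_eq_iff hess_simps i_smult_i_smult i_smult_scaleR field_simps)

lemma hess_diag_decompose: "hess \<rho> p u u = 2 * Re (levi_sesq \<rho> p u u) + Re (hess_bilin \<rho> p u u)"
  unfolding levi_sesq_def hess_bilin_def by (simp add: field_simps)

lemma frechet_derivative_of_real_comp:
  "z \<in> W \<Longrightarrow> frechet_derivative (\<lambda>z. complex_of_real (\<rho> z)) (at z) v = of_real (fderiv \<rho> z v)"
  using frechet_derivative_at[OF bounded_linear.has_derivative[OF bounded_linear_of_real real_analytic_has_derivative[OF \<rho>]]]
  by metis

lemma axis_i: "axis j \<i> = \<i> *s (axis j 1 :: complex ^ 'm)"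
  by (simp add: vec_eq_iff axis_def)

lemma d_Z_d_Zbar: "d_Z j (d_Zbar k (\<lambda>z. complex_of_real (\<rho> z))) p = levi_sesq \<rho> p (axis j 1) (axis k 1)"
proof -
  let ?g = "\<lambda>z. (of_real (fderiv \<rho> z (axis k 1)) + \<i> * of_real (fderiv \<rho> z (axis k \<i>))) / 2"
  \<comment> \<open>Needed on all of W, because this function is differentiated once more at
    p.\<close>
  have eq: "d_Zbar k (\<lambda>z. complex_of_real (\<rho> z)) z = ?g z" if "z \<in> W" for z
    unfolding d_Zbar_def frechet_derivative_of_real_comp[OF that] ..
  note D = real_analytic_has_derivative[OF real_analytic_directional[OF W \<rho>] p]
  have g: "(?g has_derivative (\<lambda>h. (of_real (hess \<rho> p h (axis k 1)) + \<i> * of_real (hess \<rho> p h (axis k \<i>))) / 2)) (at p)"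
    unfolding hess_def
    by (intro bounded_linear.has_derivative[OF bounded_linear_divide] has_derivative_add has_derivative_mult_right
        bounded_linear.has_derivative[OF bounded_linear_of_real D])
  have "(d_Zbar k (\<lambda>z. complex_of_real (\<rho> z)) has_derivative
      (\<lambda>h. (of_real (hess \<rho> p h (axis k 1)) + \<i> * of_real (hess \<rho> p h (axis k \<i>))) / 2)) (at p)"
    by (rule has_derivative_transform_within_open[OF g W p]) (simp only: eq)
  from frechet_derivative_at[OF this] show ?thesis
    unfolding d_Z_def levi_sesq_def axis_i[of k] axis_i[of j]
    by (simp add: complex_eq_iff fun_eq_iff flip: axis_i)
qed

lemma levi_form_eq: "levi_form \<rho> p u v = levi_sesq \<rho> p u v"
  unfolding levi_form_def d_Z_d_Zbar herm_expand[OF hermitian_levi_sesq, of u v] ..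

lemma frechet_derivative_smult:
  "fderiv \<rho> p (c *s u) = Re c * fderiv \<rho> p u + Im c * fderiv \<rho> p (\<i> *s u)"
  using has_derivative_bounded_linear[OF real_analytic_has_derivative[OF \<rho> p]]
  unfolding complex_smult_decompose[of c] by (simp add: bounded_linear.linear linear_add linear_scale)

lemma levi_cov_add: "levi_cov \<rho> p (u + v) = levi_cov \<rho> p u + levi_cov \<rho> p v"
  using has_derivative_bounded_linear[OF real_analytic_has_derivative[OF \<rho> p]]
  unfolding levi_cov_def
  by (simp add: complex_eq_iff bounded_linear.linear linear_add vector_add_ldistrib add_divide_distrib)

lemma levi_cov_scale: "levi_cov \<rho> p (c *s u) = c * levi_cov \<rho> p u"
proof -
  have e: "\<i> *s (c *s u) = (\<i> * c) *s u" by (simp add: vector_smult_assoc)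
  show ?thesis
    unfolding levi_cov_def e frechet_derivative_smult[of c] frechet_derivative_smult[of "\<i> * c"]
    by (simp add: complex_eq_iff field_simps)
qed

lemma levi_cov_sum: "levi_cov \<rho> p (\<Sum>i\<in>I. f i) = (\<Sum>i\<in>I. levi_cov \<rho> p (f i))"
proof (induction I rule: infinite_finite_induct)
  case (insert i I)
  then show ?case by (simp add: levi_cov_add)
qed (use levi_cov_scale[of 0 0] in simp_all)

lemma levi_space_eq: "levi_space \<rho> p = {u. levi_cov \<rho> p u = 0}"
proof -
  have d: "d_Z j (\<lambda>z. complex_of_real (\<rho> z)) p = levi_cov \<rho> p (axis j 1)" for j
    unfolding d_Z_def frechet_derivative_of_real_comp[OF p] levi_cov_def axis_i[of j]
    by (simp add: complex_eq_iff)
  have "levi_cov \<rho> p u = (\<Sum>j\<in>UNIV. d_Z j (\<lambda>z. complex_of_real (\<rho> z)) p * u $ j)" for u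
  proof -
    have "levi_cov \<rho> p u = levi_cov \<rho> p (\<Sum>j\<in>UNIV. u $ j *s axis j 1)"
      by (simp only: basis_expansion)
    then show ?thesis unfolding levi_cov_sum levi_cov_scale d by (simp add: mult.commute)
  qed
  then show ?thesis unfolding levi_space_def by simp
qed

lemma Re_levi_cov: "fderiv \<rho> p u = 2 * Re (levi_cov \<rho> p u)"
  by (simp add: levi_cov_def)

lemma continuous_levi_cov: "isCont (\<lambda>x. levi_cov \<rho> x u) p"
  unfolding levi_cov_def isCont_def
  by (intro tendsto_Complex tendsto_intros isCont_directional[OF W \<rho> p, unfolded isCont_def]) auto

lemma continuous_hess: "isCont (\<lambda>x. hess \<rho> x u v) p"
  unfolding hess_def
  by (rule isCont_directional[OF W real_analytic_directional[OF W \<rho>] p])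

lemma continuous_levi_sesq: "isCont (\<lambda>x. levi_sesq \<rho> x u v) p"
  unfolding levi_sesq_def isCont_def
  by (intro tendsto_Complex tendsto_intros continuous_hess[unfolded isCont_def]) auto

end

text \<open>Diagonal dominance is an open condition; this replaces the semicontinuity of the number of
  zero eigenvalues.\<close>

definition dominant_gram :: "'i set \<Rightarrow> ('i \<Rightarrow> 'i \<Rightarrow> complex) \<Rightarrow> bool" where
  "dominant_gram E G \<longleftrightarrow> (\<forall>b\<in>E. (\<Sum>a\<in>E - {b}. cmod (G a b)) < cmod (G b b))"

text \<open>At an index b where |c b| is largest, the b-th equation contradicts strict dominance of
  the diagonal entry unless c b = 0. The factor \<kappa> allows Gram matrices known only up to a
  common nonzero scalar.\<close>

lemma dominant_gram_nonsingular:
  assumes G: "dominant_gram E G" and E: "finite E"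
    and zero': "\<And>b. b \<in> E \<Longrightarrow> (\<Sum>a\<in>E. c a * K a b) = 0" and a: "a \<in> E"
    and K: "\<And>a b. a \<in> E \<Longrightarrow> b \<in> E \<Longrightarrow> K a b = \<kappa> * G a b" and \<kappa>: "\<kappa> \<noteq> 0"
  shows "c a = 0"
proof -
  have zero: "(\<Sum>a\<in>E. c a * G a b) = 0" if "b \<in> E" for b
  proof -
    have "\<kappa> * (\<Sum>a\<in>E. c a * G a b) = (\<Sum>a\<in>E. c a * K a b)"
      unfolding sum_distrib_left using K that by (intro sum.cong) simp_all
    then show ?thesis using zero'[OF that] \<kappa> by simp
  qed
  obtain b where b: "b \<in> E" and max: "\<And>a. a \<in> E \<Longrightarrow> cmod (c a) \<le> cmod (c b)"
  proof -
    have "Max ((\<lambda>a. cmod (c a)) ` E) \<in> (\<lambda>a. cmod (c a)) ` E" using E a by (intro Max_in) auto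
    then obtain b where b: "b \<in> E" "Max ((\<lambda>a. cmod (c a)) ` E) = cmod (c b)" by blast
    have "cmod (c a) \<le> cmod (c b)" if "a \<in> E" for a
      using E that unfolding b(2)[symmetric] by (intro Max_ge) auto
    then show ?thesis using that b(1) by blast
  qed
  have "c b * G b b = - (\<Sum>a\<in>E - {b}. c a * G a b)"
    using zero[OF b] unfolding sum.remove[OF E b] by (simp add: eq_neg_iff_add_eq_0)
  then have "cmod (c b) * cmod (G b b) = cmod (\<Sum>a\<in>E - {b}. c a * G a b)"
    by (metis norm_minus_cancel norm_mult)
  also have "\<dots> \<le> (\<Sum>a\<in>E - {b}. cmod (c b) * cmod (G a b))"
    by (rule sum_norm_le) (auto simp: norm_mult intro!: mult_right_mono max)
  also have "\<dots> = cmod (c b) * (\<Sum>a\<in>E - {b}. cmod (G a b))" by (simp add: sum_distrib_left)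
  finally have "cmod (c b) * (cmod (G b b) - (\<Sum>a\<in>E - {b}. cmod (G a b))) \<le> 0"
    by (simp add: algebra_simps)
  moreover have "cmod (G b b) - (\<Sum>a\<in>E - {b}. cmod (G a b)) > 0"
    using G b by (simp add: dominant_gram_def)
  ultimately have "cmod (c b) \<le> 0" by (simp add: mult_le_0_iff)
  then show ?thesis using max[OF a] by simp
qed

lemma eventually_dominant_gram:
  fixes G :: "'x \<Rightarrow> 'i \<Rightarrow> 'i \<Rightarrow> complex"
  assumes E: "finite E" and lim: "\<And>a b. a \<in> E \<Longrightarrow> b \<in> E \<Longrightarrow> ((\<lambda>x. G x a b) \<longlongrightarrow> K a b) F"
    and diag: "\<And>b. b \<in> E \<Longrightarrow> K b b \<noteq> 0" and off: "\<And>a b. a \<in> E \<Longrightarrow> b \<in> E \<Longrightarrow> a \<noteq> b \<Longrightarrow> K a b = 0"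
  shows "\<forall>\<^sub>F x in F. dominant_gram E (G x)"
  unfolding dominant_gram_def
proof (intro eventually_ball_finite E ballI)
  fix b assume b: "b \<in> E"
  have "((\<lambda>x. cmod (G x b b) - (\<Sum>a\<in>E - {b}. cmod (G x a b))) \<longlongrightarrow> cmod (K b b) - (\<Sum>a\<in>E - {b}. cmod (K a b))) F"
    by (intro tendsto_intros lim b) auto
  moreover have "(\<Sum>a\<in>E - {b}. cmod (K a b)) = 0" using off b by (intro sum.neutral) auto
  ultimately have "((\<lambda>x. cmod (G x b b) - (\<Sum>a\<in>E - {b}. cmod (G x a b))) \<longlongrightarrow> cmod (K b b)) F" by simp
  moreover have "0 < cmod (K b b)" using diag[OF b] by simp
  ultimately have "\<forall>\<^sub>F x in F. 0 < cmod (G x b b) - (\<Sum>a\<in>E - {b}. cmod (G x a b))"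
    by (rule order_tendstoD)
  then show "\<forall>\<^sub>F x in F. (\<Sum>a\<in>E - {b}. cmod (G x a b)) < cmod (G x b b)"
    by eventually_elim simp
qed

text \<open>The first dominance condition serves the pairings of linear terms in u, the second those
  of quadratic terms, where the Levi form enters squared.\<close>

abbreviation levi_frame :: "'i set \<Rightarrow> (complex ^ 'm::finite \<Rightarrow> real) \<Rightarrow> complex ^ 'm \<Rightarrow> ('i \<Rightarrow> complex ^ 'm) \<Rightarrow> bool" where
  "levi_frame E \<rho> x e \<equiv> (\<forall>a\<in>E. e a \<in> levi_space \<rho> x) \<and>
     dominant_gram E (\<lambda>a b. levi_form \<rho> x (e a) (e b)) \<and> dominant_gram E (\<lambda>a b. (levi_form \<rho> x (e a) (e b))\<^sup>2)"

lemma isCont_tendsto_nhds: "isCont f p \<Longrightarrow> (f \<longlongrightarrow> f p) (nhds p)"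
  by (simp add: isCont_def tendsto_at_iff_tendsto_nhds)

text \<open>An orthogonal family at p is pushed into the Levi space at x along \<nu>. The
  displacement tends to 0, so the Gram matrices converge to diagonal ones; E remains the index set,
  and its size is at least the Levi rank at p.\<close>

lemma levi_frame_nearby:
  fixes \<rho> :: "complex ^ 'm::finite \<Rightarrow> real"
  assumes W: "open W" and \<rho>: "real_analytic_on \<rho> W" and p: "p \<in> W"
    and \<nu>: "fderiv \<rho> p \<nu> > 0"
  obtains E :: "(complex ^ 'm) set" where "finite E" "CARD('m) \<le> Suc (card E + vec.dim (levi_eigenspace \<rho> p 0))"
    "\<forall>\<^sub>F x in nhds p. \<exists>e. levi_frame E \<rho> x e"
proof -
  let ?l = "levi_cov \<rho>" and ?L = "levi_sesq \<rho>"
  note L = hermitian_levi_sesq[OF W \<rho>]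
  have l\<nu>: "?l p \<nu> \<noteq> 0" using \<nu> Re_levi_cov[OF W \<rho> p, of \<nu>] by auto
  note dim = hyperplane_dim[of "?l p", OF levi_cov_add[OF W \<rho> p] levi_cov_scale[OF W \<rho> p] l\<nu>]
  note S = levi_space_eq[OF W \<rho>]
  obtain E where E: "finite E" "E \<subseteq> {u. ?l p u = 0}" "\<And>e. e \<in> E \<Longrightarrow> ?L p e e \<noteq> 0"
    "\<And>e e'. e \<in> E \<Longrightarrow> e' \<in> E \<Longrightarrow> e \<noteq> e' \<Longrightarrow> ?L p e e' = 0"
    "vec.dim {u. ?l p u = 0} \<le> card E + vec.dim {u \<in> {u. ?l p u = 0}. \<forall>v\<in>{u. ?l p u = 0}. ?L p u v = 0}"
    by (rule herm_orthogonal_family[OF L[OF p] dim(1)]) (rule that)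
  have R: "levi_eigenspace \<rho> p 0 = {u \<in> {u. ?l p u = 0}. \<forall>v\<in>{u. ?l p u = 0}. ?L p u v = 0}"
    unfolding levi_eigenspace_def S[OF p] levi_form_eq[OF W \<rho> p] by simp
  show ?thesis
  proof (rule that[OF E(1)])
    show "CARD('m) \<le> Suc (card E + vec.dim (levi_eigenspace \<rho> p 0))"
      unfolding R using dim(2) E(5) by linarith
    \<comment> \<open>The multiple of \<nu> to subtract from a so that the Levi covector at x
      annihilates the result.\<close>
    define c where "c x a = ?l x a / ?l x \<nu>" for x a
    define e where "e x a = a + (- c x a) *s \<nu>" for x a
    have lc: "((\<lambda>x. ?l x u) \<longlongrightarrow> ?l p u) (nhds p)" for u
      by (rule isCont_tendsto_nhds[OF continuous_levi_cov[OF W \<rho> p]])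
    have Lc: "((\<lambda>x. ?L x u v) \<longlongrightarrow> ?L p u v) (nhds p)" for u v
      by (rule isCont_tendsto_nhds[OF continuous_levi_sesq[OF W \<rho> p]])
    have cc: "((\<lambda>x. c x a) \<longlongrightarrow> 0) (nhds p)" if "a \<in> E" for a
    proof -
      have "((\<lambda>x. c x a) \<longlongrightarrow> ?l p a / ?l p \<nu>) (nhds p)"
        unfolding c_def by (intro tendsto_intros lc l\<nu>)
      then show ?thesis using E(2) that by auto
    qed
    have evW: "\<forall>\<^sub>F x in nhds p. x \<in> W"
      using eventually_nhds_in_open[OF W p] .
    have ev0: "\<forall>\<^sub>F x in nhds p. ?l x \<nu> \<noteq> 0"
      using tendsto_imp_eventually_ne[OF lc l\<nu>] .
    have expand: "?L x (e x a) (e x b) = ?L x a b - cnj (c x b) * ?L x a \<nu> - c x a * ?L x \<nu> b + c x a * cnj (c x b) * ?L x \<nu> \<nu>"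
      if "x \<in> W" for x a b
      unfolding e_def herm_add_left[OF L[OF that]] herm_add_right[OF L[OF that]]
        herm_scale_left[OF L[OF that]] herm_scale_right[OF L[OF that]]
      by (simp add: algebra_simps)
    have lim: "((\<lambda>x. ?L x (e x a) (e x b)) \<longlongrightarrow> ?L p a b) (nhds p)" if "a \<in> E" "b \<in> E" for a b
    proof (rule Lim_transform_eventually)
      show "((\<lambda>x. ?L x a b - cnj (c x b) * ?L x a \<nu> - c x a * ?L x \<nu> b + c x a * cnj (c x b) * ?L x \<nu> \<nu>) \<longlongrightarrow> ?L p a b) (nhds p)"
        by (rule tendsto_eq_intros Lc cc[OF that(1)] cc[OF that(2)] refl)+ simp
      show "\<forall>\<^sub>F x in nhds p. ?L x a b - cnj (c x b) * ?L x a \<nu> - c x a * ?L x \<nu> b + c x a * cnj (c x b) * ?L x \<nu> \<nu> = ?L x (e x a) (e x b)"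
        using evW by eventually_elim (simp add: expand)
    qed
    have d1: "\<forall>\<^sub>F x in nhds p. dominant_gram E (\<lambda>a b. ?L x (e x a) (e x b))"
      by (rule eventually_dominant_gram[where K = "?L p"]) (use E lim in auto)
    have d2: "\<forall>\<^sub>F x in nhds p. dominant_gram E (\<lambda>a b. (?L x (e x a) (e x b))\<^sup>2)"
      by (rule eventually_dominant_gram[where K = "\<lambda>a b. (?L p a b)\<^sup>2"]) (use E lim in \<open>auto intro: tendsto_power\<close>)
    show "\<forall>\<^sub>F x in nhds p. \<exists>e. levi_frame E \<rho> x e"
      using evW ev0 d1 d2
    proof eventually_elim
      case (elim x)
      have "e x a \<in> levi_space \<rho> x" for a
        unfolding S[OF elim(1)] e_def mem_Collect_eq levi_cov_add[OF W \<rho> elim(1)]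
          levi_cov_scale[OF W \<rho> elim(1)] c_def using elim(2) by simp
      then show ?case
        unfolding levi_form_eq[OF W \<rho> elim(1)] using elim(3,4) by (intro exI[of _ "e x"]) blast
    qed
  qed
qed

section \<open>Weighted Taylor coefficients\<close>

lemma infinite_unit_circle: "infinite {\<mu>::complex. cmod \<mu> = 1}"
proof -
  have "inj_on (\<lambda>x. Complex x (sqrt (1 - x\<^sup>2))) {0..1}" by (rule inj_onI) simp
  moreover have "(\<lambda>x. Complex x (sqrt (1 - x\<^sup>2))) ` {0..1::real} \<subseteq> {\<mu>. cmod \<mu> = 1}"
    by (auto simp: cmod_def abs_square_le_1)
  moreover have "infinite {0..1::real}" by simp
  ultimately show ?thesis using finite_imageD finite_subset by blast
qed

lemma poly_eq_on_circle:
  fixes P Q :: "complex poly"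
  assumes "\<And>\<mu>. cmod \<mu> = 1 \<Longrightarrow> poly P \<mu> = poly Q \<mu>"
  shows "P = Q"
proof (rule ccontr)
  assume "P \<noteq> Q"
  then have "finite {x. poly (P - Q) x = 0}" by (intro poly_roots_finite) simp
  moreover have "{\<mu>. cmod \<mu> = 1} \<subseteq> {x. poly (P - Q) x = 0}" using assms by auto
  ultimately show False using infinite_unit_circle finite_subset by blast
qed

text \<open>Supplies the coefficients of the leading m-th power that pair weights 1 and 2 with their
  complements. The truncated exponents are harmless, since the factors \<open>of_nat n\<close> and
  \<open>n choose 2\<close> vanish whenever truncation occurs.\<close>

lemma coeff_quadratic_power:
  fixes a b c :: complex
  shows "coeff ([:a, b, c:] ^ n) 0 = a ^ n"
    and "coeff ([:a, b, c:] ^ n) 1 = of_nat n * b * a ^ (n - 1)"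
    and "coeff ([:a, b, c:] ^ n) 2 = of_nat n * c * a ^ (n - 1) + of_nat (n choose 2) * b\<^sup>2 * a ^ (n - 2)"
proof -
  have c0: "coeff ([:a, b, c:] * P) 0 = a * coeff P 0" for P by (simp add: coeff_mult)
  have c1: "coeff ([:a, b, c:] * P) 1 = a * coeff P 1 + b * coeff P 0" for P
    by (simp add: coeff_mult atMost_Suc)
  have c2: "coeff ([:a, b, c:] * P) 2 = a * coeff P 2 + b * coeff P 1 + c * coeff P 0" for P
    by (simp add: coeff_mult atMost_Suc numeral_2_eq_2)
  show A: "coeff ([:a, b, c:] ^ n) 0 = a ^ n" for n
    by (induction n) (simp_all only: power_Suc power_0 c0, simp_all)
  show B: "coeff ([:a, b, c:] ^ n) 1 = of_nat n * b * a ^ (n - 1)" for n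
  proof (induction n)
    case (Suc n)
    then show ?case unfolding power_Suc c1 A by (cases n) (simp_all add: algebra_simps)
  qed simp
  show "coeff ([:a, b, c:] ^ n) 2 = of_nat n * c * a ^ (n - 1) + of_nat (n choose 2) * b\<^sup>2 * a ^ (n - 2)"
  proof (induction n)
    case (Suc n)
    have ch: "Suc n choose 2 = n + (n choose 2)" by (simp add: numeral_2_eq_2)
    show ?case
    proof (cases "n \<le> 1")
      case True
      then have "n = 0 \<or> n = 1" by auto
      then show ?thesis unfolding power_Suc c2 A B Suc.IH
        by (auto simp: algebra_simps numeral_2_eq_2)
    next
      case False
      then obtain l where "n = Suc (Suc l)" by (metis not_less_eq_eq One_nat_def not0_implies_Suc le_SucI zero_le)
      then show ?thesis unfolding power_Suc c2 A B Suc.IH ch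
        by (simp add: algebra_simps power2_eq_square)
    qed
  qed simp
qed

text \<open>Once the lower coefficients vanish, f / t^n tends to a n; the same quotient is f / t^N
  times t^(N - n), whose limit is known.\<close>

lemma power_series_leading_term:
  fixes a :: "nat \<Rightarrow> real"
  assumes r: "r > 0" and s: "\<And>t. \<bar>t\<bar> < r \<Longrightarrow> (\<lambda>n. a n * t ^ n) sums f t"
    and lim: "((\<lambda>t. f t / t ^ N) \<longlongrightarrow> c) (at 0)" and n: "n \<le> N"
  shows "a n = (if n = N then c else 0)"
  using n
proof (induction n rule: less_induct)
  case (less n)
  then have z: "a j = 0" if "j < n" for j using that by simp
  have "((\<lambda>t. f t / t ^ n) \<longlongrightarrow> a (0 + n)) (at 0)"
  proof (rule powser_limit_0_strong[OF r, where a = "\<lambda>j. a (j + n)"])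
    fix t :: real assume t: "t \<noteq> 0" "norm t < r"
    then have "(\<lambda>n. a n * t ^ n) sums f t" by (intro s) simp
    then have "(\<lambda>j. a (j + n) * t ^ (j + n)) sums (f t - (\<Sum>j<n. a j * t ^ j))"
      by (rule sums_split_initial_segment)
    then have "(\<lambda>j. a (j + n) * t ^ (j + n) / t ^ n) sums ((f t - (\<Sum>j<n. a j * t ^ j)) / t ^ n)"
      by (rule sums_divide)
    then show "(\<lambda>j. a (j + n) * t ^ j) sums (f t / t ^ n)"
      using t z by (simp add: power_add)
  qed
  moreover have "((\<lambda>t. f t / t ^ n) \<longlongrightarrow> c * 0 ^ (N - n)) (at 0)"
  proof (rule Lim_transform_eventually)
    show "((\<lambda>t. f t / t ^ N * t ^ (N - n)) \<longlongrightarrow> c * 0 ^ (N - n)) (at 0)"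
      by (intro tendsto_intros lim)
    have "f t / t ^ N * t ^ (N - n) = f t / t ^ n" if "t \<noteq> 0" for t
      using that less.prems by (simp add: power_diff)
    then show "\<forall>\<^sub>F t in at 0. f t / t ^ N * t ^ (N - n) = f t / t ^ n"
      by (simp add: eventually_at_filter)
  qed
  ultimately have "a n = c * 0 ^ (N - n)" using tendsto_unique[OF at_neq_bot] by fastforce
  then show ?case using less.prems by (auto simp: power_0_left)
qed

text \<open>Holomorphic in the first and antiholomorphic in the second argument, phrased through
  entire substitutions so that only one-variable theorems are needed.\<close>

definition sesquiholomorphic :: "(complex \<Rightarrow> complex \<Rightarrow> complex) \<Rightarrow> bool" where
  "sesquiholomorphic G \<longleftrightarrow> (\<forall>a b. a holomorphic_on UNIV \<longrightarrow> b holomorphic_on UNIV \<longrightarrow>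
     (\<lambda>x. G (a x) (cnj (b x))) holomorphic_on UNIV)"

lemma entire_zero_on_reals:
  assumes "f holomorphic_on UNIV" "\<And>x. f (complex_of_real x) = 0"
  shows "f z = 0"
proof (rule analytic_continuation[OF assms(1)])
  show "0 islimpt range complex_of_real"
    by (rule islimpt_subset[OF islimpt_of_real_interval[of 1]]) auto
qed (use assms(2) in auto)

text \<open>With s = x + i y and cnj t = x - i y the diagonal is the locus of real x and y. The
  identity theorem frees x, then y, and every pair (s, t) is of this form for complex x and
  y.\<close>

lemma sesquiholomorphic_diagonal_zero:
  assumes G: "sesquiholomorphic G" and diag: "\<And>s. G s s = 0"
  shows "G s t = 0"
proof -
  have 1: "G (x + \<i> * of_real y) (cnj (x - \<i> * of_real y)) = 0" for x y
  proof (rule entire_zero_on_reals[of "\<lambda>x. G (x + \<i> * of_real y) (cnj (x - \<i> * of_real y))" x])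
    have "(\<lambda>x. x + \<i> * of_real y) holomorphic_on UNIV" "(\<lambda>x. x - \<i> * of_real y) holomorphic_on UNIV"
      by (auto intro!: holomorphic_intros)
    then show "(\<lambda>x. G (x + \<i> * of_real y) (cnj (x - \<i> * of_real y))) holomorphic_on UNIV"
      using G unfolding sesquiholomorphic_def by blast
    show "G (of_real x + \<i> * of_real y) (cnj (of_real x - \<i> * of_real y)) = 0" for x
      using diag by simp
  qed
  have 2: "G (x + \<i> * y) (cnj (x - \<i> * y)) = 0" for x y
  proof (rule entire_zero_on_reals[of "\<lambda>y. G (x + \<i> * y) (cnj (x - \<i> * y))" y])
    have "(\<lambda>y. x + \<i> * y) holomorphic_on UNIV" "(\<lambda>y. x - \<i> * y) holomorphic_on UNIV"
      by (auto intro!: holomorphic_intros)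
    then show "(\<lambda>y. G (x + \<i> * y) (cnj (x - \<i> * y))) holomorphic_on UNIV"
      using G unfolding sesquiholomorphic_def by blast
  qed (rule 1)
  have "(s + cnj t) / 2 + \<i> * ((s - cnj t) / (2 * \<i>)) = s" "(s + cnj t) / 2 - \<i> * ((s - cnj t) / (2 * \<i>)) = cnj t"
    by (simp_all add: field_simps)
  then show ?thesis using 2[of "(s + cnj t) / 2" "(s - cnj t) / (2 * \<i>)"] by simp
qed

text \<open>A linear relation among the vectors persists after pairing, so \<open>ind\<close> rules
  it out, even modulo \<open>axis k 1\<close>, which the form does not see. Adjoining that vector
  keeps the family independent and makes the inequality strict.\<close>

lemma gram_card_bound:
  fixes v :: "'i \<Rightarrow> complex ^ 'k::finite"
  assumes I: "finite I"
    and ind: "\<And>c i. (\<And>y. (\<Sum>i\<in>I. c i * sesq_form k A (v i) y) = 0) \<Longrightarrow> i \<in> I \<Longrightarrow> c i = 0"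
  shows "card I < CARD('k)"
proof -
  have delta: "(\<Sum>i\<in>I. (if i = j then a else 0) * f i) = a * f j" if "j \<in> I" for j a and f :: "'i \<Rightarrow> complex"
    using I that by (simp add: if_distrib[of "\<lambda>x. x * _"] cong: if_cong)
  have inj: "inj_on v I"
  proof (rule inj_onI, rule ccontr)
    fix i j assume h: "i \<in> I" "j \<in> I" "v i = v j" "i \<noteq> j"
    let ?c = "\<lambda>x. (if x = i then 1 else 0) + (if x = j then - 1 else 0) :: complex"
    have "(\<Sum>x\<in>I. ?c x * sesq_form k A (v x) y) = 0" for y
      unfolding distrib_right sum.distrib delta[OF h(1)] delta[OF h(2)] using h by simp
    from ind[of ?c, OF this h(1)] show False using h by simp
  qed
  have ax0: "sesq_form k A (axis k 1) y = 0" for y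
    unfolding sesq_form_def axis_def by (auto intro!: sum.neutral)
  have notin: "axis k 1 \<notin> v ` I"
  proof
    assume "axis k 1 \<in> v ` I"
    then obtain j where j: "j \<in> I" "v j = axis k 1" by auto
    have "(\<Sum>i\<in>I. (if i = j then 1 else 0) * sesq_form k A (v i) y) = 0" for y
      unfolding delta[OF j(1)] j(2) ax0 by simp
    from ind[of "\<lambda>i. if i = j then 1 else 0", OF this j(1)] show False by simp
  qed
  have "vec.independent (insert (axis k 1) (v ` I))"
  proof (rule vec.independent_if_scalars_zero)
    fix f x assume s: "(\<Sum>x\<in>insert (axis k 1) (v ` I). f x *s x) = 0" and x: "x \<in> insert (axis k 1) (v ` I)"
    have s': "f (axis k 1) *s axis k 1 + (\<Sum>i\<in>I. f (v i) *s v i) = 0"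
      using s I notin by (simp add: sum.reindex[OF inj])
    have "(\<Sum>i\<in>I. f (v i) * sesq_form k A (v i) y) = 0" for y
    proof -
      have "sesq_form k A (f (axis k 1) *s axis k 1 + (\<Sum>i\<in>I. f (v i) *s v i)) y = 0"
        unfolding s' by (simp add: sesq_form_def)
      then show ?thesis
        unfolding sesq_form_add_left sesq_form_sum_left sesq_form_scale_left ax0 by simp
    qed
    from ind[of "\<lambda>i. f (v i)", OF this] have fv: "f (v i) = 0" if "i \<in> I" for i using that by blast
    then have "f (axis k 1) *s (axis k 1 :: complex ^ 'k) = 0" using s' by simp
    then have "f (axis k 1) = 0" by (auto simp: vec_eq_iff axis_def dest: spec[of _ k])
    then show "f x = 0" using x fv by auto
  qed (use I in simp)
  then have "card (insert (axis k 1) (v ` I)) \<le> vec.dim (UNIV :: (complex ^ 'k) set)"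
    by (intro vec.independent_card_le_dim) auto
  moreover have "card (insert (axis k 1) (v ` I)) = Suc (card I)"
    using I notin by (simp add: card_image[OF inj])
  ultimately show ?thesis by (simp only: vec_dim_card Suc_le_eq)
qed

text \<open>The curves \<open>\<sigma> \<mapsto> p + \<sigma> u + \<sigma>\<^sup>2 (\<alpha> w + Q u) \<nu>\<close> give \<open>u\<close> weight 1 and \<open>w\<close> weight 2; the
  quadratic correction \<open>Q\<close> removes the pluriharmonic second-order part of the defining function.\<close>

locale weighted_jets =
  fixes H :: "complex ^ 'm::finite \<Rightarrow> complex ^ 'k::finite" and U p k A S Q L \<nu> \<alpha> and C :: real and m :: nat
  assumes H: "holomorphic_map_on H U" and U: "open U" and p: "p \<in> U" and A: "hermitian_matrix k A"
    and S: "vec.subspace S" and L: "hermitian_form L"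
    and Q_scale: "\<And>c u. Q (c *s u) = c\<^sup>2 * Q u"
    and Q_hol: "\<And>u v. (\<lambda>s. Q (u + s *s v)) holomorphic_on UNIV"
    and C: "C \<noteq> 0" and m: "m \<ge> 2"
    and asym: "\<And>u w. u \<in> S \<Longrightarrow>
      ((\<lambda>t. quadric_fn k A (H (p + t *\<^sub>R u + t\<^sup>2 *\<^sub>R ((\<alpha> * w + Q u) *s \<nu>))) / t ^ (2 * m)) \<longlongrightarrow>
        C * (Re w + Re (L u u)) ^ m) (at 0)"
begin

definition curve :: "complex ^ 'm \<Rightarrow> complex \<Rightarrow> complex \<Rightarrow> complex ^ 'm" where
  "curve u w \<sigma> = p + \<sigma> *s u + (\<sigma>\<^sup>2 * (\<alpha> * w + Q u)) *s \<nu>"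

text \<open>The part of H of weight n at p, evaluated at (u, w).\<close>

definition jet :: "nat \<Rightarrow> complex ^ 'm \<Rightarrow> complex \<Rightarrow> complex ^ 'k" where
  "jet n u w = (\<chi> i. (deriv ^^ n) (\<lambda>\<sigma>. H (curve u w \<sigma>) $ i) 0 / fact n)"

lemma curve_of_real: "curve u w (of_real t) = p + t *\<^sub>R u + t\<^sup>2 *\<^sub>R ((\<alpha> * w + Q u) *s \<nu>)"
  unfolding curve_def of_real_smult[symmetric] by (simp only: vector_smult_assoc of_real_power)

lemma holomorphic_curve: "(\<lambda>\<sigma>. curve u w \<sigma> $ i) holomorphic_on T"
  unfolding curve_def by (auto intro!: holomorphic_intros)

text \<open>Holomorphy of Taylor coefficients in a parameter requires one radius and one bound for
  H; compactness of the parameter set provides both.\<close>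

lemma curve_family_domain:
  assumes "compact X" "continuous_on X u" "continuous_on X w" "continuous_on X (\<lambda>s. Q (u s))"
  obtains r M where "r > 0" "\<And>s \<sigma>. s \<in> X \<Longrightarrow> cmod \<sigma> < r \<Longrightarrow> curve (u s) (w s) \<sigma> \<in> U"
    "\<And>s \<sigma> i. s \<in> X \<Longrightarrow> cmod \<sigma> < r \<Longrightarrow> cmod (H (curve (u s) (w s) \<sigma>) $ i) \<le> M"
proof -
  obtain \<delta> where \<delta>: "\<delta> > 0" "cball p \<delta> \<subseteq> U" using U p open_contains_cball by blast
  have "bounded (H ` cball p \<delta>)"
    using holomorphic_map_continuous_on[OF H] \<delta>(2)
    by (intro compact_imp_bounded compact_continuous_image compact_cball) (rule continuous_on_subset)
  then obtain M where M: "\<And>z. z \<in> cball p \<delta> \<Longrightarrow> norm (H z) \<le> M" unfolding bounded_iff by blast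
  have "continuous_on X (\<lambda>s. norm (u s) + cmod (\<alpha> * w s + Q (u s)) * norm \<nu>)"
    by (intro continuous_intros assms)
  then have "bounded ((\<lambda>s. norm (u s) + cmod (\<alpha> * w s + Q (u s)) * norm \<nu>) ` X)"
    by (intro compact_imp_bounded compact_continuous_image assms(1))
  then obtain K where K: "\<And>s. s \<in> X \<Longrightarrow> norm (norm (u s) + cmod (\<alpha> * w s + Q (u s)) * norm \<nu>) \<le> K"
    unfolding bounded_iff by blast
  \<comment> \<open>Radius at most 1 lets |\<sigma>|^2 be replaced by |\<sigma>|, so the
    displacement is linear in |\<sigma>| with factor at most K.\<close>
  define r where "r = min 1 (\<delta> / (\<bar>K\<bar> + 1))"
  have r: "r > 0" "r \<le> 1" using \<delta> by (auto simp: r_def)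
  have in_ball: "curve (u s) (w s) \<sigma> \<in> cball p \<delta>" if s: "s \<in> X" and \<sigma>: "cmod \<sigma> < r" for s \<sigma>
  proof -
    have "norm (\<sigma> *s u s + (\<sigma>\<^sup>2 * (\<alpha> * w s + Q (u s))) *s \<nu>) \<le>
        cmod \<sigma> * norm (u s) + (cmod \<sigma>)\<^sup>2 * (cmod (\<alpha> * w s + Q (u s)) * norm \<nu>)"
      by (rule order_trans[OF norm_triangle_ineq]) (simp add: norm_vector_smult norm_mult norm_power)
    also have "\<dots> \<le> cmod \<sigma> * norm (u s) + cmod \<sigma> * (cmod (\<alpha> * w s + Q (u s)) * norm \<nu>)"
    proof -
      have "(cmod \<sigma>)\<^sup>2 \<le> cmod \<sigma>" using \<sigma> r by (simp add: power2_eq_square mult_left_le)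
      then show ?thesis by (intro add_left_mono mult_right_mono) auto
    qed
    also have "\<dots> = cmod \<sigma> * (norm (u s) + cmod (\<alpha> * w s + Q (u s)) * norm \<nu>)" by (simp add: algebra_simps)
    also have "\<dots> \<le> r * (\<bar>K\<bar> + 1)"
      using K[OF s] \<sigma> r by (intro mult_mono) auto
    also have "\<dots> \<le> \<delta>"
    proof -
      have "r \<le> \<delta> / (\<bar>K\<bar> + 1)" by (simp add: r_def)
      then show ?thesis by (simp add: field_simps)
    qed
    finally show ?thesis
      unfolding curve_def mem_cball dist_norm add.assoc
      by (subst norm_minus_commute) (simp only: add_diff_cancel_left')
  qed
  show ?thesis
  proof (rule that[OF r(1)])
    fix s \<sigma> assume h: "s \<in> X" "cmod \<sigma> < r"
    show "curve (u s) (w s) \<sigma> \<in> U" using in_ball[OF h] \<delta>(2) by blast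
    show "cmod (H (curve (u s) (w s) \<sigma>) $ i) \<le> M" for i
      using M[OF in_ball[OF h]] Finite_Cartesian_Product.norm_nth_le[of "H (curve (u s) (w s) \<sigma>)" i] by linarith
  qed
qed

lemma curve_domain:
  obtains r where "r > 0" "\<And>\<sigma>. cmod \<sigma> < r \<Longrightarrow> curve u w \<sigma> \<in> U"
  using curve_family_domain[of "{0::complex}" "\<lambda>_. u" "\<lambda>_. w"] by (metis compact_sing continuous_on_const singletonI)

lemma holomorphic_along_curve:
  assumes "\<And>\<sigma>. cmod \<sigma> < r \<Longrightarrow> curve u w \<sigma> \<in> U"
  shows "(\<lambda>\<sigma>. H (curve u w \<sigma>) $ i) holomorphic_on ball 0 r"
  by (rule holomorphic_map_curve[OF H open_ball _ holomorphic_curve]) (use assms in simp)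

text \<open>On each disc of parameters s the coefficient lemma applies; discs exhaust the plane.
  Entire dependence along complex lines is what polarisation of the pairings needs.\<close>

lemma jet_holomorphic:
  "(\<lambda>s. jet n (u + s *s v) (w + s * w') $ i) holomorphic_on UNIV"
proof -
  have cQ: "continuous_on T (\<lambda>s. Q (u + s *s v))" for T
    using holomorphic_on_imp_continuous_on[OF Q_hol] continuous_on_subset by blast
  have "(\<lambda>s. jet n (u + s *s v) (w + s * w') $ i) holomorphic_on ball 0 R" for R
  proof -
    obtain r M where r: "r > 0" "\<And>s \<sigma>. s \<in> cball 0 R \<Longrightarrow> cmod \<sigma> < r \<Longrightarrow> curve (u + s *s v) (w + s * w') \<sigma> \<in> U"
      "\<And>s \<sigma> i. s \<in> cball 0 R \<Longrightarrow> cmod \<sigma> < r \<Longrightarrow> cmod (H (curve (u + s *s v) (w + s * w') \<sigma>) $ i) \<le> M"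
      by (rule curve_family_domain[of "cball (0::complex) R" "\<lambda>s. u + s *s v" "\<lambda>s. w + s * w'"])
         (auto intro!: continuous_intros continuous_on_smult cQ)
    have "(\<lambda>s. (deriv ^^ n) (\<lambda>\<sigma>. H (curve (u + s *s v) (w + s * w') \<sigma>) $ i) 0 / fact n) holomorphic_on ball 0 R"
    proof (rule coeff_holomorphic_in_parameter[where M = M, OF open_ball r(1)])
      fix z :: complex assume z: "cmod z < r"
      have "(\<lambda>s. curve (u + s *s v) (w + s * w') z $ j) holomorphic_on ball 0 R" for j
        unfolding curve_def
        by (auto intro!: holomorphic_intros holomorphic_on_subset[OF Q_hol])
      then show "(\<lambda>s. H (curve (u + s *s v) (w + s * w') z) $ i) holomorphic_on ball 0 R"
        by (intro holomorphic_map_curve[OF H open_ball]) (use r(2) z in auto)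
    next
      fix s assume "s \<in> ball (0::complex) R"
      then show "(\<lambda>\<sigma>. H (curve (u + s *s v) (w + s * w') \<sigma>) $ i) holomorphic_on ball 0 r"
        by (intro holomorphic_along_curve r(2)) auto
    qed (use r(3) in auto)
    then show ?thesis by (simp add: jet_def)
  qed
  then have "(\<lambda>s. jet n (u + s *s v) (w + s * w') $ i) holomorphic_on (\<Union>R. ball 0 R)"
    by (subst holomorphic_on_UN_open) auto
  moreover have "(\<Union>R. ball (0::complex) R) = UNIV"
    by (auto intro: gt_ex)
  ultimately show ?thesis by simp
qed

text \<open>Because Q is homogeneous of degree 2, scaling (u, w) with weights 1 and 2 only
  reparametrises the curve by c \<sigma>.\<close>

lemma jet_homogeneous: "jet n (c *s u) (c\<^sup>2 * w) = c ^ n *s jet n u w"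
proof -
  have e: "curve (c *s u) (c\<^sup>2 * w) \<sigma> = curve u w (c * \<sigma>)" for \<sigma>
    unfolding curve_def Q_scale
    by (simp add: vector_smult_assoc algebra_simps power_mult_distrib mult.commute)
  obtain r where r: "r > 0" "\<And>\<sigma>. cmod \<sigma> < r \<Longrightarrow> curve u w \<sigma> \<in> U" by (rule curve_domain[of u w]) (rule that)
  have "(deriv ^^ n) (\<lambda>\<sigma>. H (curve u w (c * \<sigma>)) $ i) 0 = c ^ n * (deriv ^^ n) (\<lambda>\<sigma>. H (curve u w \<sigma>) $ i) (c * 0)" for i
  proof (rule higher_deriv_compose_linear[OF holomorphic_along_curve[OF r(2)], where S = "ball 0 (r / (cmod c + 1))"])
    show "c * z \<in> ball 0 r" if "z \<in> ball 0 (r / (cmod c + 1))" for z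
    proof -
      have "cmod z * (cmod c + 1) < r" using that by (simp add: field_simps pos_less_divide_eq add_pos_nonneg)
      then have "cmod c * cmod z + cmod z < r" by (simp add: algebra_simps)
      then have "cmod c * cmod z < r" using norm_ge_zero[of z] by linarith
      then show ?thesis by (simp add: norm_mult)
    qed
    show "0 \<in> ball 0 (r / (cmod c + 1))"
      using divide_pos_pos[OF r(1) add_nonneg_pos[OF norm_ge_zero[of c] zero_less_one]] by simp
  qed (use r in auto)
  then show ?thesis unfolding jet_def e by (simp add: vec_eq_iff)
qed

text \<open>The coefficient of t^n in the pulled-back defining function along the curve at real t,
  with the sesquilinear part as a Cauchy product.\<close>

definition coeff_pullback :: "nat \<Rightarrow> complex ^ 'm \<Rightarrow> complex \<Rightarrow> complex" where
  "coeff_pullback n u w = (jet n u w $ k - cnj (jet n u w $ k)) / (2 * \<i>) -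
     (\<Sum>l\<le>n. sesq_form k A (jet l u w) (jet (n - l) u w))"

lemma pullback_series:
  assumes r: "\<And>\<sigma>. cmod \<sigma> < r \<Longrightarrow> curve u w \<sigma> \<in> U" and t: "\<bar>t\<bar> < r"
  shows "(\<lambda>n. coeff_pullback n u w * of_real t ^ n) sums of_real (quadric_fn k A (H (curve u w (of_real t))))"
proof -
  let ?h = "H (curve u w (of_real t))" and ?T = "complex_of_real t"
  let ?a = "\<lambda>i n. jet n u w $ i * ?T ^ n" and ?b = "\<lambda>i n. cnj (jet n u w $ i) * ?T ^ n"
  have s: "(\<lambda>n. jet n u w $ i * z ^ n) sums (H (curve u w z) $ i)" if "cmod z < r" for i z
    using holomorphic_power_series[OF holomorphic_along_curve[OF r, where i = i], where w = z] that by (simp add: jet_def)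
  have sa: "?a i sums (?h $ i)" for i by (rule s) (use t in simp)
  have sb: "?b i sums cnj (?h $ i)" for i
    using sa[of i] by (subst (asm) sums_cnj[symmetric]) simp
  have na: "summable (\<lambda>n. norm (?a i n))" for i
  proof (rule powser_insidea)
    show "summable (\<lambda>n. jet n u w $ i * complex_of_real ((\<bar>t\<bar> + r) / 2) ^ n)"
      by (rule sums_summable[OF s]) (use t in \<open>simp del: of_real_add of_real_divide\<close>)
    show "norm ?T < norm (complex_of_real ((\<bar>t\<bar> + r) / 2))" using t by (simp del: of_real_add of_real_divide)
  qed
  then have nb: "summable (\<lambda>n. norm (?b i n))" for i by (simp add: norm_mult)
  have prod: "(\<lambda>n. \<Sum>l\<le>n. ?a i l * ?b j (n - l)) sums (?h $ i * cnj (?h $ j))" for i j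
    using Cauchy_product_sums[OF na[of i] nb[of j]] sums_unique[OF sa[of i]] sums_unique[OF sb[of j]] by simp
  have "(\<lambda>n. (?a k n - ?b k n) / (2 * \<i>) -
      (\<Sum>i\<in>UNIV - {k}. \<Sum>j\<in>UNIV - {k}. A i j * (\<Sum>l\<le>n. ?a i l * ?b j (n - l)))) sums
     ((?h $ k - cnj (?h $ k)) / (2 * \<i>) - (\<Sum>i\<in>UNIV - {k}. \<Sum>j\<in>UNIV - {k}. A i j * (?h $ i * cnj (?h $ j))))"
    by (intro sums_diff sums_divide sums_sum sums_mult sa sb prod)
  moreover have "(?h $ k - cnj (?h $ k)) / (2 * \<i>) - (\<Sum>i\<in>UNIV - {k}. \<Sum>j\<in>UNIV - {k}. A i j * (?h $ i * cnj (?h $ j)))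
     = of_real (quadric_fn k A ?h)"
    unfolding quadric_polar_diag[OF A, symmetric] quadric_polar_def sesq_form_def by (simp add: mult.assoc)
  moreover have "(?a k n - ?b k n) / (2 * \<i>) -
      (\<Sum>i\<in>UNIV - {k}. \<Sum>j\<in>UNIV - {k}. A i j * (\<Sum>l\<le>n. ?a i l * ?b j (n - l))) = coeff_pullback n u w * ?T ^ n" for n
  proof -
    have "(\<Sum>i\<in>UNIV - {k}. \<Sum>j\<in>UNIV - {k}. A i j * (\<Sum>l\<le>n. ?a i l * ?b j (n - l)))
      = (\<Sum>i\<in>UNIV - {k}. \<Sum>j\<in>UNIV - {k}. \<Sum>l\<le>n. ?T ^ n * (A i j * jet l u w $ i * cnj (jet (n - l) u w $ j)))"
      unfolding sum_distrib_left
    proof (intro sum.cong refl)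
      fix i j l assume "l \<in> {..n}"
      then have "?T ^ n = ?T ^ l * ?T ^ (n - l)" by (simp flip: power_add)
      then show "A i j * (?a i l * ?b j (n - l)) = ?T ^ n * (A i j * jet l u w $ i * cnj (jet (n - l) u w $ j))"
        by (simp add: mult_ac)
    qed
    also have "\<dots> = (\<Sum>l\<le>n. \<Sum>i\<in>UNIV - {k}. \<Sum>j\<in>UNIV - {k}. ?T ^ n * (A i j * jet l u w $ i * cnj (jet (n - l) u w $ j)))"
      by (rule trans[OF sum.cong[OF refl sum.swap] sum.swap])
    also have "\<dots> = ?T ^ n * (\<Sum>l\<le>n. sesq_form k A (jet l u w) (jet (n - l) u w))"
      unfolding sesq_form_def sum_distrib_left ..
    finally show ?thesis unfolding coeff_pullback_def by (simp add: algebra_simps diff_divide_distrib)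
  qed
  ultimately show ?thesis by simp
qed

text \<open>The assumed asymptotics determine every coefficient up to order 2m. Real and imaginary
  parts are treated as two real series, the second with sum 0.\<close>

lemma coeff_pullback_eq:
  assumes u: "u \<in> S" and n: "n \<le> 2 * m"
  shows "coeff_pullback n u w = (if n = 2 * m then of_real (C * (Re w + Re (L u u)) ^ m) else 0)"
proof -
  obtain r where r: "r > 0" "\<And>\<sigma>. cmod \<sigma> < r \<Longrightarrow> curve u w \<sigma> \<in> U" by (rule curve_domain[of u w]) (rule that)
  let ?f = "\<lambda>t. quadric_fn k A (H (curve u w (of_real t)))"
  have s: "(\<lambda>n. coeff_pullback n u w * of_real t ^ n) sums of_real (?f t)" if "\<bar>t\<bar> < r" for t
    by (rule pullback_series[OF r(2) that])
  have Re_s: "(\<lambda>n. Re (coeff_pullback n u w) * t ^ n) sums ?f t" if "\<bar>t\<bar> < r" for t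
    using sums_Re[OF s[OF that]] by (simp flip: of_real_power)
  have Im_s: "(\<lambda>n. Im (coeff_pullback n u w) * t ^ n) sums 0" if "\<bar>t\<bar> < r" for t
    using sums_Im[OF s[OF that]] by (simp flip: of_real_power)
  have "Re (coeff_pullback n u w) = (if n = 2 * m then C * (Re w + Re (L u u)) ^ m else 0)"
    by (rule power_series_leading_term[OF r(1) Re_s _ n]) (use asym[OF u] in \<open>simp_all add: curve_of_real\<close>)
  moreover have "Im (coeff_pullback n u w) = (if n = 2 * m then 0 else 0)"
    by (rule power_series_leading_term[OF r(1) Im_s _ n]) simp_all
  ultimately show ?thesis by (simp add: complex_eq_iff)
qed

text \<open>Replacing \<open>(u, w)\<close> by \<open>(\<lambda> u, \<lambda>\<^sup>2 w)\<close> with \<open>|\<lambda>| = 1\<close> turns the identity above into an identity of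
  trigonometric polynomials, here written as polynomials in \<open>\<mu> = \<lambda>\<^sup>2\<close>.\<close>

lemma jet_products:
  assumes u: "u \<in> S" and l: "1 \<le> l" "l < n" and n: "n \<le> 2 * m"
  shows "sesq_form k A (jet l u w) (jet (n - l) u w) =
    (if n = 2 * m then - of_real C * coeff ([:cnj w / 2, L u u, w / 2:] ^ m) l else 0)"
proof -
  \<comment> \<open>The coefficient of \<mu>^j after rotation. The k-th component of H enters only
    for j = 0 and j = n, so for 0 < l < n only the pairing is left.\<close>
  define d where "d j = - sesq_form k A (jet j u w) (jet (n - j) u w) +
      (if j = n then jet n u w $ k / (2 * \<i>) else 0) - (if j = 0 then cnj (jet n u w $ k) / (2 * \<i>) else 0)" for j
  define P where "P = (\<Sum>j\<le>n. monom (d j) j)"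
  \<comment> \<open>On the unit circle \<mu> (Re (\<mu> w) + L(u,u)) is the quadratic polynomial in
    \<mu> with coefficients cnj w / 2, L(u,u), w / 2.\<close>
  define R where "R = (if n = 2 * m then smult (of_real C) ([:cnj w / 2, L u u, w / 2:] ^ m) else 0)"
  have "P = R"
  proof (rule poly_eq_on_circle)
    fix \<mu> :: complex assume \<mu>: "cmod \<mu> = 1"
    \<comment> \<open>Scaling u by c multiplies w by c^2 = \<mu>. The extra factor c^n turns c^j
      times cnj c^(n - j) into \<mu>^j, as |c| = 1.\<close>
    define c where "c = csqrt \<mu>"
    have c2: "c\<^sup>2 = \<mu>" by (simp add: c_def)
    have cc: "c * cnj c = 1" using \<mu> by (simp add: c_def complex_norm_square[symmetric])
    have ccn: "c ^ j * cnj c ^ j = 1" for j using cc by (simp flip: power_mult_distrib)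
    have \<mu>\<mu>: "\<mu> * cnj \<mu> = 1" using \<mu> by (simp add: complex_norm_square[symmetric])
    have \<mu>j: "c ^ j * c ^ j = \<mu> ^ j" for j by (simp add: c2[symmetric] power2_eq_square power_mult_distrib)
    have cu: "c *s u \<in> S" using S u by (rule vec.subspace_scale)
    have "c ^ n * coeff_pullback n (c *s u) (c\<^sup>2 * w) = poly P \<mu>"
    proof -
      have "c ^ n * sesq_form k A (c ^ j *s jet j u w) (c ^ (n - j) *s jet (n - j) u w) =
          \<mu> ^ j * sesq_form k A (jet j u w) (jet (n - j) u w)" if "j \<le> n" for j
      proof -
        have "c ^ n = c ^ j * c ^ (n - j)" using that by (simp flip: power_add)
        then have "c ^ n * (c ^ j * cnj (c ^ (n - j))) = (c ^ j * c ^ j) * (c ^ (n - j) * cnj c ^ (n - j))"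
          by (simp add: mult_ac)
        then have "c ^ n * (c ^ j * cnj (c ^ (n - j))) = \<mu> ^ j" by (simp add: ccn \<mu>j)
        from arg_cong[OF this, of "\<lambda>z. z * sesq_form k A (jet j u w) (jet (n - j) u w)"] show ?thesis
          unfolding sesq_form_scale_left sesq_form_scale_right by (simp only: mult_ac)
      qed
      then have 1: "c ^ n * (\<Sum>j\<le>n. sesq_form k A (c ^ j *s jet j u w) (c ^ (n - j) *s jet (n - j) u w)) =
          (\<Sum>j\<le>n. \<mu> ^ j * sesq_form k A (jet j u w) (jet (n - j) u w))"
        unfolding sum_distrib_left by (intro sum.cong) auto
      have 2: "c ^ n * (((c ^ n *s jet n u w) $ k - cnj ((c ^ n *s jet n u w) $ k)) / (2 * \<i>)) =
          \<mu> ^ n * (jet n u w $ k / (2 * \<i>)) - cnj (jet n u w $ k) / (2 * \<i>)"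
      proof -
        have "c ^ n * ((c ^ n *s jet n u w) $ k - cnj ((c ^ n *s jet n u w) $ k)) =
            (c ^ n * c ^ n) * jet n u w $ k - (c ^ n * cnj c ^ n) * cnj (jet n u w $ k)"
          by (simp add: algebra_simps)
        then have "c ^ n * ((c ^ n *s jet n u w) $ k - cnj ((c ^ n *s jet n u w) $ k)) =
            \<mu> ^ n * jet n u w $ k - cnj (jet n u w $ k)"
          unfolding ccn \<mu>j by simp
        then show ?thesis unfolding times_divide_eq_right diff_divide_distrib[symmetric] by (rule arg_cong)
      qed
      have "poly P \<mu> = (\<Sum>j\<le>n. d j * \<mu> ^ j)" by (simp add: P_def poly_sum poly_monom)
      also have "\<dots> = - (\<Sum>j\<le>n. \<mu> ^ j * sesq_form k A (jet j u w) (jet (n - j) u w)) +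
          \<mu> ^ n * (jet n u w $ k / (2 * \<i>)) - cnj (jet n u w $ k) / (2 * \<i>)"
      proof -
        have "(\<Sum>j\<le>n. (if j = q then x else 0) * \<mu> ^ j) = x * \<mu> ^ q" if "q \<le> n" for q x
          using that by (simp add: if_distrib[of "\<lambda>x. x * _"] cong: if_cong)
        from this[of n] this[of 0] show ?thesis
          unfolding d_def left_diff_distrib distrib_right sum.distrib sum_subtractf
          by (simp add: sum_negf mult.commute)
      qed
      finally show ?thesis
        unfolding coeff_pullback_def jet_homogeneous right_diff_distrib 1 2 by simp
    qed
    moreover have "c ^ n * coeff_pullback n (c *s u) (c\<^sup>2 * w) = poly R \<mu>"
    proof (cases "n = 2 * m")
      case True
      have "L (c *s u) (c *s u) = (c * cnj c) * L u u"
        unfolding herm_scale_left[OF L] herm_scale_right[OF L] by simp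
      then have "complex_of_real (Re (L (c *s u) (c *s u))) = L u u"
        unfolding cc using herm_self_real[OF L, of u] by simp
      moreover have "complex_of_real (Re (c\<^sup>2 * w)) = (\<mu> * w + cnj \<mu> * cnj w) / 2"
        unfolding c2 by (simp add: complex_eq_iff)
      ultimately have "complex_of_real (Re (c\<^sup>2 * w) + Re (L (c *s u) (c *s u))) = (\<mu> * w + cnj \<mu> * cnj w) / 2 + L u u"
        by simp
      then have e: "coeff_pullback n (c *s u) (c\<^sup>2 * w) = of_real C * ((\<mu> * w + cnj \<mu> * cnj w) / 2 + L u u) ^ m"
        unfolding coeff_pullback_eq[OF cu n] using True by (simp only: simp_thms if_True of_real_mult of_real_power)
      have "c ^ n = \<mu> ^ m" unfolding True power_mult c2 ..
      then have "c ^ n * coeff_pullback n (c *s u) (c\<^sup>2 * w) =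
          of_real C * (\<mu> * ((\<mu> * w + cnj \<mu> * cnj w) / 2 + L u u)) ^ m"
        unfolding e power_mult_distrib by simp
      also have "\<mu> * ((\<mu> * w + cnj \<mu> * cnj w) / 2 + L u u) = poly [:cnj w / 2, L u u, w / 2:] \<mu>"
      proof -
        have "\<mu> * ((\<mu> * w + cnj \<mu> * cnj w) / 2 + L u u) = (\<mu> * \<mu> * w + (\<mu> * cnj \<mu>) * cnj w) / 2 + \<mu> * L u u"
          by (simp add: algebra_simps add_divide_distrib)
        then show ?thesis unfolding \<mu>\<mu> by (simp add: algebra_simps add_divide_distrib)
      qed
      finally show ?thesis using True by (simp add: R_def poly_power)
    next
      case False
      then show ?thesis by (simp add: R_def coeff_pullback_eq[OF cu n])
    qed
    ultimately show "poly P \<mu> = poly R \<mu>" by simp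
  qed
  then have "coeff P l = coeff R l" by simp
  moreover have "coeff P l = - sesq_form k A (jet l u w) (jet (n - l) u w)"
    unfolding P_def coeff_sum coeff_monom using l by (simp add: d_def)
  ultimately have "sesq_form k A (jet l u w) (jet (n - l) u w) = - coeff R l" by (metis minus_minus)
  then show ?thesis by (simp add: R_def)
qed

text \<open>The points (u, w) and (u', w') are joined by a complex line. The difference of the two
  sides is sesquiholomorphic in the two parameters and vanishes on the diagonal, hence also at (0,
  1). \<Psi> takes w and cnj w as separate arguments so that they can be varied
  independently.\<close>

lemma jet_polarize:
  assumes diag: "\<And>u w. u \<in> S \<Longrightarrow> sesq_form k A (jet a u w) (jet b u w) = \<Psi> (L u u) w (cnj w)"
    and \<Psi>: "\<And>f g h. f holomorphic_on UNIV \<Longrightarrow> g holomorphic_on UNIV \<Longrightarrow> h holomorphic_on UNIV \<Longrightarrow>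
      (\<lambda>x. \<Psi> (f x) (g x) (h x)) holomorphic_on UNIV"
    and u: "u \<in> S" "u' \<in> S"
  shows "sesq_form k A (jet a u w) (jet b u' w') = \<Psi> (L u u') w (cnj w')"
proof -
  define X where "X s = u + s *s (u' - u)" for s
  define Y where "Y s = w + s * (w' - w)" for s
  have XS: "X s \<in> S" for s
    unfolding X_def using S u by (intro vec.subspace_add vec.subspace_scale vec.subspace_diff)
  define G where "G s t = sesq_form k A (jet a (X s) (Y s)) (jet b (X t) (Y t)) - \<Psi> (L (X s) (X t)) (Y s) (cnj (Y t))" for s t
  have "sesquiholomorphic G"
    unfolding sesquiholomorphic_def
  proof (intro allI impI)
    fix f g :: "complex \<Rightarrow> complex" assume f: "f holomorphic_on UNIV" and g: "g holomorphic_on UNIV"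
    have 1: "(\<lambda>x. jet a (X (f x)) (Y (f x)) $ i) holomorphic_on UNIV" for i
      using holomorphic_on_compose[OF f holomorphic_on_subset[OF jet_holomorphic]] unfolding X_def Y_def o_def by blast
    have j: "(\<lambda>s. jet b (X s) (Y s) $ i) holomorphic_on cnj ` UNIV" for i
      using holomorphic_on_subset[OF jet_holomorphic] unfolding X_def Y_def by blast
    have 2: "(\<lambda>x. cnj (jet b (X (cnj (g x))) (Y (cnj (g x))) $ i)) holomorphic_on UNIV" for i
      using holomorphic_on_compose[OF g holomorphic_on_subset[OF holomorphic_on_compose_cnj_cnj[OF j open_UNIV]], of i]
      unfolding o_def by blast
    have "L (X s) (X (cnj t)) = L u u + s * L (u' - u) u + t * L u (u' - u) + s * t * L (u' - u) (u' - u)" for s t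
      unfolding X_def herm_add_left[OF L] herm_add_right[OF L]
        herm_scale_left[OF L] herm_scale_right[OF L] by (simp add: algebra_simps)
    then have 3: "(\<lambda>x. L (X (f x)) (X (cnj (g x)))) holomorphic_on UNIV"
      by (simp only:) (intro holomorphic_intros f g)
    have 4: "(\<lambda>x. Y (f x)) holomorphic_on UNIV" "(\<lambda>x. cnj (Y (cnj (g x)))) holomorphic_on UNIV"
      unfolding Y_def by (auto intro!: holomorphic_intros f g)
    show "(\<lambda>x. G (f x) (cnj (g x))) holomorphic_on UNIV"
      unfolding G_def sesq_form_def
      by (intro holomorphic_intros 1 2 \<Psi> 3 4)
  qed
  moreover have "G s s = 0" for s unfolding G_def using diag[OF XS] by simp
  ultimately have "G 0 1 = 0" by (rule sesquiholomorphic_diagonal_zero)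
  then show ?thesis unfolding G_def X_def Y_def by simp
qed

text \<open>The pullback has no terms of weight below 2m; this supplies the zero blocks of the Gram
  matrix.\<close>

lemma jet_orthogonal:
  assumes "u \<in> S" "u' \<in> S" "1 \<le> a" "1 \<le> b" "a + b < 2 * m"
  shows "sesq_form k A (jet a u w) (jet b u' w') = 0"
  by (rule jet_polarize[where \<Psi> = "\<lambda>_ _ _. 0"])
     (use assms jet_products[of _ a "a + b"] in \<open>auto intro: holomorphic_intros\<close>)

text \<open>The linear coefficient of the m-th power: one factor contributes L, the other m - 1
  contribute cnj w / 2.\<close>

lemma jet_pairing_1:
  assumes "u \<in> S" "u' \<in> S"
  shows "sesq_form k A (jet 1 u w) (jet (2 * m - 1) u' w') = - of_real C * (of_nat m * L u u' * (cnj w' / 2) ^ (m - 1))"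
proof (rule jet_polarize[where \<Psi> = "\<lambda>l w v. - of_real C * (of_nat m * l * (v / 2) ^ (m - 1))", OF _ _ assms])
  show "sesq_form k A (jet 1 u w) (jet (2 * m - 1) u w) = - of_real C * (of_nat m * L u u * (cnj w / 2) ^ (m - 1))" if "u \<in> S" for u w
    using jet_products[OF that, of 1 "2 * m" w] m by (simp only: coeff_quadratic_power) simp
qed (auto intro!: holomorphic_intros)

text \<open>Two sources of weight 2 on the left: one factor w / 2, or two factors L. The vectors for
  w and for u^2 use them separately, by setting u' = 0 or w = 0.\<close>

lemma jet_pairing_2:
  assumes "u \<in> S" "u' \<in> S"
  shows "sesq_form k A (jet 2 u w) (jet (2 * m - 2) u' w') =
    - of_real C * (of_nat m * (w / 2) * (cnj w' / 2) ^ (m - 1) + of_nat (m choose 2) * (L u u')\<^sup>2 * (cnj w' / 2) ^ (m - 2))"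
proof (rule jet_polarize[where \<Psi> = "\<lambda>l w v. - of_real C * (of_nat m * (w / 2) * (v / 2) ^ (m - 1) + of_nat (m choose 2) * l\<^sup>2 * (v / 2) ^ (m - 2))", OF _ _ assms])
  show "sesq_form k A (jet 2 u w) (jet (2 * m - 2) u w) =
    - of_real C * (of_nat m * (w / 2) * (cnj w / 2) ^ (m - 1) + of_nat (m choose 2) * (L u u)\<^sup>2 * (cnj w / 2) ^ (m - 2))" if "u \<in> S" for u w
    using jet_products[OF that, of 2 "2 * m" w] m by (simp only: coeff_quadratic_power) simp
qed (auto intro!: holomorphic_intros)

text \<open>The coefficients of a relation are eliminated one block at a time by testing with jets
  of complementary weight. The order of elimination makes each test meet a single surviving block,
  which is nonsingular by dominance or a nonzero number.\<close>

lemma jets_span_lower_bound: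
  fixes e :: "'i \<Rightarrow> complex ^ 'm"
  assumes E: "finite E" and e: "\<And>a. a \<in> E \<Longrightarrow> e a \<in> S"
    and G1: "dominant_gram E (\<lambda>a b. L (e a) (e b))" and G2: "dominant_gram E (\<lambda>a b. (L (e a) (e b))\<^sup>2)"
  shows "3 * card E + 1 < CARD('k)"
proof -
  \<comment> \<open>\<open>None\<close> stands for w; the tags 0, 1, 2 stand for u, u^2 and u
    w^(m-1).\<close>
  define v where "v x = (case x of None \<Rightarrow> jet 2 0 1
      | Some (j, a) \<Rightarrow> if j = 0 then jet 1 (e a) 0 else if j = 1 then jet 2 (e a) 0 else jet (2 * m - 1) (e a) 1)"
    for x :: "(nat \<times> 'i) option"
  define I where "I = insert None (Some ` ({..<3::nat} \<times> E))"
  have S0: "0 \<in> S" using S by (rule vec.subspace_0)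
  have C': "complex_of_real C \<noteq> 0" "complex_of_nat m \<noteq> 0" "complex_of_nat (m choose 2) \<noteq> 0"
    using C m by (auto simp: binomial_eq_0_iff)
  have sum_I: "(\<Sum>x\<in>I. f x) = f None + ((\<Sum>a\<in>E. f (Some (0, a))) + (\<Sum>a\<in>E. f (Some (1, a))) + (\<Sum>a\<in>E. f (Some (2, a))))"
    for f :: "(nat \<times> 'i) option \<Rightarrow> complex"
  proof -
    have "(\<Sum>x\<in>I. f x) = f None + (\<Sum>x\<in>{..<3} \<times> E. f (Some x))"
      unfolding I_def using E by (subst sum.insert) (auto simp: sum.reindex)
    also have "(\<Sum>x\<in>{..<3} \<times> E. f (Some x)) = (\<Sum>j<3. \<Sum>a\<in>E. f (Some (j, a)))"
      by (simp add: sum.cartesian_product)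
    finally show ?thesis by (simp add: numeral_3_eq_3 numeral_2_eq_2)
  qed
  have "card I < CARD('k)"
  proof (rule gram_card_bound)
    show "finite I" using E by (simp add: I_def)
    fix c i assume z: "\<And>y. (\<Sum>i\<in>I. c i * sesq_form k A (v i) y) = 0" and i: "i \<in> I"
    have rel: "c None * sesq_form k A (jet 2 0 1) y +
        ((\<Sum>a\<in>E. c (Some (0, a)) * sesq_form k A (jet 1 (e a) 0) y) +
         (\<Sum>a\<in>E. c (Some (1, a)) * sesq_form k A (jet 2 (e a) 0) y) +
         (\<Sum>a\<in>E. c (Some (2, a)) * sesq_form k A (jet (2 * m - 1) (e a) 1) y)) = 0" for y
      using z[of y] unfolding sum_I by (simp add: v_def)
    \<comment> \<open>Against weight 1 the vectors of weights 1 and 2 give total weight at most 3 <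
      2m, so only weight 2m - 1 responds.\<close>
    have c2: "c (Some (2, b)) = 0" if b: "b \<in> E" for b
    proof (rule dominant_gram_nonsingular[OF G1 E _ b])
      show "(\<Sum>a\<in>E. c (Some (2, a)) * sesq_form k A (jet (2 * m - 1) (e a) 1) (jet 1 (e b) 0)) = 0" if "b \<in> E" for b
        using rel[of "jet 1 (e b) 0"] m that by (simp add: jet_orthogonal S0 e)
      show "sesq_form k A (jet (2 * m - 1) (e a) 1) (jet 1 (e b) 0) =
          (- of_real C * of_nat m * (1 / 2) ^ (m - 1)) * L (e a) (e b)" if "a \<in> E" "b \<in> E" for a b
        unfolding sesq_form_cnj[OF A, of "jet 1 (e b) 0" "jet (2 * m - 1) (e a) 1", symmetric]
          jet_pairing_1[OF e[OF that(2)] e[OF that(1)]] herm_cnj[OF L, of "e a" "e b"] by simp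
    qed (use C' in simp)
    \<comment> \<open>With u' = 0 and w = 0 both terms of the pairing vanish for the u^2 vectors, so
      this test sees w alone.\<close>
    have cN: "c None = 0"
    proof -
      have "c None * sesq_form k A (jet 2 0 1) (jet (2 * m - 2) 0 1) = 0"
        using rel[of "jet (2 * m - 2) 0 1"] m
        by (simp add: jet_orthogonal S0 e c2 jet_pairing_2 herm_zero_right[OF L])
      then show ?thesis using C' by (simp add: jet_pairing_2 S0 herm_zero_right[OF L])
    qed
    \<comment> \<open>Here w = 0 on the left, which leaves the term with the squared Levi form;
      hence the second dominance condition.\<close>
    have c1: "c (Some (1, b)) = 0" if b: "b \<in> E" for b
    proof (rule dominant_gram_nonsingular[OF G2 E _ b])
      show "(\<Sum>a\<in>E. c (Some (1, a)) * sesq_form k A (jet 2 (e a) 0) (jet (2 * m - 2) (e b) 1)) = 0" if "b \<in> E" for b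
        using rel[of "jet (2 * m - 2) (e b) 1"] m that by (simp add: jet_orthogonal S0 e c2 cN)
      show "sesq_form k A (jet 2 (e a) 0) (jet (2 * m - 2) (e b) 1) =
          (- of_real C * of_nat (m choose 2) * (1 / 2) ^ (m - 2)) * (L (e a) (e b))\<^sup>2" if "a \<in> E" "b \<in> E" for a b
        using jet_pairing_2[OF e[OF that(1)] e[OF that(2)], of 0 1] by simp
    qed (use C' in simp)
    \<comment> \<open>Only the vectors of weight 1 remain, so weight 2m - 1 can be used for
      testing.\<close>
    have c0: "c (Some (0, b)) = 0" if b: "b \<in> E" for b
    proof (rule dominant_gram_nonsingular[OF G1 E _ b])
      show "(\<Sum>a\<in>E. c (Some (0, a)) * sesq_form k A (jet 1 (e a) 0) (jet (2 * m - 1) (e b) 1)) = 0" if "b \<in> E" for b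
        using rel[of "jet (2 * m - 1) (e b) 1"] by (simp add: c1[simplified] c2 cN)
      show "sesq_form k A (jet 1 (e a) 0) (jet (2 * m - 1) (e b) 1) =
          (- of_real C * of_nat m * (1 / 2) ^ (m - 1)) * L (e a) (e b)" if "a \<in> E" "b \<in> E" for a b
        using jet_pairing_1[OF e[OF that(1)] e[OF that(2)], of 0 1] by simp
    qed (use C' in simp)
    show "c i = 0"
    proof (cases i)
      case (Some x)
      then obtain j a where "i = Some (j, a)" "j < 3" "a \<in> E" using i by (auto simp: I_def)
      moreover have "j = 0 \<or> j = 1 \<or> j = 2" using \<open>j < 3\<close> by linarith
      ultimately show ?thesis using c0 c1 c2 by blast
    qed (simp add: cN)
  qed
  moreover have "card I = 3 * card E + 1"
    unfolding I_def using E by (subst card_insert_disjoint) (auto simp: card_image card_cartesian_product)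
  ultimately show ?thesis by simp
qed

end

section \<open>The dichotomy\<close>

text \<open>If every transverse derivative vanishes along M near \<open>p0\<close>, each nearby
  point is reached from M along \<nu> and the pullback is zero there. A nonzero transverse
  derivative is excluded by counting jets at a point where the order is minimal. The inequality on
  cardinalities is n' <= 3 (n - e0) without subtraction.\<close>

lemma pullback_vanishes_near:
  fixes H :: "complex ^ 'm::finite \<Rightarrow> complex ^ 'k::finite"
  assumes M: "real_analytic_hypersurface M" and p0: "p0 \<in> M" and U: "open U" "M \<subseteq> U"
    and H: "holomorphic_map_on H U" and A: "hermitian_matrix k A"
    and zero: "\<And>z. z \<in> M \<Longrightarrow> quadric_fn k A (H z) = 0"
    and dzero: "\<And>z. z \<in> M \<Longrightarrow> frechet_derivative (\<lambda>z. quadric_fn k A (H z)) (at z) = (\<lambda>_. 0)"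
    and dim: "CARD('k) + 3 * e0 M p0 + 2 \<le> 3 * CARD('m)"
  obtains N where "open N" "p0 \<in> N" "N \<subseteq> U" "\<And>z. z \<in> N \<Longrightarrow> quadric_fn k A (H z) = 0"
proof -
  define \<phi> where "\<phi> z = quadric_fn k A (H z)" for z
  define \<psi> where "\<psi> v = iter_deriv \<phi> v" for v
  have \<phi>an: "real_analytic_on \<phi> U"
    unfolding \<phi>_def[abs_def] by (rule real_analytic_quadric_pullback[OF H U(1) A])
  define \<rho> where "\<rho> = (SOME \<rho>. \<exists>W. local_defining_function M p0 W \<rho>)"
  have "\<exists>\<rho> W. local_defining_function M p0 W \<rho>"
    using M p0 unfolding real_analytic_hypersurface_def by blast
  then have "\<exists>W. local_defining_function M p0 W \<rho>" unfolding \<rho>_def by (rule someI_ex)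
  then obtain W where W: "open W" "p0 \<in> W" and \<rho>: "real_analytic_on \<rho> W"
    and d\<rho>: "\<And>x. x \<in> W \<Longrightarrow> fderiv \<rho> x \<noteq> (\<lambda>_. 0)" and MW: "M \<inter> W = {x \<in> W. \<rho> x = 0}"
    unfolding local_defining_function_def by blast
  have e0: "e0 M p0 = vec.dim (levi_eigenspace \<rho> p0 0)" unfolding e0_def \<rho>_def ..
  have \<rho>p0: "\<rho> p0 = 0" using MW W(2) p0 by blast
  obtain v where v: "fderiv \<rho> p0 v \<noteq> 0" using d\<rho>[OF W(2)] by auto
  \<comment> \<open>The sign makes \<rho> increase along \<nu>.\<close>
  define \<nu> where "\<nu> = sgn (fderiv \<rho> p0 v) *\<^sub>R v"
  have \<nu>: "fderiv \<rho> p0 \<nu> > 0"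
    using has_derivative_bounded_linear[OF real_analytic_has_derivative[OF \<rho> W(2)]] v
    unfolding \<nu>_def by (simp add: bounded_linear.linear linear_scale sgn_if)
  obtain E :: "(complex ^ 'm) set" where E: "finite E" "CARD('m) \<le> Suc (card E + vec.dim (levi_eigenspace \<rho> p0 0))"
    and frame: "\<forall>\<^sub>F x in nhds p0. \<exists>e. levi_frame E \<rho> x e"
    by (rule levi_frame_nearby[OF W(1) \<rho> W(2) \<nu>]) (rule that)
  have "\<forall>\<^sub>F x in nhds p0. 0 < fderiv \<rho> x \<nu>"
    using isCont_tendsto_nhds[OF isCont_directional[OF W(1) \<rho> W(2), of \<nu>]] \<nu>
    by (rule order_tendstoD)
  moreover have "\<forall>\<^sub>F x in nhds p0. x \<in> U \<inter> W"
    by (rule eventually_nhds_in_open) (use U W p0 in auto)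
  ultimately have "\<forall>\<^sub>F x in nhds p0. x \<in> U \<inter> W \<and> 0 < fderiv \<rho> x \<nu> \<and>
      (\<exists>e. levi_frame E \<rho> x e)"
    using frame by eventually_elim blast
  then obtain R where R: "R > 0" and near: "\<And>x. dist x p0 < R \<Longrightarrow> x \<in> U \<inter> W \<and> 0 < fderiv \<rho> x \<nu> \<and>
      (\<exists>e. levi_frame E \<rho> x e)"
    unfolding eventually_nhds_metric by blast
  define B where "B = ball p0 R"
  have B: "open B" "convex B" "B \<subseteq> U" "B \<subseteq> W" "p0 \<in> B"
    using near R by (auto simp: B_def dist_commute)
  have all0: "\<psi> \<nu> j y = 0" if y: "y \<in> M \<inter> B" for j y
  proof (rule ccontr)
    assume "\<psi> \<nu> j y \<noteq> 0"
    \<comment> \<open>Least over all of \<open>M \<inter> B\<close>, so that the lower derivatives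
      vanish along M in a whole neighbourhood of the point p chosen next.\<close>
    define m where "m = (LEAST j. \<exists>y\<in>M \<inter> B. \<psi> \<nu> j y \<noteq> 0)"
    have ex: "\<exists>j. \<exists>y\<in>M \<inter> B. \<psi> \<nu> j y \<noteq> 0" using y \<open>\<psi> \<nu> j y \<noteq> 0\<close> by blast
    obtain p where p: "p \<in> M \<inter> B" "\<psi> \<nu> m p \<noteq> 0" using LeastI_ex[OF ex] unfolding m_def by blast
    have below: "\<psi> \<nu> j y = 0" if "j < m" "y \<in> M \<inter> B" for j y
      using not_less_Least[of j "\<lambda>j. \<exists>y\<in>M \<inter> B. \<psi> \<nu> j y \<noteq> 0"] that unfolding m_def by blast
    have "\<psi> \<nu> 0 p = 0" using zero p(1) by (simp add: \<psi>_def \<phi>_def)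
    moreover have "\<psi> \<nu> 1 p = 0" using dzero p(1) by (simp add: \<psi>_def \<phi>_def[abs_def])
    ultimately have "m \<noteq> 0" "m \<noteq> 1" using p(2) by metis+
    then have m: "m \<ge> 2" by simp
    have pW: "p \<in> W" and pU: "p \<in> U" using p(1) B by auto
    have \<rho>p: "\<rho> p = 0" using MW p(1) pW by blast
    have near_p: "0 < fderiv \<rho> p \<nu>"
      using near[of p] p(1) by (simp add: B_def dist_commute)
    obtain e where e: "\<And>a. a \<in> E \<Longrightarrow> e a \<in> levi_space \<rho> p"
      "dominant_gram E (\<lambda>a b. levi_form \<rho> p (e a) (e b))" "dominant_gram E (\<lambda>a b. (levi_form \<rho> p (e a) (e b))\<^sup>2)"
      using near[of p] p(1) by (auto simp: B_def dist_commute)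
    let ?l = "levi_cov \<rho> p" and ?b = "hess_bilin \<rho> p"
    have l\<nu>: "?l \<nu> \<noteq> 0" using near_p Re_levi_cov[OF W(1) \<rho> pW, of \<nu>] by auto
    note ladd = levi_cov_add[OF W(1) \<rho> pW] and lscale = levi_cov_scale[OF W(1) \<rho> pW]
    note bl = hess_bilin_add_left[OF W(1) \<rho> pW] hess_bilin_scale_left[OF W(1) \<rho> pW]
    have br: "?b u (v + w) = ?b u v + ?b u w" "?b u (c *s v) = c * ?b u v" for u v w c
      using bl hess_bilin_sym[OF W(1) \<rho> pW] by metis+
    \<comment> \<open>The Levi covector of the second-order displacement is then
      \<open>w / 2 - ?b u u / 4\<close>; twice its real part cancels the bilinear part of half the
      Hessian and leaves Re w plus the Levi form.\<close>
    define Q where "Q u = - ?b u u / (4 * ?l \<nu>)" for u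
    define C where "C = \<psi> \<nu> m p / fact m / fderiv \<rho> p \<nu> ^ m"
    interpret weighted_jets H U p k A "levi_space \<rho> p" Q "levi_form \<rho> p" \<nu> "1 / (2 * ?l \<nu>)" C m
    proof
      show "vec.subspace (levi_space \<rho> p)"
        unfolding levi_space_eq[OF W(1) \<rho> pW] by (rule hyperplane_dim(1)[of ?l, OF ladd lscale l\<nu>])
      show "hermitian_form (levi_form \<rho> p)"
        unfolding levi_form_eq[OF W(1) \<rho> pW, abs_def] using hermitian_levi_sesq[OF W(1) \<rho> pW] by simp
      show "Q (c *s u) = c\<^sup>2 * Q u" for c u
        unfolding Q_def bl br by (simp add: power2_eq_square)
      show "(\<lambda>s. Q (u + s *s v)) holomorphic_on UNIV" for u v
        unfolding Q_def bl br by (intro holomorphic_intros) (use l\<nu> in auto)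
      show "C \<noteq> 0" unfolding C_def using p(2) near_p by simp
      fix u w assume u: "u \<in> levi_space \<rho> p"
      let ?\<eta> = "(1 / (2 * ?l \<nu>) * w + Q u) *s \<nu>"
      have Du: "fderiv \<rho> p u = 0"
        unfolding Re_levi_cov[OF W(1) \<rho> pW] using u unfolding levi_space_eq[OF W(1) \<rho> pW] by simp
      have "?l ?\<eta> = w / 2 - ?b u u / 4"
        unfolding lscale Q_def using l\<nu> by (simp add: field_simps)
      then have \<kappa>: "fderiv \<rho> p ?\<eta> + hess \<rho> p u u / 2 = Re w + Re (levi_form \<rho> p u u)"
        unfolding Re_levi_cov[OF W(1) \<rho> pW] hess_diag_decompose[OF W(1) \<rho> pW] levi_form_eq[OF W(1) \<rho> pW]
        by (simp add: add_divide_distrib)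
      let ?x = "\<lambda>t. p + t *\<^sub>R u + t\<^sup>2 *\<^sub>R ?\<eta>"
      have "((\<lambda>t. \<phi> (?x t) / t ^ (2 * m)) \<longlongrightarrow>
          iter_deriv \<phi> \<nu> m p / fact m * ((Re w + Re (levi_form \<rho> p u u)) / fderiv \<rho> p \<nu>) ^ m) (at 0)"
      proof (rule transverse_vanishing_asymptotics[OF U(1) \<phi>an pU W(1) \<rho> pW \<rho>p near_p B(1)])
        show "p \<in> B" using p(1) by simp
        show "iter_deriv \<phi> \<nu> j y = 0" if "y \<in> B \<inter> W" "\<rho> y = 0" "j < m" for y j
          using below[OF that(3), of y] MW that unfolding \<psi>_def by blast
        have "((\<lambda>t. ?x t) \<longlongrightarrow> p + 0 *\<^sub>R u + 0\<^sup>2 *\<^sub>R ?\<eta>) (at 0)"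
          by (intro tendsto_intros)
        then show "(?x \<longlongrightarrow> p) (at 0)" by simp
        show "((\<lambda>t. \<rho> (?x t) / t\<^sup>2) \<longlongrightarrow> Re w + Re (levi_form \<rho> p u u)) (at 0)"
          unfolding \<kappa>[symmetric] by (rule defining_function_along_curve[OF W(1) \<rho> pW \<rho>p Du])
      qed
      then show "((\<lambda>t. quadric_fn k A (H (?x t)) / t ^ (2 * m)) \<longlongrightarrow> C * (Re w + Re (levi_form \<rho> p u u)) ^ m) (at 0)"
        by (simp add: C_def \<psi>_def \<phi>_def power_divide)
    qed (use H U pU A m in auto)
    \<comment> \<open>This says n' > 3 card E, whereas card E >= n - e0 at \<open>p0\<close> and the
      assumed inequality give n' <= 3 card E.\<close>
    have "3 * card E + 1 < CARD('k)" by (rule jets_span_lower_bound[OF E(1) e])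
    then show False using E(2) dim unfolding e0 by simp
  qed
  obtain \<delta> K where \<delta>: "\<delta> > 0" and pr:
    "\<And>x. x \<in> ball p0 \<delta> \<Longrightarrow> \<exists>s. \<bar>s\<bar> \<le> K * \<bar>\<rho> x\<bar> \<and> \<rho> (x - s *\<^sub>R \<nu>) = 0 \<and>
       (\<forall>\<sigma>. \<bar>\<sigma>\<bar> \<le> 2 * \<bar>s\<bar> \<longrightarrow> x + \<sigma> *\<^sub>R \<nu> \<in> ball p0 R \<inter> W)"
    by (rule hypersurface_projection[OF W(1) \<rho> W(2) \<rho>p0 \<nu> R]) (rule that)
  show ?thesis
  proof (rule that[of "ball p0 (min \<delta> R)"])
    show "ball p0 (min \<delta> R) \<subseteq> U" using B(3) by (auto simp: B_def)
    fix z assume z: "z \<in> ball p0 (min \<delta> R)"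
    then have "z \<in> ball p0 \<delta>" "z \<in> B" by (auto simp: B_def)
    \<comment> \<open>The second property is the segment clause at \<sigma> = - s: the projected
      point itself lies in the ball.\<close>
    then obtain s where s: "\<rho> (z - s *\<^sub>R \<nu>) = 0" "z + (- s) *\<^sub>R \<nu> \<in> ball p0 R \<inter> W"
      using pr[of z] by (metis abs_ge_zero abs_minus_cancel mult_2 le_add_same_cancel1)
    define y where "y = z - s *\<^sub>R \<nu>"
    have y: "y \<in> M \<inter> B" "y + s *\<^sub>R \<nu> = z" using s MW by (auto simp: y_def B_def)
    have "quadric_fn k A (H (y + s *\<^sub>R \<nu>)) = 0"
    proof (rule pullback_zero_of_iter_derivs[OF H U(1) A B(1-3)])
      show "iter_deriv (\<lambda>z. quadric_fn k A (H z)) \<nu> j y = 0" for j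
        using all0[OF y(1), of j] by (simp add: \<psi>_def \<phi>_def[abs_def])
    qed (use y \<open>z \<in> B\<close> in auto)
    then show "quadric_fn k A (H z) = 0" by (simp add: y(2))
  qed (use \<delta> R in auto)
qed

theorem theorem1p3:
  fixes M U :: "(complex ^ 'm::finite) set"
    and M' :: "(complex ^ 'k::finite) set"
    and H :: "complex ^ 'm \<Rightarrow> complex ^ 'k"
    and n n' :: nat
  assumes "CARD('m) = n + 1" and "CARD('k) = n' + 1"
    and "real_analytic_hypersurface M" and "connected M"
    and "open U" and "M \<subseteq> U"
    and "nondegenerate_hyperquadric M'"
    and "\<exists>p\<in>M. int n' \<le> 3 * (int n - int (e0 M p))"
    and "holomorphic_map_on H U" and "H ` M \<subseteq> M'"
  shows "let
      cond_i = (\<exists>V. open V \<and> V \<subseteq> U \<and> M \<subseteq> V \<and> H ` V \<subseteq> M');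
      cond_ii = (\<exists>A. real_analytic_subset A M \<and> A \<noteq> M \<and> (\<forall>p\<in>M - A. transversal_at H M' p))
    in (cond_i \<or> cond_ii) \<and> \<not> (cond_i \<and> cond_ii)"
proof -
  note U = \<open>open U\<close> \<open>M \<subseteq> U\<close> and H = \<open>holomorphic_map_on H U\<close>
  obtain k A where A: "hermitian_matrix k A" and M'0: "M' = {x. complex_of_real (Im (x $ k)) = sesq_form k A x x}"
    using assms(7) unfolding nondegenerate_hyperquadric_def by blast
  have M': "M' = {x. quadric_fn k A x = 0}" unfolding M'0 by (rule quadric_eq[OF A])
  let ?\<phi> = "\<lambda>z. quadric_fn k A (H z)"
  let ?D = "\<lambda>z. frechet_derivative ?\<phi> (at z)"
  have zero: "?\<phi> z = 0" if "z \<in> M" for z using assms(10) that unfolding M' by blast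
  have an: "real_analytic_on ?\<phi> U" by (rule real_analytic_quadric_pullback[OF H U(1) A])
  have transv: "transversal_at H M' z \<longleftrightarrow> ?D z \<noteq> (\<lambda>_. 0)" if z: "z \<in> M" for z
  proof -
    obtain D where "(H has_derivative D) (at z)" using H z U(2) unfolding holomorphic_map_on_def by blast
    then show ?thesis unfolding M' by (rule transversal_at_quadric_iff) (rule zero[OF z])
  qed
  \<comment> \<open>The locus of nontransversality. It is cut out in M by the real partial
    derivatives of the pullback, with U serving as neighbourhood of every point, and so is a
    candidate for the exceptional set unless it is all of M.\<close>
  define T where "T = {z \<in> M. ?D z = (\<lambda>_. 0)}"
  have T_an: "real_analytic_subset T M"
    unfolding real_analytic_subset_def
  proof (intro conjI ballI)
    fix q assume q: "q \<in> M"
    let ?F = "(\<lambda>b z. ?D z b) ` Basis"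
    have "?D z = (\<lambda>_. 0) \<longleftrightarrow> (\<forall>b\<in>Basis. ?D z b = 0)" if "z \<in> U" for z
    proof
      assume "\<forall>b\<in>Basis. ?D z b = 0"
      then have "?D z v = 0" for v
        by (subst frechet_derivative_expand[OF real_analytic_differentiable[OF an that]]) simp
      then show "?D z = (\<lambda>_. 0)" by (rule ext)
    qed simp
    then have "T \<inter> U = {x \<in> M \<inter> U. \<forall>f\<in>?F. f x = 0}" by (auto simp: T_def)
    then show "\<exists>W F. open W \<and> q \<in> W \<and> finite F \<and> (\<forall>f\<in>F. real_analytic_on f W) \<and> T \<inter> W = {x \<in> M \<inter> W. \<forall>f\<in>F. f x = 0}"
      using U q real_analytic_partial[OF an]
      by (intro exI[of _ U] exI[of _ ?F]) (auto intro: finite_imageI)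
  qed (simp add: T_def)
  have i: "\<exists>V. open V \<and> V \<subseteq> U \<and> M \<subseteq> V \<and> H ` V \<subseteq> M'" if T: "T = M"
  proof -
    obtain p0 where p0: "p0 \<in> M" "int n' \<le> 3 * (int n - int (e0 M p0))" using assms(8) by blast
    have dz: "?D z = (\<lambda>_. 0)" if "z \<in> M" for z using T that unfolding T_def by blast
    have dim: "CARD('k) + 3 * e0 M p0 + 2 \<le> 3 * CARD('m)"
    proof -
      have "int (CARD('k) + 3 * e0 M p0 + 2) \<le> int (3 * CARD('m))"
        unfolding assms(1,2) using p0(2) by simp
      then show ?thesis by (simp only: of_nat_le_iff)
    qed
    obtain N where N: "open N" "p0 \<in> N" "N \<subseteq> U" "\<And>z. z \<in> N \<Longrightarrow> ?\<phi> z = 0"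
      by (rule pullback_vanishes_near[OF assms(3) p0(1) U H A _ _ dim]) (blast intro: zero dz that)+
    \<comment> \<open>The largest open subset of U on which the pullback vanishes; its trace on the
      connected set M turns out to be open, closed and nonempty.\<close>
    define Z where "Z = \<Union>{N. open N \<and> N \<subseteq> U \<and> (\<forall>z\<in>N. ?\<phi> z = 0)}"
    have Z: "open Z" "Z \<subseteq> U" "\<And>z. z \<in> Z \<Longrightarrow> ?\<phi> z = 0" unfolding Z_def by auto
    have op: "openin (top_of_set M) (M \<inter> Z)" using Z(1) by (rule openin_open_Int)
    have "openin (top_of_set M) (M - Z)"
      unfolding openin_contains_ball
    proof (intro conjI ballI)
      fix q assume q: "q \<in> M - Z"
      then obtain r where r: "r > 0" "ball q r \<subseteq> U" using U open_contains_ball by blast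
      have "ball q r \<inter> Z = {}"
      proof (rule ccontr)
        assume "ball q r \<inter> Z \<noteq> {}"
        then obtain q1 where q1: "q1 \<in> ball q r" "q1 \<in> Z" by blast
        \<comment> \<open>A ball in U that meets Z is swallowed by Z through unique continuation, so
          q could not lie outside Z.\<close>
        have "?\<phi> x = 0" if "x \<in> ball q r" for x
          by (rule pullback_zero_on_ball[OF H A open_ball convex_ball r(2) q1(1) Z(1) q1(2) Z(3) that])
        then have "ball q r \<subseteq> Z" unfolding Z_def using r(2) by blast
        then have "q \<in> Z" using r(1) centre_in_ball by blast
        then show False using q by blast
      qed
      then show "\<exists>e>0. ball q e \<inter> M \<subseteq> M - Z" using r(1) by blast
    qed simp
    then have cl: "closedin (top_of_set M) (M \<inter> Z)"
      by (simp add: closedin_def Diff_Int)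
    have "p0 \<in> M \<inter> Z" unfolding Z_def using N p0(1) by blast
    then have "M \<inter> Z = M" using assms(4) op cl unfolding connected_clopen by blast
    moreover have "H ` Z \<subseteq> M'" using Z(3) unfolding M' by blast
    ultimately show ?thesis using Z(1,2) by blast
  qed
  have excl: "\<not> (\<exists>A. real_analytic_subset A M \<and> A \<noteq> M \<and> (\<forall>p\<in>M - A. transversal_at H M' p))"
    if V: "open V" "M \<subseteq> V" "H ` V \<subseteq> M'" for V
  proof clarify
    fix A assume h: "real_analytic_subset A M" "A \<noteq> M" "\<forall>p\<in>M - A. transversal_at H M' p"
    then obtain p where p: "p \<in> M - A" unfolding real_analytic_subset_def by blast
    \<comment> \<open>Under the first alternative the pullback is identically zero near p, so its
      differential vanishes and transversality fails at every point of M.\<close>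
    have "(?\<phi> has_derivative (\<lambda>_. 0)) (at p)"
      by (rule has_derivative_transform_within_open[OF has_derivative_const[of 0] V(1)])
         (use V(2,3) p M' in auto)
    from frechet_derivative_at[OF this] have "?D p = (\<lambda>_. 0)" by simp
    then show False using h(3) p transv by blast
  qed
  have ii: "\<forall>p\<in>M - T. transversal_at H M' p"
    using transv unfolding T_def by blast
  show ?thesis
    unfolding Let_def
  proof (intro conjI notI)
    show "(\<exists>V. open V \<and> V \<subseteq> U \<and> M \<subseteq> V \<and> H ` V \<subseteq> M') \<or>
        (\<exists>A. real_analytic_subset A M \<and> A \<noteq> M \<and> (\<forall>p\<in>M - A. transversal_at H M' p))"
    proof (cases "T = M")
      case False
      then show ?thesis using T_an ii by (intro disjI2 exI[of _ T] conjI)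
    qed (rule disjI1, rule i)
    assume h: "(\<exists>V. open V \<and> V \<subseteq> U \<and> M \<subseteq> V \<and> H ` V \<subseteq> M') \<and>
        (\<exists>A. real_analytic_subset A M \<and> A \<noteq> M \<and> (\<forall>p\<in>M - A. transversal_at H M' p))"
    obtain V where "open V" "M \<subseteq> V" "H ` V \<subseteq> M'" using conjunct1[OF h] by (elim exE conjE)
    from excl[OF this] conjunct2[OF h] show False by (rule notE)
  qed
qed

end
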